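(* Given $\Lambda$-periodic $u_0\in L^\infty(\Lambda)\cap BV(\Lambda)$, there is at most one periodic entropy solution (in the sense defined in the context) of the initial value problem $\partial_tu+\partial_x\cdot f(u)=\mathcal{L}^\mu[u]$ in $D_T$, $u(\cdot,0)=u_0$ in $\Lambda$.
   Context: Let $d\ge1$, $T>0$, $\Lambda=(0,2\pi)^d$, $D_T=\Lambda\times(0,T)$. A function is $\Lambda$-periodic if it is $2\pi$-periodic in each space coordinate; a subscript $p$ on a function space indicates $\Lambda$-periodicity in the space variables. $\partial_x=(\partial_1,\dots,\partial_d)$ is the spatial gradient. Standing assumptions. $f=(f_1,\dots,f_d)$ with $f_j\in C^s(\mathbb{R})$ for an integer $s>4+[d/2]$ ($[\cdot]$ is the integer part). $\mu\ge0$ is a Radon measure on $\mathbb{R}^d\setminus\{0\}$ with $\int_{|z|>0}|z|^2\wedge1\,d\mu(z)<\infty$, where $a\wedge b=\min(a,b)$. The nonlocal operator is $$\mathcal{L}^\mu[\phi](x)=\int_{|z|>0}\phi(x+z)-\phi(x)-z\cdot\partial_x\phi(x)\mathbf{1}_{|z|<1}\,d\mu(z).$$ For $r>0$ set $$\mathcal{L}^{*,\mu}_r[\phi](x)=\int_{|z|\le r}\phi(x-z)-\phi(x)+z\cdot\partial_x\phi(x)\mathbf{1}_{|z|<1}\,d\mu(z),$$ $$\mathcal{L}^{\mu,r}[\phi](x)=\int_{|z|>r}\phi(x+z)-\phi(x)\,d\mu(z),\qquad \gamma_\mu^r=\int_{r<|z|<1}z\,d\mu(z)$$ (with $\gamma_\mu^r=0$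 if $r>1$), and $\eta(u,k)=|u-k|$, $\eta'(u,k)=\mathrm{sgn}(u-k)$, $q_j(u,k)=\eta'(u,k)(f_j(u)-f_j(k))$, $q=(q_1,\dots,q_d)$. Definition. $u$ is a periodic entropy solution of the initial value problem with datum $u_0$ if: (i) $u\in C([0,T];L^\infty_p(\mathbb{R}^d))$; (ii) for all $k\in\mathbb{R}$, all $r>0$, and all nonnegative $\varphi\in C_p^\infty(\mathbb{R}^d\times(0,T))$ (smooth, $\Lambda$-periodic in $x$) with compact support in time in $(0,T)$, $$\iint_{D_T}\eta(u,k)\partial_t\varphi+q(u,k)\cdot\partial_x\varphi+\eta(u,k)\mathcal{L}^{*,\mu}_r[\varphi]+\eta'(u,k)\mathcal{L}^{\mu,r}[u]\varphi+\eta(u,k)\gamma_\mu^r\cdot\partial_x\varphi\;dx\,dt\ge0;$$ (iii) $\mathrm{esslim}_{t\to0}\|u(\cdot,t)-u_0\|_{L^1(\Lambda)}=0$. *)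

theory Defs
  imports "HOL-Analysis.Analysis" "HOL-Probability.Essential_Supremum"
begin

text \<open>
  Space is \<open>real ^ 'n\<close> with \<open>d = CARD('n)\<close>. A function \<open>g\<close> of \<open>(x, t)\<close> is curried with time first,
  so that \<open>g t\<close> is the function of the space variable usually written \<open>g(\<cdot>, t)\<close>.
\<close>

section \<open>Differentiation\<close>

text \<open>
  For open \<open>S\<close>, \<open>Ck_on k g S\<close> says that \<open>g\<close> is of class \<open>C^k\<close> on \<open>S\<close>: the derivative in every
  fixed direction is again of class \<open>C^(k-1)\<close>.
\<close>

primrec Ck_on :: "nat \<Rightarrow> ('a::euclidean_space \<Rightarrow> 'b::euclidean_space) \<Rightarrow> 'a set \<Rightarrow> bool" where
  "Ck_on 0 g S \<longleftrightarrow> continuous_on S g"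
| "Ck_on (Suc k) g S \<longleftrightarrow>
     (\<forall>x\<in>S. g differentiable (at x)) \<and> (\<forall>v. Ck_on k (\<lambda>x. frechet_derivative g (at x) v) S)"

definition Cinf_on :: "('a::euclidean_space \<Rightarrow> 'b::euclidean_space) \<Rightarrow> 'a set \<Rightarrow> bool" where
  "Cinf_on g S \<longleftrightarrow> (\<forall>k. Ck_on k g S)"

definition grad :: "(real ^ 'n \<Rightarrow> real) \<Rightarrow> real ^ 'n \<Rightarrow> real ^ 'n" where
  "grad g x = (\<chi> i. frechet_derivative g (at x) (axis i 1))"

definition divergence :: "(real ^ 'n \<Rightarrow> real ^ 'n) \<Rightarrow> real ^ 'n \<Rightarrow> real" where
  "divergence \<psi> x = (\<Sum>i\<in>UNIV. frechet_derivative \<psi> (at x) (axis i 1) $ i)"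

section \<open>Function spaces\<close>

definition Lam :: "(real ^ 'n) set" where
  "Lam = {x. \<forall>i. 0 < x $ i \<and> x $ i < 2 * pi}"

definition periodic :: "(real ^ 'n \<Rightarrow> real) \<Rightarrow> bool" where
  "periodic g \<longleftrightarrow> (\<forall>i x. g (x + axis i (2 * pi)) = g x)"

text \<open>Periodicity of the class of \<open>g\<close> modulo equality almost everywhere.\<close>

definition AE_periodic :: "(real ^ 'n \<Rightarrow> real) \<Rightarrow> bool" where
  "AE_periodic g \<longleftrightarrow> (\<forall>i. AE x in lborel. g (x + axis i (2 * pi)) = g x)"

definition Linf_norm :: "'a measure \<Rightarrow> ('a \<Rightarrow> real) \<Rightarrow> ereal" where
  "Linf_norm M g = esssup M (\<lambda>x. ereal \<bar>g x\<bar>)"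

definition Linf :: "'a measure \<Rightarrow> ('a \<Rightarrow> real) set" where
  "Linf M = {g \<in> borel_measurable M. Linf_norm M g < \<infinity>}"

definition Linf_p :: "(real ^ 'n \<Rightarrow> real) set" where
  "Linf_p = {g \<in> Linf lborel. AE_periodic g}"

text \<open>
  An element of \<open>C([0,T]; Linf_p)\<close> is a curve of classes modulo equality almost everywhere. Being
  a uniform limit of curves that are piecewise constant in time, it always has a representative
  that is jointly Borel measurable in \<open>(t, x)\<close>; it is such a representative that is meant here.
  (Borel rather than Lebesgue measurability makes \<open>z \<mapsto> u t (x + z)\<close> measurable for every Borel
  measure in \<open>z\<close>.)
\<close>

definition C_Linf_p :: "real \<Rightarrow> (real \<Rightarrow> real ^ 'n \<Rightarrow> real) set" where
  "C_Linf_p T = {u.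
     (\<lambda>(t, x). u t x) \<in> borel_measurable (restrict_space borel ({0..T} \<times> UNIV)) \<and>
     (\<forall>t\<in>{0..T}. u t \<in> Linf_p) \<and>
     (\<forall>t\<in>{0..T}. ((\<lambda>s. Linf_norm lborel (\<lambda>x. u s x - u t x)) \<longlongrightarrow> 0) (at t within {0..T}))}"

definition total_variation :: "(real ^ 'n) set \<Rightarrow> (real ^ 'n \<Rightarrow> real) \<Rightarrow> ereal" where
  "total_variation \<Omega> g =
     (SUP \<psi> \<in> {\<psi> :: real ^ 'n \<Rightarrow> real ^ 'n. Ck_on 1 \<psi> UNIV \<and>
                 compact (closure {x. \<psi> x \<noteq> 0}) \<and> closure {x. \<psi> x \<noteq> 0} \<subseteq> \<Omega> \<and>
                 (\<forall>x. norm (\<psi> x) \<le> 1)}.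
        ereal (LINT x|lebesgue_on \<Omega>. g x * divergence \<psi> x))"

definition BV :: "(real ^ 'n) set \<Rightarrow> (real ^ 'n \<Rightarrow> real) set" where
  "BV \<Omega> = {g. integrable (lebesgue_on \<Omega>) g \<and> total_variation \<Omega> g < \<infinity>}"

definition test_functions :: "real \<Rightarrow> (real \<Rightarrow> real ^ 'n \<Rightarrow> real) set" where
  "test_functions T = {\<phi>.
     Cinf_on (\<lambda>(t, x). \<phi> t x) ({0<..<T} \<times> UNIV) \<and>
     (\<forall>t\<in>{0<..<T}. periodic (\<phi> t)) \<and>
     (\<exists>a b. 0 < a \<and> b < T \<and> (\<forall>t\<in>{0<..<T} - {a..b}. \<forall>x. \<phi> t x = 0))}"

section \<open>The measure and the nonlocal operators\<close>

definition radon_measure_on :: "'a::topological_space set \<Rightarrow> 'a measure \<Rightarrow> bool" where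
  "radon_measure_on S \<mu> \<longleftrightarrow>
     sets \<mu> = sets (restrict_space borel S) \<and>
     (\<forall>K. compact K \<and> K \<subseteq> S \<longrightarrow> emeasure \<mu> K < \<infinity>) \<and>
     (\<forall>A\<in>sets \<mu>. emeasure \<mu> A = (SUP K\<in>{K. compact K \<and> K \<subseteq> A}. emeasure \<mu> K))"

text \<open>
  The measures below live on \<open>- {0}\<close>, so that \<open>z \<noteq> 0\<close> is implicit in the domains of integration.
\<close>

definition Lstar :: "(real ^ 'n) measure \<Rightarrow> real \<Rightarrow> (real ^ 'n \<Rightarrow> real) \<Rightarrow> real ^ 'n \<Rightarrow> real" where
  "Lstar \<mu> r \<phi> x =
     (LINT z:{z. norm z \<le> r}|\<mu>.
        \<phi> (x - z) - \<phi> x + (z \<bullet> grad \<phi> x) * indicator {z. norm z < 1} z)"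

definition Lfar :: "(real ^ 'n) measure \<Rightarrow> real \<Rightarrow> (real ^ 'n \<Rightarrow> real) \<Rightarrow> real ^ 'n \<Rightarrow> real" where
  "Lfar \<mu> r g x = (LINT z:{z. norm z > r}|\<mu>. g (x + z) - g x)"

definition gam :: "(real ^ 'n) measure \<Rightarrow> real \<Rightarrow> real ^ 'n" where
  "gam \<mu> r = (LINT z:{z. r < norm z \<and> norm z < 1}|\<mu>. z)"

section \<open>Entropy solutions\<close>

definition ent :: "real \<Rightarrow> real \<Rightarrow> real" where
  "ent u k = \<bar>u - k\<bar>"

definition ent' :: "real \<Rightarrow> real \<Rightarrow> real" where
  "ent' u k = sgn (u - k)"

definition ent_flux :: "('n \<Rightarrow> real \<Rightarrow> real) \<Rightarrow> real \<Rightarrow> real \<Rightarrow> real ^ 'n" where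
  "ent_flux f u k = (\<chi> j. ent' u k * (f j u - f j k))"

definition entropy_integrand ::
  "('n \<Rightarrow> real \<Rightarrow> real) \<Rightarrow> (real ^ 'n) measure \<Rightarrow> real \<Rightarrow> real \<Rightarrow> (real \<Rightarrow> real ^ 'n \<Rightarrow> real) \<Rightarrow>
   (real \<Rightarrow> real ^ 'n \<Rightarrow> real) \<Rightarrow> real \<Rightarrow> real ^ 'n \<Rightarrow> real" where
  "entropy_integrand f \<mu> k r \<phi> u t x =
     ent (u t x) k * deriv (\<lambda>\<tau>. \<phi> \<tau> x) t
     + ent_flux f (u t x) k \<bullet> grad (\<phi> t) x
     + ent (u t x) k * Lstar \<mu> r (\<phi> t) x
     + ent' (u t x) k * Lfar \<mu> r (u t) x * \<phi> t x
     + ent (u t x) k * (gam \<mu> r \<bullet> grad (\<phi> t) x)"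

text \<open>\<open>esslim_0 g l\<close>: the essential limit of \<open>g t\<close> as \<open>t\<close> decreases to \<open>0\<close> is \<open>l\<close>.\<close>

definition esslim_0 :: "(real \<Rightarrow> real) \<Rightarrow> real \<Rightarrow> bool" where
  "esslim_0 g l \<longleftrightarrow> (\<forall>\<epsilon>>0. \<exists>\<delta>>0. AE t in lborel. 0 < t \<and> t < \<delta> \<longrightarrow> \<bar>g t - l\<bar> < \<epsilon>)"

definition periodic_entropy_solution ::
  "real \<Rightarrow> ('n \<Rightarrow> real \<Rightarrow> real) \<Rightarrow> (real ^ 'n) measure \<Rightarrow> (real ^ 'n \<Rightarrow> real) \<Rightarrow>
   (real \<Rightarrow> real ^ 'n \<Rightarrow> real) \<Rightarrow> bool" where
  "periodic_entropy_solution T f \<mu> u0 u \<longleftrightarrow>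
     u \<in> C_Linf_p T \<and>
     (\<forall>k. \<forall>r>0. \<forall>\<phi>\<in>test_functions T. (\<forall>t\<in>{0<..<T}. \<forall>x. 0 \<le> \<phi> t x) \<longrightarrow>
        0 \<le> (LINT p:{0<..<T} \<times> Lam|lborel. entropy_integrand f \<mu> k r \<phi> u (fst p) (snd p))) \<and>
     esslim_0 (\<lambda>t. LINT x|lebesgue_on Lam. \<bar>u t x - u0 x\<bar>) 0"

end

theory Submission
  imports Defs
begin

text \<open>
  The proof doubles the variables, in the manner of Kruzhkov. Write \<open>p = (t, x)\<close> and \<open>q = (s, y)\<close>. In
  the entropy inequality of \<open>u\<close> the constant is \<open>k = v q\<close>, in that of \<open>v\<close> it is \<open>k = u p\<close>, and both use
  the test function \<open>\<theta> t * \<theta> s * \<kappa> (t - s) * \<omega> (x - y)\<close> with even, smooth, nonnegative \<open>\<kappa>\<close> and \<open>\<omega>\<close>,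
  where \<open>\<omega>\<close> is \<open>\<Lambda>\<close>-periodic. Integrating over both variables and adding, the following happens
  (\<open>doubled_integrand_sum_le\<close>, \<open>doubling_inequality\<close>).

  \<^item> The flux is symmetric in \<open>u\<close> and \<open>v\<close> and the gradient of \<open>\<omega>\<close> is odd, so the flux terms cancel; so
    do the drift terms with \<open>\<gamma>\<close>, and the terms with the derivative of \<open>\<kappa>\<close>.

  \<^item> Large jumps: \<open>sgn (a - b) * ((a' - a) - (b' - b)) \<le> \<bar>a' - b'\<bar> - \<bar>a - b\<bar>\<close>, and the right-hand side
    integrates to zero, since \<open>\<omega> (x - y)\<close> is unchanged when \<open>x\<close> and \<open>y\<close> are translated by the same jump
    \<open>z\<close>, and integrals of periodic functions over \<open>\<Lambda>\<close> are invariant under translation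
    (\<open>simultaneous_shift\<close>).

  \<^item> Small jumps: their contribution is at most a constant, depending on \<open>\<omega>\<close>, times the integral of
    \<open>\<bar>z\<bar>\<^sup>2\<close> over \<open>\<bar>z\<bar> \<le> r\<close>. The kernels are kept fixed while \<open>r\<close> tends to \<open>0\<close>, so it disappears.

  What remains is the nonnegativity of the double integral of
  \<open>\<bar>u p - v q\<bar> * (\<theta>' t * \<theta> s + \<theta> t * \<theta>' s) * \<kappa> (t - s) * \<omega> (x - y)\<close>. Taking for \<open>\<kappa> * \<omega>\<close> the
  \<open>n\<close>-th power of a trigonometric product that has its strict maximum over one period at the origin, and
  letting \<open>n\<close> grow, the variables collapse onto the diagonal (\<open>kernel_concentration\<close>,
  \<open>kato_localization\<close>); the continuity required for this is the continuity of translations in \<open>L\<^sup>1\<close>. Hence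
  the distance \<open>\<Psi> t = \<integral>\<^sub>\<Lambda> \<bar>u t x - v t x\<bar> dx\<close> satisfies \<open>\<integral> 2 \<theta> \<theta>' \<Psi> dt \<ge> 0\<close> for every smooth
  \<open>\<theta> \<ge> 0\<close> with compact support in \<open>(0, T)\<close> (\<open>kato_inequality\<close>).

  If \<open>\<Psi> b > 0\<close>, then a \<open>\<theta>\<close> that climbs near time \<open>0\<close>, where \<open>\<Psi>\<close> is small by the initial condition, and
  falls just after \<open>b\<close>, where \<open>\<Psi>\<close> stays large, contradicts this (\<open>kato_vanishing\<close>). So \<open>u\<close> and \<open>v\<close> agree
  at every interior time, and by continuity in time also at the two ends.
\<close>

type_synonym 'n spacetime = "real \<times> (real ^ 'n)"

section \<open>Smooth functions\<close>

text \<open>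
  Infinite differentiability, stated coinductively: the derivative exists and is again smooth. A family
  of functions closed under differentiation then consists of smooth functions.
\<close>

coinductive smooth_real :: "(real \<Rightarrow> real) \<Rightarrow> bool" where
  "(\<forall>x. (g has_real_derivative g' x) (at x)) \<Longrightarrow> smooth_real g' \<Longrightarrow> smooth_real g"

lemma smooth_real_deriv:
  assumes "smooth_real g"
  obtains g' where "\<And>x. (g has_real_derivative g' x) (at x)" "smooth_real g'"
  using assms by (cases rule: smooth_real.cases) auto

lemma smooth_real_continuous: "smooth_real g \<Longrightarrow> continuous_on UNIV g"
  by (erule smooth_real_deriv) (auto intro!: continuous_at_imp_continuous_on DERIV_isCont)

lemma smooth_real_continuous_deriv:
  assumes g: "smooth_real g" "\<And>t. (g has_real_derivative g' t) (at t)"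
  shows "continuous_on UNIV g'"
proof -
  obtain h where h: "\<And>t. (g has_real_derivative h t) (at t)" "smooth_real h"
    using g(1) by (rule smooth_real_deriv) blast
  have "g' = h" using g(2) h(1) by (intro ext DERIV_unique)
  with smooth_real_continuous[OF h(2)] show ?thesis by simp
qed

text \<open>
  A supply of smooth functions of several variables that is visibly closed under directional
  derivatives, hence contained in every class \<open>C^k\<close>. All test functions below lie in it.
\<close>

inductive_set smooth_algebra :: "('a::euclidean_space \<Rightarrow> real) set" where
  const: "(\<lambda>_. c) \<in> smooth_algebra"
| add: "f \<in> smooth_algebra \<Longrightarrow> g \<in> smooth_algebra \<Longrightarrow> (\<lambda>p. f p + g p) \<in> smooth_algebra"
| mult: "f \<in> smooth_algebra \<Longrightarrow> g \<in> smooth_algebra \<Longrightarrow> (\<lambda>p. f p * g p) \<in> smooth_algebra"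
| comp: "smooth_real g \<Longrightarrow> bounded_linear l \<Longrightarrow> (\<lambda>p. g (l p)) \<in> smooth_algebra"

lemma smooth_algebra_derivative:
  assumes "f \<in> smooth_algebra"
  shows "\<exists>f'. (\<forall>p. (f has_derivative f' p) (at p)) \<and> (\<forall>v. (\<lambda>p. f' p v) \<in> smooth_algebra)"
  using assms
proof induction
  case (const c)
  show ?case
    by (rule exI[of _ "\<lambda>p v. 0"]) (auto intro: smooth_algebra.const)
next
  case (add f g)
  then obtain f' g' where f': "\<And>p. (f has_derivative f' p) (at p)" "\<And>v. (\<lambda>p. f' p v) \<in> smooth_algebra"
    and g': "\<And>p. (g has_derivative g' p) (at p)" "\<And>v. (\<lambda>p. g' p v) \<in> smooth_algebra" by blast
  show ?case
    by (rule exI[of _ "\<lambda>p v. f' p v + g' p v"])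
      (use f' g' in \<open>auto intro: smooth_algebra.add has_derivative_add\<close>)
next
  case (mult f g)
  then obtain f' g' where f': "\<And>p. (f has_derivative f' p) (at p)" "\<And>v. (\<lambda>p. f' p v) \<in> smooth_algebra"
    and g': "\<And>p. (g has_derivative g' p) (at p)" "\<And>v. (\<lambda>p. g' p v) \<in> smooth_algebra" by blast
  show ?case
    by (rule exI[of _ "\<lambda>p v. f p * g' p v + f' p v * g p"])
      (use f' g' mult.hyps in \<open>auto intro!: smooth_algebra.add smooth_algebra.mult has_derivative_mult\<close>)
next
  case (comp g l)
  from comp(1) obtain g' where g': "\<And>x. (g has_real_derivative g' x) (at x)" "smooth_real g'"
    by (rule smooth_real_deriv) blast
  have "((\<lambda>p. g (l p)) has_derivative (\<lambda>v. g' (l p) * l v)) (at p)" for p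
  proof -
    have "(l has_derivative l) (at p)"
      using comp(2) by (rule bounded_linear_imp_has_derivative)
    moreover have "(g has_derivative (*) (g' (l p))) (at (l p))"
      using g'(1)[of "l p"] by (simp add: has_field_derivative_def)
    ultimately show ?thesis
      using has_derivative_compose[of l l p UNIV g "(*) (g' (l p))"] by (simp add: o_def)
  qed
  moreover have "(\<lambda>p. g' (l p) * l v) \<in> smooth_algebra" for v
    by (intro smooth_algebra.mult smooth_algebra.comp smooth_algebra.const g' comp)
  ultimately show ?case
    by (intro exI[of _ "\<lambda>p v. g' (l p) * l v"]) auto
qed

text \<open>
  By induction on \<open>k\<close>, because directional derivatives stay in the algebra.
\<close>

lemma smooth_algebra_Ck_on:
  assumes "f \<in> smooth_algebra" shows "Ck_on k f S"
  using assms
proof (induction k arbitrary: f)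
  case 0
  then obtain f' where "\<And>p. (f has_derivative f' p) (at p)"
    using smooth_algebra_derivative by blast
  then have "continuous_on UNIV f"
    by (meson continuous_at_imp_continuous_on has_derivative_continuous)
  then show ?case by (auto intro: continuous_on_subset)
next
  case (Suc k)
  then obtain f' where f': "\<And>p. (f has_derivative f' p) (at p)" "\<And>v. (\<lambda>p. f' p v) \<in> smooth_algebra"
    using smooth_algebra_derivative by blast
  have "frechet_derivative f (at p) = f' p" for p
    using frechet_derivative_at[OF f'(1)] by simp
  then show ?case
    using f' Suc.IH by (auto simp: differentiable_def)
qed

lemma smooth_algebra_smooth_real:
  fixes f :: "real \<Rightarrow> real"
  assumes "f \<in> smooth_algebra" shows "smooth_real f"
  using assms
proof (coinduction arbitrary: f)
  case (smooth_real f)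
  then obtain f' where f': "\<And>p. (f has_derivative f' p) (at p)" "\<And>v. (\<lambda>p. f' p v) \<in> smooth_algebra"
    using smooth_algebra_derivative by blast
  have "(f has_real_derivative f' p 1) (at p)" for p
    using f'(1)[of p] has_derivative_bounded_linear[OF f'(1)[of p]]
    by (metis has_derivative_imp_has_field_derivative linear_simps(5) mult.commute mult.right_neutral real_scaleR_def)
  then show ?case
    using f'(2)[of 1] by (intro exI[of _ f] exI[of _ "\<lambda>p. f' p 1"]) blast
qed

lemma smooth_real_affine:
  assumes "smooth_real g" shows "smooth_real (\<lambda>x. c * g (a * x + b))"
  using assms
proof (coinduction arbitrary: g c)
  case (smooth_real g c)
  then obtain g' where g': "\<And>x. (g has_real_derivative g' x) (at x)" "smooth_real g'"
    by (rule smooth_real_deriv) blast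
  have "((\<lambda>x. c * g (a * x + b)) has_real_derivative (c * a) * g' (a * x + b)) (at x)" for x
    by (auto intro!: derivative_eq_intros DERIV_chain2[OF g'(1)])
  then show ?case using g'(2)
    by (intro exI[of _ "\<lambda>x. c * g (a * x + b)"] exI[of _ "\<lambda>x. (c * a) * g' (a * x + b)"]) blast
qed

text \<open>
  The shifted cosines are closed under differentiation: a derivative is a further shift by \<open>pi / 2\<close>.
\<close>

lemma smooth_real_cos: "smooth_real cos"
proof -
  have "smooth_real (\<lambda>x. cos (x + b))" for b
  proof (coinduction arbitrary: b)
    case (smooth_real b)
    have "((\<lambda>x. cos (x + b)) has_real_derivative cos (x + (b + pi / 2))) (at x)" for x
      by (auto intro!: derivative_eq_intros simp: cos_add sin_add)
    then show ?case
      by (intro exI[of _ "\<lambda>x. cos (x + b)"] exI[of _ "\<lambda>x. cos (x + (b + pi / 2))"]) blast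
  qed
  from this[of 0] show ?thesis by simp
qed

section \<open>A smooth step\<close>

text \<open>
  The functions \<open>P(1/x) exp(-1/x)\<close> for \<open>x > 0\<close>, extended by zero; with a polynomial factor the family is
  closed under differentiation.
\<close>

definition flat :: "real poly \<Rightarrow> real \<Rightarrow> real" where
  "flat P x = (if 0 < x then poly P (1 / x) * exp (- (1 / x)) else 0)"

lemma poly_over_exp_tendsto_0:
  fixes P :: "real poly" shows "((\<lambda>y. poly P y * exp (- y)) \<longlongrightarrow> 0) at_top"
proof -
  have "((\<lambda>y. \<Sum>i\<le>degree P. coeff P i * (y ^ i / exp y)) \<longlongrightarrow> (\<Sum>i\<le>degree P. coeff P i * 0)) at_top"
    by (intro tendsto_intros tendsto_power_div_exp_0)
  then show ?thesis
    by (simp add: poly_altdef exp_minus sum_distrib_left sum_distrib_right field_simps)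
qed

lemma flat_has_derivative:
  "(flat P has_real_derivative flat ([:0, 0, 1:] * (P - pderiv P)) x) (at x)"
proof -
  consider "x < 0" | "x = 0" | "0 < x" by linarith
  then show ?thesis
  proof cases
    case 1
    have "((\<lambda>_. 0::real) has_real_derivative 0) (at x)" by simp
    then have "(flat P has_real_derivative 0) (at x)"
      by (rule has_field_derivative_transform_within_open[of _ _ _ "{..<0}"]) (use 1 in \<open>auto simp: flat_def\<close>)
    with 1 show ?thesis by (simp add: flat_def)
  next
    case 2
    have *: "((\<lambda>h. flat P h / h) \<longlongrightarrow> 0) (at_right 0)"
    proof -
      have "((\<lambda>h. poly ([:0,1:] * P) (inverse h) * exp (- inverse h)) \<longlongrightarrow> 0) (at_right (0::real))"
        using filterlim_compose[OF poly_over_exp_tendsto_0 filterlim_inverse_at_top_right] .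
      then show ?thesis
        by (rule Lim_transform_eventually)
          (auto simp: flat_def eventually_at_right_field field_simps intro!: exI[of _ 1])
    qed
    moreover have "((\<lambda>h. flat P h / h) \<longlongrightarrow> 0) (at_left 0)"
    proof -
      have "((\<lambda>h::real. 0::real) \<longlongrightarrow> 0) (at_left 0)" by simp
      then show ?thesis
        by (rule Lim_transform_eventually)
          (auto simp: flat_def eventually_at_left_field intro!: exI[of _ "-1"])
    qed
    ultimately have "((\<lambda>h. flat P h / h) \<longlongrightarrow> 0) (at 0)"
      by (simp add: filterlim_split_at)
    then show ?thesis using 2 by (simp add: DERIV_def flat_def)
  next
    case 3
    have "((\<lambda>x. poly P (1 / x) * exp (- (1 / x))) has_real_derivative
        poly ([:0, 0, 1:] * (P - pderiv P)) (1 / x) * exp (- (1 / x))) (at x)"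
      using 3 by (auto intro!: derivative_eq_intros DERIV_chain2[OF poly_DERIV] simp: field_simps power2_eq_square)
    then have "(flat P has_real_derivative poly ([:0, 0, 1:] * (P - pderiv P)) (1 / x) * exp (- (1 / x))) (at x)"
      by (rule has_field_derivative_transform_within_open[of _ _ _ "{0<..}"]) (use 3 in \<open>auto simp: flat_def\<close>)
    with 3 show ?thesis by (simp add: flat_def)
  qed
qed

lemma smooth_real_flat: "smooth_real (flat P)"
  by (coinduction arbitrary: P) (use flat_has_derivative in blast)

text \<open>
  A primitive of the bump \<open>exp(-1/x) exp(-1/(1-x))\<close> on \<open>(0, 1)\<close>; its final value \<open>c\<close> is the integral
  of the bump.
\<close>

lemma smooth_step_exists:
  obtains J J' :: "real \<Rightarrow> real" and c where
    "smooth_real J" "smooth_real J'" "\<And>x. (J has_real_derivative J' x) (at x)" "\<And>x. 0 \<le> J' x"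
    "\<And>x. x \<le> 0 \<Longrightarrow> J x = 0" "\<And>x. 1 \<le> x \<Longrightarrow> J x = c" "0 < c"
    "\<And>x. x \<le> 0 \<or> 1 \<le> x \<Longrightarrow> J' x = 0"
proof -
  define g where "g x = flat 1 x * flat 1 (- x + 1)" for x
  have g: "smooth_real g"
  proof -
    have "flat 1 \<in> smooth_algebra" "(\<lambda>x. flat 1 (- x + 1)) \<in> smooth_algebra"
      using smooth_algebra.comp[OF smooth_real_flat[of 1] bounded_linear_ident]
        smooth_algebra.comp[OF smooth_real_affine[OF smooth_real_flat[of 1], of 1 "-1" 1] bounded_linear_ident]
      by auto
    then show ?thesis
      unfolding g_def by (intro smooth_algebra_smooth_real smooth_algebra.mult)
  qed
  have g_nonneg: "0 \<le> g x" and g_zero: "x \<le> 0 \<or> 1 \<le> x \<Longrightarrow> g x = 0" and g_pos: "0 < x \<Longrightarrow> x < 1 \<Longrightarrow> 0 < g x" for x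
    by (auto simp: g_def flat_def)
  have "continuous_on UNIV g"
    by (metis DERIV_isCont continuous_at_imp_continuous_on g smooth_real.cases)
  then have cont: "continuous_on A g" for A
    by (rule continuous_on_subset) simp
  \<comment> \<open>Integrating from a point left of the support makes the derivative at 0 two-sided.\<close>
  define J where "J x = (if x \<le> -1 then 0 else integral {-1..x} g)" for x
  have J0: "J x = 0" if "x \<le> 0" for x
  proof (cases "x \<le> -1")
    case False
    have "integral {-1..x} g = integral {-1..x} (\<lambda>_. 0)"
      by (rule integral_cong) (use that g_zero in auto)
    then show ?thesis by (simp add: J_def)
  qed (simp add: J_def)
  have J_deriv: "(J has_real_derivative g x) (at x)" for x
  proof (cases "x < 0")
    case True
    have "((\<lambda>_. 0::real) has_real_derivative 0) (at x)" by simp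
    then have "(J has_real_derivative 0) (at x)"
      by (rule has_field_derivative_transform_within_open[of _ _ _ "{..<0}"]) (use True J0 in auto)
    with True show ?thesis using g_zero[of x] by simp
  next
    case False
    have "((\<lambda>u. integral {-1..u} g) has_real_derivative g x) (at x within {-1..x+1})"
      by (rule integral_has_real_derivative[OF cont]) (use False in auto)
    then have "((\<lambda>u. integral {-1..u} g) has_real_derivative g x) (at x)"
      using False at_within_interior[of x "{-1..x+1}"] by simp
    then show ?thesis
      by (rule has_field_derivative_transform_within_open[of _ _ _ "{-1<..}"]) (use False in \<open>auto simp: J_def\<close>)
  qed
  have J1: "J x = J 1" if "1 \<le> x" for x
  proof (cases "x = 1")
    case False
    have "\<exists>l z. 1 < z \<and> z < x \<and> (J has_real_derivative l) (at z) \<and> J x - J 1 = (x - 1) * l"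
      by (rule MVT) (use that False J_deriv in \<open>auto intro!: continuous_at_imp_continuous_on DERIV_isCont simp: real_differentiable_def\<close>)
    then obtain l z where "1 < z" "(J has_real_derivative l) (at z)" "J x - J 1 = (x - 1) * l" by blast
    with g_zero[of z] DERIV_unique[OF J_deriv[of z]] show ?thesis by auto
  qed simp
  have "\<exists>l z. 0 < z \<and> z < 1 \<and> (J has_real_derivative l) (at z) \<and> J 1 - J 0 = (1 - 0) * l"
    by (rule MVT) (use J_deriv in \<open>auto intro!: continuous_at_imp_continuous_on DERIV_isCont simp: real_differentiable_def\<close>)
  then obtain l z where "0 < z" "z < 1" "(J has_real_derivative l) (at z)" "J 1 - J 0 = l" by auto
  with g_pos[of z] DERIV_unique[OF J_deriv[of z]] J0[of 0] have "0 < J 1" by auto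
  moreover have "smooth_real J" using J_deriv g by (blast intro: smooth_real.intros)
  ultimately show ?thesis
    using that[of J g "J 1"] g J_deriv g_nonneg J0 J1 g_zero by blast
qed

section \<open>Integration on Euclidean space\<close>

lemma set_integrable_lborel_bounded:
  fixes f :: "'a::euclidean_space \<Rightarrow> real"
  assumes "A \<in> sets borel" "bounded A" "f \<in> borel_measurable borel" "\<And>x. x \<in> A \<Longrightarrow> \<bar>f x\<bar> \<le> C"
  shows "set_integrable lborel A f"
  unfolding set_integrable_def
  by (rule integrableI_bounded_set_indicator[where B = C])
    (use assms emeasure_bounded_finite[of A] in \<open>auto simp: measurable_lborel1\<close>)

lemma lborel_integral_translation:
  fixes f :: "'a::euclidean_space \<Rightarrow> real"
  assumes "f \<in> borel_measurable borel"
  shows "(LINT x|lborel. f (x + c)) = (LINT x|lborel. f x)"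
proof -
  have "(LINT x|lborel. f x) = (LINT x|distr lborel borel ((+) c). f x)"
    by (simp add: lborel_distr_plus)
  also have "\<dots> = (LINT x|lborel. f (c + x))"
    by (rule integral_distr) (use assms in auto)
  finally show ?thesis by (simp add: add.commute)
qed

lemma continuous_bounded_Icc:
  fixes g :: "real \<Rightarrow> real"
  assumes "continuous_on UNIV g"
  obtains C where "\<And>t. t \<in> {a..b} \<Longrightarrow> \<bar>g t\<bar> \<le> C"
proof -
  have "compact (g ` {a..b})"
    using assms by (intro compact_continuous_image) (auto intro: continuous_on_subset)
  then have "bounded (g ` {a..b})" by (rule compact_imp_bounded)
  then obtain C where "\<forall>x\<in>g ` {a..b}. norm x \<le> C" unfolding bounded_iff by blast
  with that[of C] show thesis by simp
qed

lemma fst_borel [measurable]: "fst \<in> borel_measurable (borel :: ('a::topological_space \<times> 'b::topological_space) measure)"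
  by (intro borel_measurable_continuous_onI continuous_intros)

lemma snd_borel [measurable]: "snd \<in> borel_measurable (borel :: ('a::topological_space \<times> 'b::topological_space) measure)"
  by (intro borel_measurable_continuous_onI continuous_intros)

lemma measurable_Pair_left:
  fixes F :: "'a::euclidean_space \<times> 'b::euclidean_space \<Rightarrow> real"
  assumes "F \<in> borel_measurable borel" shows "(\<lambda>y. F (x, y)) \<in> borel_measurable borel"
proof -
  have "(\<lambda>y :: 'b. (x, y)) \<in> borel_measurable borel"
    by (intro borel_measurable_continuous_onI continuous_intros)
  from measurable_compose[OF this assms] show ?thesis .
qed

lemma sets_borel_pair_lborel:
  "sets ((borel :: 'a::euclidean_space measure) \<Otimes>\<^sub>M (lborel :: 'b::euclidean_space measure)) = sets borel"
  by (metis borel_prod sets_lborel sets_pair_measure_cong)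

lemma set_integral_Times_iterated:
  fixes F :: "'a::euclidean_space \<times> 'b::euclidean_space \<Rightarrow> real"
  assumes A: "A \<in> sets borel" "bounded A" and B: "B \<in> sets borel" "bounded B"
    and F: "F \<in> borel_measurable borel" "\<And>x y. x \<in> A \<Longrightarrow> y \<in> B \<Longrightarrow> \<bar>F (x, y)\<bar> \<le> C"
  shows "(LINT z:A \<times> B|lborel. F z) = (LINT x:A|lborel. LINT y:B|lborel. F (x, y))"
    and "(LINT z:A \<times> B|lborel. F z) = (LINT y:B|lborel. LINT x:A|lborel. F (x, y))"
proof -
  have AB: "A \<times> B \<in> sets borel"
    unfolding borel_prod[symmetric] using A(1) B(1) by (intro pair_measureI)
  have "set_integrable lborel (A \<times> B) F"
    by (rule set_integrable_lborel_bounded[where C = C])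
      (use F AB A B in \<open>auto intro: bounded_Times\<close>)
  then have int: "integrable (lborel \<Otimes>\<^sub>M lborel) (\<lambda>p. indicator (A \<times> B) p *\<^sub>R F p)"
    by (simp add: set_integrable_def lborel_prod)
  have eq: "(LINT p:A \<times> B|lborel. F p) = (LINT p|(lborel \<Otimes>\<^sub>M lborel). indicator (A \<times> B) p *\<^sub>R F p)"
    by (simp add: set_lebesgue_integral_def lborel_prod)
  also have "\<dots> = (LINT t|lborel. LINT x|lborel. indicator (A \<times> B) (t, x) *\<^sub>R F (t, x))"
    by (rule lborel_pair.integral_fst'[OF int, symmetric])
  also have "\<dots> = (LINT t:A|lborel. LINT x:B|lborel. F (t, x))"
    unfolding set_lebesgue_integral_def
    by (intro Bochner_Integration.integral_cong refl) (simp add: indicator_times mult.assoc)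
  finally show "(LINT z:A \<times> B|lborel. F z) = (LINT x:A|lborel. LINT y:B|lborel. F (x, y))" .
  have "(LINT p|(lborel \<Otimes>\<^sub>M lborel). indicator (A \<times> B) p *\<^sub>R F p) =
      (LINT x|lborel. LINT t|lborel. indicator (A \<times> B) (t, x) *\<^sub>R F (t, x))"
    using lborel_pair.integral_snd[of "\<lambda>t x. indicator (A \<times> B) (t, x) *\<^sub>R F (t, x)"] int
    by (simp add: case_prod_beta')
  also have "\<dots> = (LINT x:B|lborel. LINT t:A|lborel. F (t, x))"
    unfolding set_lebesgue_integral_def
  proof (rule Bochner_Integration.integral_cong[OF refl])
    fix x
    have "(\<lambda>t. indicat_real (A \<times> B) (t, x) *\<^sub>R F (t, x)) = (\<lambda>t. indicator B x * (indicator A t * F (t, x)))"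
      by (simp add: indicator_times ac_simps fun_eq_iff)
    then show "(LINT t|lborel. indicat_real (A \<times> B) (t, x) *\<^sub>R F (t, x)) =
        indicat_real B x *\<^sub>R (LINT t|lborel. indicat_real A t *\<^sub>R F (t, x))" by simp
  qed
  finally show "(LINT z:A \<times> B|lborel. F z) = (LINT y:B|lborel. LINT x:A|lborel. F (x, y))" unfolding eq .
qed

section \<open>Continuity of translations in the mean\<close>

text \<open>
  A Lebesgue measurable function is almost everywhere a limit of continuous functions; truncated at the
  bound of \<open>g\<close>, they converge in \<open>L\<^sup>1\<close> over bounded sets by dominated convergence.
\<close>

lemma L1_approximation_by_continuous:
  fixes g :: "'a::euclidean_space \<Rightarrow> real"
  assumes g: "g \<in> borel_measurable borel" "\<And>x. \<bar>g x\<bar> \<le> M" and A: "A \<in> sets borel" "bounded A" and e: "0 < e"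
  obtains c where "continuous_on UNIV c" "\<And>x. \<bar>c x\<bar> \<le> M" "(LINT x:A|lborel. \<bar>g x - c x\<bar>) < e"
proof -
  have "g \<in> borel_measurable (lebesgue_on UNIV)"
    using measurable_completion[of g lborel borel] g(1) by (simp add: lebesgue_on_UNIV_eq measurable_lborel1)
  then have "g measurable_on UNIV"
    by (simp add: lebesgue_measurable_imp_measurable_on)
  then obtain N h where N: "negligible N" and h: "\<And>n. continuous_on UNIV (h n)"
    and lim: "\<And>x. x \<notin> N \<Longrightarrow> (\<lambda>n. h n x) \<longlonglongrightarrow> g x"
    unfolding measurable_on_def by auto
  define c where "c n x = max (- M) (min M (h n x))" for n :: nat and x
  have c: "continuous_on UNIV (c n)" "\<bar>c n x\<bar> \<le> M" for n x
    unfolding c_def using g(2)[of x] by (auto intro!: continuous_intros h)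
  have [measurable]: "c n \<in> borel_measurable borel" for n
    using c(1) by (rule borel_measurable_continuous_onI)
  have [measurable]: "g \<in> borel_measurable borel" "A \<in> sets borel" by fact+
  have AE: "AE x in lborel. (\<lambda>n. indicator A x * \<bar>g x - c n x\<bar>) \<longlonglongrightarrow> 0"
  proof -
    have "AE x in lebesgue. x \<notin> N"
      using N by (simp add: negligible_iff_null_sets AE_not_in)
    then have "AE x in lborel. x \<notin> N"
      by (simp add: AE_completion_iff)
    then show ?thesis
    proof (rule AE_mp, intro AE_I2 impI)
      fix x assume "x \<notin> N"
      then have "(\<lambda>n. c n x) \<longlonglongrightarrow> max (- M) (min M (g x))"
        unfolding c_def by (intro tendsto_intros lim)
      also have "max (- M) (min M (g x)) = g x"
        using g(2)[of x] by auto
      finally have "(\<lambda>n. indicator A x * \<bar>g x - c n x\<bar>) \<longlonglongrightarrow> indicator A x * \<bar>g x - g x\<bar>"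
        by (intro tendsto_intros)
      then show "(\<lambda>n. indicator A x * \<bar>g x - c n x\<bar>) \<longlonglongrightarrow> 0" by simp
    qed
  qed
  have "(\<lambda>n. LINT x|lborel. indicator A x * \<bar>g x - c n x\<bar>) \<longlonglongrightarrow> (LINT x|(lborel :: 'a measure). 0)"
  proof (rule integral_dominated_convergence[where w = "\<lambda>x. indicator A x * (2 * M)"])
    show "integrable lborel (\<lambda>x. indicator A x * (2 * M))"
      using set_integrable_lborel_bounded[OF A, of "\<lambda>_. 2 * M" "\<bar>2 * M\<bar>"] by (simp add: set_integrable_def)
    show "AE x in lborel. norm (indicator A x * \<bar>g x - c n x\<bar>) \<le> indicator A x * (2 * M)" for n
    proof (intro AE_I2)
      fix x show "norm (indicator A x * \<bar>g x - c n x\<bar>) \<le> indicator A x * (2 * M)"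
        using g(2)[of x] c(2)[of n x] by (auto simp: indicator_def)
    qed
  qed (use AE in auto)
  then have "\<forall>\<^sub>F n in sequentially. (LINT x|lborel. indicator A x * \<bar>g x - c n x\<bar>) < e"
    using e by (intro order_tendstoD) simp_all
  then obtain n where "(LINT x|lborel. indicator A x * \<bar>g x - c n x\<bar>) < e"
    by (auto simp: eventually_sequentially)
  with that[of "c n"] c show ?thesis by (simp add: set_lebesgue_integral_def)
qed

text \<open>
  Compare \<open>g\<close> with a continuous function on a ball that contains all translates by vectors of norm at
  most 1; the continuous function is uniformly continuous there.
\<close>

lemma L1_translation_continuous:
  fixes g :: "'a::euclidean_space \<Rightarrow> real"
  assumes g: "g \<in> borel_measurable borel" "\<And>x. \<bar>g x\<bar> \<le> M" and A: "A \<in> sets borel" "bounded A"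
  shows "((\<lambda>h. LINT x:A|lborel. \<bar>g (x + h) - g x\<bar>) \<longlongrightarrow> 0) (at 0)"
proof -
  have nonneg: "0 \<le> (LINT x:A|lborel. \<bar>g (x + h) - g x\<bar>)" for h
    unfolding set_lebesgue_integral_def by (intro integral_nonneg_AE AE_I2) auto
  note [measurable] = g(1) A(1)
  have [measurable]: "cball (0::'a) \<rho> \<in> sets borel" for \<rho> by (intro borel_closed closed_cball)
  obtain R where R: "A \<subseteq> ball 0 R"
    using A(2) bounded_subset_ballD by blast
  let ?B = "cball (0::'a) (R + 1)"
  have M: "0 \<le> M" using g(2)[of 0] by linarith
  have "\<exists>d>0. \<forall>h. norm h < d \<longrightarrow> (LINT x:A|lborel. \<bar>g (x + h) - g x\<bar>) < e" if e: "0 < e" for e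
  proof -
    obtain c where c: "continuous_on UNIV c" "\<And>x. \<bar>c x\<bar> \<le> M"
      and ce: "(LINT x:?B|lborel. \<bar>g x - c x\<bar>) < e / 3"
      using L1_approximation_by_continuous[OF g, of ?B "e / 3"] e by auto
    have [measurable]: "c \<in> borel_measurable borel"
      using c(1) by (rule borel_measurable_continuous_onI)
    define V where "V = measure lborel A"
    have V: "0 \<le> V" by (simp add: V_def)
    have "uniformly_continuous_on ?B c"
      using c(1) by (intro compact_uniformly_continuous) (auto intro: continuous_on_subset)
    moreover have "0 < e / (3 * (V + 1))" using e V by simp
    ultimately obtain d where d: "0 < d"
      "\<And>x y. x \<in> ?B \<Longrightarrow> y \<in> ?B \<Longrightarrow> dist y x < d \<Longrightarrow> dist (c y) (c x) < e / (3 * (V + 1))"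
      unfolding uniformly_continuous_on_def by meson
    have int: "set_integrable lborel S (\<lambda>x. \<bar>p x - q x\<bar>)"
      if "S \<in> sets borel" "bounded S" "p \<in> borel_measurable borel" "q \<in> borel_measurable borel"
        "\<And>x. \<bar>p x\<bar> \<le> M" "\<And>x. \<bar>q x\<bar> \<le> M" for S p q
    proof (rule set_integrable_lborel_bounded[where C = "2 * M"])
      show "\<bar>\<bar>p x - q x\<bar>\<bar> \<le> 2 * M" if "x \<in> S" for x
        using \<open>\<And>x. \<bar>p x\<bar> \<le> M\<close>[of x] \<open>\<And>x. \<bar>q x\<bar> \<le> M\<close>[of x] by linarith
      show "(\<lambda>x. \<bar>p x - q x\<bar>) \<in> borel_measurable borel"
        using that by measurable
    qed fact+
    have "(LINT x:A|lborel. \<bar>g (x + h) - g x\<bar>) < e" if h: "norm h < min d 1" for h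
    proof -
      have AB: "x \<in> ?B \<and> x + h \<in> ?B" if "x \<in> A" for x
        using that R h norm_triangle_ineq[of x h] by fastforce
      have i1: "set_integrable lborel A (\<lambda>x. \<bar>g (x + h) - c (x + h)\<bar>)"
        and i2: "set_integrable lborel A (\<lambda>x. \<bar>c (x + h) - c x\<bar>)"
        and i3: "set_integrable lborel A (\<lambda>x. \<bar>g x - c x\<bar>)"
        and i4: "set_integrable lborel A (\<lambda>x. \<bar>g (x + h) - g x\<bar>)"
        by (rule int; use g c A in measurable)+
      have B3: "set_integrable lborel ?B (\<lambda>x. \<bar>g x - c x\<bar>)"
        by (rule int; use g c in measurable)
      have "(LINT x:A|lborel. \<bar>g (x + h) - g x\<bar>) \<le>
          (LINT x:A|lborel. (\<bar>g (x + h) - c (x + h)\<bar> + \<bar>c (x + h) - c x\<bar>) + \<bar>g x - c x\<bar>)"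
        by (intro set_integral_mono set_integral_add i1 i2 i3 i4) auto
      also have "\<dots> = (LINT x:A|lborel. \<bar>g (x + h) - c (x + h)\<bar>) + (LINT x:A|lborel. \<bar>c (x + h) - c x\<bar>)
          + (LINT x:A|lborel. \<bar>g x - c x\<bar>)"
        by (simp add: set_integral_add(2)[OF set_integral_add(1)[OF i1 i2] i3] set_integral_add(2)[OF i1 i2])
      also have "(LINT x:A|lborel. \<bar>g x - c x\<bar>) \<le> (LINT x:?B|lborel. \<bar>g x - c x\<bar>)"
        using i3 B3 AB unfolding set_lebesgue_integral_def set_integrable_def
        by (intro integral_mono) (auto simp: indicator_def)
      also have "(LINT x:A|lborel. \<bar>g (x + h) - c (x + h)\<bar>) \<le> (LINT x:?B|lborel. \<bar>g x - c x\<bar>)"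
      proof -
        have eq: "(LINT x:?B|lborel. \<bar>g x - c x\<bar>) = (LINT x|lborel. indicator ?B (x + h) * \<bar>g (x + h) - c (x + h)\<bar>)"
          unfolding set_lebesgue_integral_def
          by (subst lborel_integral_translation[where c = h, symmetric]) auto
        have "integrable lborel (\<lambda>x. indicator ?B (x + h) * \<bar>g (x + h) - c (x + h)\<bar>)"
        proof -
          have "integrable (distr lborel borel ((+) h)) (\<lambda>x. indicator ?B x * \<bar>g x - c x\<bar>)"
            using B3 by (simp add: lborel_distr_plus set_integrable_def)
          then show ?thesis
            by (subst (asm) integrable_distr_eq) (auto simp: add.commute)
        qed
        then show ?thesis
          unfolding eq using i1 AB unfolding set_lebesgue_integral_def set_integrable_def
          by (intro integral_mono) (auto simp: indicator_def)
      qed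
      also have "(LINT x:A|lborel. \<bar>c (x + h) - c x\<bar>) \<le> (LINT x:A|lborel. e / (3 * (V + 1)))"
      proof (rule set_integral_mono[OF i2])
        show "set_integrable lborel A (\<lambda>_. e / (3 * (V + 1)))"
          by (rule set_integrable_lborel_bounded[OF A]) auto
        show "\<bar>c (x + h) - c x\<bar> \<le> e / (3 * (V + 1))" if "x \<in> A" for x
          using d(2)[of x "x + h"] AB[OF that] h by (auto simp: dist_norm)
      qed
      also have "(LINT x:A|lborel. e / (3 * (V + 1))) = V * (e / (3 * (V + 1)))"
        by (simp add: set_lebesgue_integral_def V_def)
      also have "V * (e / (3 * (V + 1))) \<le> e / 3"
        using V e by (simp add: field_simps)
      finally show ?thesis using ce by linarith
    qed
    then show ?thesis using d(1) by (intro exI[of _ "min d 1"]) auto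
  qed
  note small = this
  show ?thesis
  proof (rule LIM_I)
    fix e :: real assume "0 < e"
    then obtain d where "0 < d" "\<forall>h. norm h < d \<longrightarrow> (LINT x:A|lborel. \<bar>g (x + h) - g x\<bar>) < e"
      using small by blast
    then show "\<exists>d>0. \<forall>h. h \<noteq> 0 \<and> norm (h - 0) < d \<longrightarrow> norm ((LINT x:A|lborel. \<bar>g (x + h) - g x\<bar>) - 0) < e"
      using nonneg by (intro exI[of _ d]) simp
  qed
qed

text \<open>
  Laplace's method, reduced to a statement about signs: for large \<open>n\<close> the part of the integral near the
  maximum of \<open>\<kappa>\<close> dominates the rest, so a negative value of \<open>N\<close> at the maximum would make the integral
  negative.
\<close>

lemma kernel_concentration:
  fixes \<kappa> N :: "'a::euclidean_space \<Rightarrow> real"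
  assumes K: "bounded K" "K \<in> sets borel" "0 \<in> interior K"
    and \<kappa>: "continuous_on UNIV \<kappa>" "\<And>x. 0 \<le> \<kappa> x" "\<kappa> 0 = 1" "\<And>x. x \<in> closure K \<Longrightarrow> x \<noteq> 0 \<Longrightarrow> \<kappa> x < 1"
    and N: "N \<in> borel_measurable borel" "\<And>x. x \<in> K \<Longrightarrow> \<bar>N x\<bar> \<le> C" "isCont N 0"
    and int: "\<And>n. 0 \<le> (LINT x:K|lborel. \<kappa> x ^ n * N x)"
  shows "0 \<le> N 0"
proof (rule ccontr)
  assume "\<not> 0 \<le> N 0"
  define c where "c = - N 0 / 2"
  have c: "0 < c" "N 0 < - c" using \<open>\<not> 0 \<le> N 0\<close> by (auto simp: c_def)
  have K0: "0 \<in> K" using K(3) interior_subset by blast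
  have C: "0 \<le> C" using N(2)[OF K0] by linarith
  have [measurable]: "ball (0::'a) \<rho> \<in> sets borel" for \<rho> by (intro borel_open open_ball)
  note [measurable] = N(1) borel_measurable_continuous_onI[OF \<kappa>(1)] K(2)
  note Kb = K(1)
  have cl: "x \<in> closure K" if "x \<in> K" for x using that closure_subset by blast
  obtain d1 where d1: "0 < d1" "ball 0 d1 \<subseteq> K"
    using K(3) by (auto simp: mem_interior)
  have "\<forall>\<^sub>F x in at 0. N x < - c"
    using N(3) c(2) by (intro order_tendstoD) (auto simp: isCont_def)
  then obtain d2 where d2: "0 < d2" "\<And>x. x \<noteq> 0 \<Longrightarrow> dist x 0 < d2 \<Longrightarrow> N x < - c"
    by (auto simp: eventually_at)
  define d where "d = min d1 d2"
  have d: "0 < d" "ball 0 d \<subseteq> K" "\<And>x. x \<in> ball 0 d \<Longrightarrow> N x < - c"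
  proof -
    show "0 < d" using d1(1) d2(1) by (simp add: d_def)
    show "ball 0 d \<subseteq> K" by (rule order_trans[OF subset_ball d1(2)]) (simp add: d_def)
    show "N x < - c" if "x \<in> ball 0 d" for x
    proof (cases "x = 0")
      case False
      then show ?thesis using that by (intro d2(2)) (simp_all add: d_def)
    qed (use c(2) in simp)
  qed
  have "\<exists>q\<ge>0. q < 1 \<and> (\<forall>x\<in>closure K - ball 0 d. \<kappa> x \<le> q)"
  proof (cases "closure K - ball 0 d = {}")
    case False
    have "compact (closure K - ball 0 d)"
      using K(1) by (intro compact_diff) (auto simp: compact_closure)
    then obtain x where x: "x \<in> closure K - ball 0 d" "\<forall>y\<in>closure K - ball 0 d. \<kappa> y \<le> \<kappa> x"
      using continuous_attains_sup[OF _ False continuous_on_subset[OF \<kappa>(1) subset_UNIV]] by blast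
    moreover have "\<kappa> x < 1" using x d(1) \<kappa>(4)[of x] by (cases "x = 0") auto
    ultimately show ?thesis using \<kappa>(2)[of x] by (intro exI[of _ "\<kappa> x"]) auto
  qed (auto intro!: exI[of _ 0])
  then obtain q where q: "0 \<le> q" "q < 1" "\<And>x. x \<in> closure K - ball 0 d \<Longrightarrow> \<kappa> x \<le> q" by blast
  \<comment> \<open>The kernel is at most q away from the origin and exceeds some q' > q in a smaller ball.\<close>
  obtain q' where q': "q < q'" "q' < 1" using dense[OF q(2)] by blast
  have "\<forall>\<^sub>F x in at 0. q' < \<kappa> x"
  proof (rule order_tendstoD)
    show "(\<kappa> \<longlongrightarrow> 1) (at 0)"
      using \<kappa>(1,3) continuous_on_eq_continuous_at[OF open_UNIV, of \<kappa>] by (metis UNIV_I isCont_def)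
  qed (rule q'(2))
  then obtain d3 where d3: "0 < d3" "\<And>x. x \<noteq> 0 \<Longrightarrow> dist x 0 < d3 \<Longrightarrow> q' < \<kappa> x"
    by (auto simp: eventually_at)
  define d' where "d' = min d d3"
  have d': "0 < d'" "d' \<le> d" "\<And>x. x \<in> ball 0 d' \<Longrightarrow> q' < \<kappa> x"
  proof -
    show "0 < d'" "d' \<le> d" using d(1) d3(1) by (auto simp: d'_def)
    show "q' < \<kappa> x" if "x \<in> ball 0 d'" for x
    proof (cases "x = 0")
      case False
      then show ?thesis using that by (intro d3(2)) (simp_all add: d'_def)
    qed (use \<kappa>(3) q'(2) in simp)
  qed
  have bK: "ball 0 d' \<subseteq> K" by (rule order_trans[OF subset_ball[OF d'(2)] d(2)])
  define m where "m = measure lborel (ball (0::'a) d')"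
  have m: "0 < m"
    unfolding m_def by (rule content_ball_pos) (rule d'(1))
  have bound: "c * m \<le> (q / q') ^ n * (C * measure lborel K)" for n
  proof -
    have pw: "\<kappa> x ^ n * N x \<le> C * q ^ n - c * q' ^ n * indicator (ball 0 d') x" if x: "x \<in> K" for x
    proof -
      consider "x \<in> ball 0 d'" | "x \<in> ball 0 d" "x \<notin> ball 0 d'" | "x \<notin> ball 0 d" by blast
      then show ?thesis
      proof cases
        case 1
        have "q' ^ n \<le> \<kappa> x ^ n"
          using d'(3)[OF 1] q(1) q'(1) by (intro power_mono) linarith+
        moreover have "x \<in> ball 0 d" using 1 d'(2) by simp
        then have "c \<le> - N x" using d(3)[of x] by linarith
        ultimately have "c * q' ^ n \<le> (- N x) * \<kappa> x ^ n"
          using c(1) q(1) q'(1) by (intro mult_mono) simp_all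
        moreover have "0 \<le> C * q ^ n" using C q(1) by simp
        ultimately show ?thesis using 1 by (simp add: algebra_simps)
      next
        case 2
        then have "\<kappa> x ^ n * N x \<le> 0"
          using d(3)[OF 2(1)] c(1) \<kappa>(2)[of x] by (intro mult_nonneg_nonpos) simp_all
        moreover have "0 \<le> C * q ^ n" using C q(1) by simp
        ultimately show ?thesis using 2(2) by simp
      next
        case 3
        have "\<kappa> x ^ n * N x \<le> \<kappa> x ^ n * \<bar>N x\<bar>"
          using \<kappa>(2)[of x] by (intro mult_left_mono) auto
        also have "\<dots> \<le> q ^ n * C"
        proof (rule mult_mono)
          show "\<kappa> x ^ n \<le> q ^ n" using q(3)[of x] cl[OF x] 3 \<kappa>(2)[of x] by (intro power_mono) blast+
        qed (use N(2)[OF x] q(1) in simp_all)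
        finally have "\<kappa> x ^ n * N x \<le> q ^ n * C" .
        moreover have "x \<notin> ball 0 d'" using 3 d'(2) by auto
        ultimately show ?thesis by (simp add: mult.commute)
      qed
    qed
    have i1: "set_integrable lborel K (\<lambda>x. \<kappa> x ^ n * N x)"
    proof (rule set_integrable_lborel_bounded[where C = C])
      fix x assume x: "x \<in> K"
      have "\<kappa> x \<le> 1" using \<kappa>(3) \<kappa>(4)[OF cl[OF x]] by (cases "x = 0") auto
      then have "\<kappa> x ^ n * \<bar>N x\<bar> \<le> 1 * C"
        using \<kappa>(2)[of x] N(2)[OF x] by (intro mult_mono power_le_one) auto
      then show "\<bar>\<kappa> x ^ n * N x\<bar> \<le> C" using \<kappa>(2)[of x] by (simp add: abs_mult)
    qed (use Kb in auto)
    have i: "set_integrable lborel K (\<lambda>x. a * indicator (ball 0 d') x)" for a :: real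
      by (rule set_integrable_lborel_bounded[where C = "\<bar>a\<bar>"])
        (use Kb in \<open>auto split: split_indicator\<close>)
    have i': "set_integrable lborel K (\<lambda>x. C * q ^ n)"
      by (rule set_integrable_lborel_bounded[where C = "\<bar>C * q ^ n\<bar>"]) (use Kb in auto)
    note i2 = set_integral_diff(1)[OF i' i]
    have "0 \<le> (LINT x:K|lborel. C * q ^ n - c * q' ^ n * indicator (ball 0 d') x)"
      using int[of n] set_integral_mono[OF i1 i2 pw] by linarith
    also have "\<dots> = (LINT x:K|lborel. C * q ^ n) - (LINT x:K|lborel. c * q' ^ n * indicator (ball 0 d') x)"
      by (rule set_integral_diff(2)[OF i' i])
    also have "(LINT x:K|lborel. c * q' ^ n * indicator (ball 0 d') x) = (LINT x|(lborel :: 'a measure). c * q' ^ n * indicator (ball 0 d') x)"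
      unfolding set_lebesgue_integral_def
      by (rule Bochner_Integration.integral_cong) (use bK in \<open>auto simp: indicator_def\<close>)
    also have "\<dots> = c * q' ^ n * m" by (simp add: m_def)
    also have "(LINT x:K|lborel. C * q ^ n) = C * q ^ n * measure lborel K"
      by (simp add: set_lebesgue_integral_def)
    finally have "c * m * q' ^ n \<le> q ^ n * (C * measure lborel K)" by (simp add: algebra_simps)
    moreover have "0 < q' ^ n" using q(1) q' by simp
    ultimately show ?thesis
      unfolding power_divide times_divide_eq_left by (subst pos_le_divide_eq) simp_all
  qed
  have "(\<lambda>n. (q / q') ^ n) \<longlonglongrightarrow> 0"
    using q(1) q' by (intro LIMSEQ_realpow_zero) simp_all
  then have "(\<lambda>n. (q / q') ^ n * (C * measure lborel K)) \<longlonglongrightarrow> 0 * (C * measure lborel K)"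
    by (rule tendsto_mult_right)
  then have "c * m \<le> 0 * (C * measure lborel K)"
    by (rule LIMSEQ_le_const) (blast intro: bound)
  with mult_pos_pos[OF c(1) m] show False by simp
qed

section \<open>Periodic functions\<close>

lemma AE_lborel_translation:
  fixes c :: "'a::euclidean_space" and P :: "'a \<Rightarrow> bool"
  assumes "AE x in lborel. P x" shows "AE x in lborel. P (x + c)"
proof -
  have "AE x in distr lborel borel ((+) c). P x"
    unfolding lborel_distr_plus by (rule assms)
  then have "AE x in lborel. P (c + x)"
    by (rule AE_distrD[rotated]) simp
  then show ?thesis by (simp add: add.commute)
qed

lemma AE_lborel_component_neq: "AE x in (lborel :: (real ^ 'n) measure). x $ i \<noteq> c"
proof -
  have "negligible {x :: real ^ 'n. x $ i = c}"
    using negligible_standard_hyperplane[of "axis i 1 :: real ^ 'n" c]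
    by (simp add: inner_axis axis_in_Basis_iff)
  then have "AE x in lebesgue. x \<notin> {x :: real ^ 'n. x $ i = c}"
    by (intro AE_not_in) (simp add: negligible_iff_null_sets)
  then show ?thesis by (simp add: AE_completion_iff)
qed

lemma Lam_eq_box: "Lam = box 0 (\<chi> i. 2 * pi)"
  by (auto simp: Lam_def mem_box_cart)

lemma Lam_borel [measurable]: "Lam \<in> sets borel"
  by (simp add: Lam_eq_box)

lemma bounded_Lam: "bounded Lam"
  by (simp add: Lam_eq_box bounded_box)

lemma cell_borel: "{0<..<T::real} \<times> (Lam :: (real ^ 'n) set) \<in> sets borel"
  unfolding borel_prod[symmetric] by (intro pair_measureI) auto

lemma bounded_cell: "bounded ({0<..<T::real} \<times> (Lam :: (real ^ 'n) set))"
  by (intro bounded_Times bounded_Lam) simp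

lemma minus_axis: "x - axis i c = x + axis i (- c :: real)"
  by (simp add: vec_eq_iff axis_def)

lemma plus_axis: "axis i a + axis i b = axis i (a + b :: real)"
  by (simp add: vec_eq_iff axis_def)

lemma Lam_plus_axis_iff:
  "x + axis i a \<in> Lam \<longleftrightarrow> 0 < x $ i + a \<and> x $ i + a < 2 * pi \<and> (\<forall>j. j \<noteq> i \<longrightarrow> 0 < x $ j \<and> x $ j < 2 * pi)"
  by (auto simp: Lam_def axis_def)

lemma axis_zero: "axis i (0 :: real) = 0"
  by (simp add: vec_eq_iff axis_def)

text \<open>
  The translated cell sticks out of \<open>Lam\<close> on one side (the set \<open>Q\<close> below); moving that piece back by one
  period fills exactly the gap left on the other side, up to two hyperplanes.
\<close>

lemma integral_Lam_coordinate_shift: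
  fixes g :: "real ^ 'n \<Rightarrow> real"
  assumes g: "periodic g" "g \<in> borel_measurable borel" "\<And>x. \<bar>g x\<bar> \<le> M" and c: "0 \<le> c" "c \<le> 2 * pi"
  shows "(LINT x:Lam|lborel. g (x + axis i c)) = (LINT x:Lam|lborel. g x)"
proof -
  note [measurable] = g(2)
  define P Q where "P = {x. x - axis i c \<in> Lam \<and> x $ i < 2 * pi}"
    and "Q = {x. x - axis i c \<in> Lam \<and> 2 * pi < x $ i}"
  have [measurable]: "P \<in> sets borel" "Q \<in> sets borel"
    unfolding P_def Q_def by measurable
  have "bounded ((\<lambda>x. axis i c + x) ` Lam)"
    by (rule bounded_translation[OF bounded_Lam])
  moreover have "{x. x - axis i c \<in> Lam} \<subseteq> (\<lambda>x. axis i c + x) ` Lam"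
    by (auto intro!: image_eqI[where x = "_ - axis i c"])
  ultimately have "bounded {x. x - axis i c \<in> Lam}" by (rule bounded_subset)
  then have bPQ: "bounded P" "bounded Q"
    by (auto simp: P_def Q_def elim!: bounded_subset)
  have iP: "integrable lborel (\<lambda>x. indicator P x * g x)" and iQ: "integrable lborel (\<lambda>x. indicator Q x * g x)"
    using set_integrable_lborel_bounded[OF _ bPQ(1) g(2), of M] set_integrable_lborel_bounded[OF _ bPQ(2) g(2), of M] g(3)
    by (auto simp: set_integrable_def)
  have iQ': "integrable lborel (\<lambda>x. indicator Q (x + axis i (2 * pi)) * g x)"
  proof -
    have "integrable (distr lborel borel ((+) (axis i (2 * pi)))) (\<lambda>x. indicator Q x * g x)"
      using iQ by (simp add: lborel_distr_plus)
    then have "integrable lborel (\<lambda>x. indicator Q (axis i (2 * pi) + x) * g (axis i (2 * pi) + x))"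
      by (subst (asm) integrable_distr_eq) auto
    then show ?thesis using g(1) by (simp add: periodic_def add.commute)
  qed
  have "(LINT x:Lam|lborel. g (x + axis i c)) = (LINT x|lborel. indicator Lam x * g (x + axis i c))"
    by (simp add: set_lebesgue_integral_def)
  also have "\<dots> = (LINT x|lborel. indicator Lam (x - axis i c) * g x)"
    by (subst lborel_integral_translation[where c = "axis i c", symmetric]) auto
  also have "\<dots> = (LINT x|lborel. indicator P x * g x + indicator Q x * g x)"
  proof (rule integral_cong_AE)
    show "AE x in lborel. indicator Lam (x - axis i c) * g x = indicator P x * g x + indicator Q x * g x"
      using AE_lborel_component_neq[of i "2 * pi"]
      by eventually_elim (auto simp: P_def Q_def indicator_def)
  qed measurable
  also have "\<dots> = (LINT x|lborel. indicator P x * g x) + (LINT x|lborel. indicator Q x * g x)"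
    using iP iQ by (rule Bochner_Integration.integral_add)
  also have "(LINT x|lborel. indicator Q x * g x) = (LINT x|lborel. indicator Q (x + axis i (2 * pi)) * g x)"
    using g(1) by (subst lborel_integral_translation[where c = "axis i (2 * pi)", symmetric]) (auto simp: periodic_def)
  also have "(LINT x|lborel. indicator P x * g x) + \<dots> =
      (LINT x|lborel. indicator P x * g x + indicator Q (x + axis i (2 * pi)) * g x)"
    using iP iQ' by (rule Bochner_Integration.integral_add[symmetric])
  also have "\<dots> = (LINT x|lborel. indicator Lam x * g x)"
  proof (rule integral_cong_AE)
    have PQ: "indicator P x + indicator Q (x + axis i (2 * pi)) = (indicator Lam x :: real)" if "x $ i \<noteq> c" for x
    proof -
      have "x \<in> P \<longleftrightarrow> x \<in> Lam \<and> c < x $ i"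
        using c Lam_plus_axis_iff[of x i "- c"] Lam_plus_axis_iff[of x i 0]
        by (auto simp: P_def minus_axis axis_zero)
      moreover have "x + axis i (2 * pi) \<in> Q \<longleftrightarrow> x \<in> Lam \<and> x $ i < c"
        using c Lam_plus_axis_iff[of x i "2 * pi - c"] Lam_plus_axis_iff[of x i 0]
        by (auto simp: Q_def minus_axis add.assoc plus_axis axis_zero)
      ultimately show ?thesis using that by (auto simp: indicator_def)
    qed
    show "AE x in lborel. indicator P x * g x + indicator Q (x + axis i (2 * pi)) * g x = indicator Lam x * g x"
      using AE_lborel_component_neq[of i c]
      by eventually_elim (metis PQ distrib_right)
  qed measurable
  finally show ?thesis by (simp add: set_lebesgue_integral_def)
qed

lemma periodic_int_shift:
  assumes "periodic g" shows "g (x + axis i (2 * pi * of_int m)) = g x"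
proof -
  have nat: "g (x + axis i (2 * pi * real k)) = g x" for k x
  proof (induction k arbitrary: x)
    case (Suc k)
    have "x + axis i (2 * pi * real (Suc k)) = (x + axis i (2 * pi * real k)) + axis i (2 * pi)"
      by (simp add: vec_eq_iff axis_def algebra_simps)
    then show ?case using assms Suc by (metis periodic_def)
  qed (simp add: axis_def zero_vec_def[symmetric])
  show ?thesis
  proof (cases "0 \<le> m")
    case True
    then show ?thesis using nat[of x "nat m"] by simp
  next
    case False
    have e: "(x + axis i (2 * pi * of_int m)) + axis i (2 * pi * real (nat (- m))) = x"
      using False by (simp add: vec_eq_iff axis_def)
    then show ?thesis using nat[of "x + axis i (2 * pi * of_int m)" "nat (- m)"] unfolding e by simp
  qed
qed

lemma vec_sum_axis: "(\<Sum>i\<in>UNIV. axis i (z $ i)) = (z :: real ^ 'n)"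
  by (simp add: vec_eq_iff axis_def sum.delta)

text \<open>
  Translation by \<open>z\<close> is done one coordinate at a time; in each coordinate, whole periods are dropped.
\<close>

lemma integral_Lam_shift:
  fixes g :: "real ^ 'n \<Rightarrow> real"
  assumes "periodic g" "g \<in> borel_measurable borel" "\<And>x. \<bar>g x\<bar> \<le> M"
  shows "(LINT x:Lam|lborel. g (x + z)) = (LINT x:Lam|lborel. g x)"
proof -
  have "(LINT x:Lam|lborel. g (x + (\<Sum>i\<in>S. axis i (z $ i)))) = (LINT x:Lam|lborel. g x)" if "finite S" for S
    using that assms
  proof (induction arbitrary: g)
    case (insert i S)
    define m where "m = \<lfloor>z $ i / (2 * pi)\<rfloor>"
    define c where "c = z $ i - 2 * pi * of_int m"
    have "of_int m \<le> z $ i / (2 * pi)" "z $ i / (2 * pi) < of_int m + 1"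
      unfolding m_def by (rule of_int_floor_le, rule real_of_int_floor_add_one_gt)
    then have c: "0 \<le> c" "c \<le> 2 * pi"
      by (simp_all add: c_def field_simps)
    let ?s = "\<Sum>i\<in>S. axis i (z $ i)"
    have "x + (\<Sum>j\<in>insert i S. axis j (z $ j)) = (x + ?s + axis i c) + axis i (2 * pi * of_int m)" for x
      using insert(1,2) by (simp add: vec_eq_iff axis_def c_def)
    then have "g (x + (\<Sum>j\<in>insert i S. axis j (z $ j))) = g ((x + ?s) + axis i c)" for x
      using periodic_int_shift[OF insert.prems(1), of _ i m] by metis
    then have "(LINT x:Lam|lborel. g (x + (\<Sum>j\<in>insert i S. axis j (z $ j)))) =
        (LINT x:Lam|lborel. (\<lambda>y. g (y + axis i c)) (x + ?s))" by simp
    also have "\<dots> = (LINT x:Lam|lborel. g (x + axis i c))"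
    proof (rule insert.IH)
      show "periodic (\<lambda>y. g (y + axis i c))"
        using insert.prems(1) unfolding periodic_def by (metis add.assoc add.commute)
      show "(\<lambda>y. g (y + axis i c)) \<in> borel_measurable borel"
        using insert.prems(2) by measurable
    qed (rule insert.prems(3))
    also have "\<dots> = (LINT x:Lam|lborel. g x)"
      by (rule integral_Lam_coordinate_shift[OF insert.prems(1,2,3) c])
    finally show ?case .
  qed simp
  from this[of UNIV] show ?thesis by (simp add: vec_sum_axis)
qed

definition centered_cube :: "(real ^ 'n) set" where "centered_cube = box (\<chi> i. - pi) (\<chi> i. pi)"

lemma centered_cube_iff: "x \<in> centered_cube \<longleftrightarrow> (\<forall>i. - pi < x $ i \<and> x $ i < pi)"
  by (auto simp: centered_cube_def mem_box_cart)

lemma centered_cube_borel [measurable]: "centered_cube \<in> sets borel"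
  by (simp add: centered_cube_def)

lemma integral_Lam_eq_centered_cube:
  fixes g :: "real ^ 'n \<Rightarrow> real"
  assumes g: "periodic g" "g \<in> borel_measurable borel" "\<And>x. \<bar>g x\<bar> \<le> M"
  shows "(LINT y:Lam|lborel. g y) = (LINT w:centered_cube|lborel. g (x + w))"
proof -
  note [measurable] = g(2)
  let ?p = "\<chi> i. pi"
  have "(LINT y:Lam|lborel. g y) = (LINT y:Lam|lborel. g (y + (x - ?p)))"
    by (rule integral_Lam_shift[OF g, symmetric])
  also have "\<dots> = (LINT y|lborel. indicator Lam (y + ?p) * g ((y + ?p) + (x - ?p)))"
    unfolding set_lebesgue_integral_def
    by (subst lborel_integral_translation[where c = ?p, symmetric]) auto
  also have "\<dots> = (LINT w:centered_cube|lborel. g (x + w))"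
    unfolding set_lebesgue_integral_def
    by (rule Bochner_Integration.integral_cong) (auto simp: indicator_def Lam_def centered_cube_iff add.commute, (smt (verit))+)
  finally show ?thesis .
qed

text \<open>
  The representative of \<open>x\<close> modulo \<open>2 * pi\<close> in the half-open cell, used to turn functions that are
  periodic almost everywhere into functions that are periodic everywhere.
\<close>

definition wrap :: "real ^ 'n \<Rightarrow> real ^ 'n" where
  "wrap x = (\<chi> i. x $ i - 2 * pi * of_int \<lfloor>x $ i / (2 * pi)\<rfloor>)"

lemma wrap_measurable [measurable]: "wrap \<in> borel_measurable borel"
proof (subst borel_measurable_euclidean_space, intro ballI)
  fix e :: "real ^ 'n" assume "e \<in> Basis"
  then obtain i where "e = axis i 1" by (auto simp: Basis_vec_def)
  then show "(\<lambda>x. wrap x \<bullet> e) \<in> borel_measurable borel"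
    by (simp add: wrap_def inner_axis)
qed

lemma wrap_shift: "wrap (x + axis i (2 * pi)) = wrap x"
proof -
  have "\<lfloor>(x $ j + axis i (2 * pi) $ j) / (2 * pi)\<rfloor> = \<lfloor>x $ j / (2 * pi)\<rfloor> + (if i = j then 1 else 0)" for j
    by (auto simp: axis_def add_divide_distrib)
  then show ?thesis
    by (auto simp: wrap_def vec_eq_iff axis_def algebra_simps)
qed

text \<open>
  The translations leaving \<open>g\<close> unchanged almost everywhere form a group containing the countable period
  lattice, and \<open>wrap x\<close> differs from \<open>x\<close> by a lattice vector.
\<close>

lemma AE_periodic_wrap:
  fixes g :: "real ^ 'n \<Rightarrow> real"
  assumes g: "AE_periodic g"
  shows "AE x in lborel. g (wrap x) = g x"
proof -
  define I where "I z \<longleftrightarrow> (AE x in lborel. g (x + z) = g x)" for z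
  have add: "I (z + w)" if "I z" "I w" for z w
    using that(2) AE_lborel_translation[OF that(1)[unfolded I_def], of w]
    unfolding I_def by eventually_elim (simp add: ac_simps)
  have neg: "I (- z)" if "I z" for z
    using AE_lborel_translation[OF that[unfolded I_def], of "- z"] unfolding I_def by eventually_elim simp
  have zero: "I 0" by (simp add: I_def)
  have nat: "I (axis i (2 * pi * real k))" for i k
  proof (induction k)
    case (Suc k)
    have "axis i (2 * pi * real (Suc k)) = axis i (2 * pi * real k) + axis i (2 * pi)"
      by (simp add: vec_eq_iff axis_def algebra_simps)
    moreover have "I (axis i (2 * pi))" using g by (simp add: I_def AE_periodic_def)
    ultimately show ?case using add Suc by simp
  qed (use zero in \<open>simp add: axis_def zero_vec_def[symmetric]\<close>)
  have int: "I (axis i (2 * pi * of_int m))" for i m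
  proof (cases "0 \<le> m")
    case True
    then show ?thesis using nat[of i "nat m"] by simp
  next
    case False
    have "axis i (2 * pi * of_int m) = - axis i (2 * pi * real (nat (- m)))"
      using False by (simp add: vec_eq_iff axis_def)
    then show ?thesis using neg[OF nat[of i "nat (- m)"]] by simp
  qed
  have sum: "I (\<Sum>i\<in>S. axis i (2 * pi * of_int (m i)))" if "finite S" for S and m :: "'n \<Rightarrow> int"
    using that by induction (auto intro: zero add int)
  have "AE x in lborel. \<forall>m :: 'n \<Rightarrow> int. g (x + (\<Sum>i\<in>UNIV. axis i (2 * pi * of_int (m i)))) = g x"
    unfolding AE_all_countable using sum[of UNIV] by (auto simp: I_def)
  then show ?thesis
  proof eventually_elim
    fix x assume *: "\<forall>m :: 'n \<Rightarrow> int. g (x + (\<Sum>i\<in>UNIV. axis i (2 * pi * of_int (m i)))) = g x"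
    have "wrap x = x + (\<Sum>i\<in>UNIV. axis i (2 * pi * of_int (- \<lfloor>x $ i / (2 * pi)\<rfloor>)))"
      by (simp add: vec_eq_iff wrap_def axis_def sum.delta)
    then show "g (wrap x) = g x" using *[rule_format, of "\<lambda>i. - \<lfloor>x $ i / (2 * pi)\<rfloor>"] by (rule ssubst)
  qed
qed

section \<open>Representatives of curves of bounded periodic functions\<close>

lemma C_Linf_p_AE_close:
  assumes u: "u \<in> C_Linf_p T" and t: "t \<in> {0..T}" and e: "0 < e"
  obtains d where "0 < d" "\<And>s. s \<in> {0..T} \<Longrightarrow> \<bar>s - t\<bar> < d \<Longrightarrow> AE x in lborel. \<bar>u s x - u t x\<bar> \<le> e"
proof -
  have "\<forall>\<^sub>F s in at t within {0..T}. Linf_norm lborel (\<lambda>x. u s x - u t x) < ereal e"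
    using u t e by (intro order_tendstoD(2)[where y = 0]) (auto simp: C_Linf_p_def)
  then obtain d where d: "0 < d"
    "\<And>s. s \<in> {0..T} \<Longrightarrow> s \<noteq> t \<Longrightarrow> dist s t < d \<Longrightarrow> Linf_norm lborel (\<lambda>x. u s x - u t x) < ereal e"
    by (auto simp: eventually_at)
  have "AE x in lborel. \<bar>u s x - u t x\<bar> \<le> e" if s: "s \<in> {0..T}" "\<bar>s - t\<bar> < d" for s
  proof (cases "s = t")
    case False
    have "AE x in lborel. ereal \<bar>u s x - u t x\<bar> \<le> Linf_norm lborel (\<lambda>x. u s x - u t x)"
      unfolding Linf_norm_def by (rule esssup_AE)
    moreover have "Linf_norm lborel (\<lambda>x. u s x - u t x) < ereal e"
      using d(2)[OF s(1) False] s(2) by (simp add: dist_real_def)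
    ultimately have "AE x in lborel. ereal \<bar>u s x - u t x\<bar> < ereal e"
      by (auto elim!: eventually_mono dest: le_less_trans)
    then show ?thesis by eventually_elim simp
  qed (use e in simp)
  with d(1) that show ?thesis by blast
qed

text \<open>
  Near each time the norm exceeds its value there by at most 1, and finitely many such neighbourhoods
  cover the compact interval.
\<close>

lemma C_Linf_p_bounded:
  assumes u: "u \<in> C_Linf_p T"
  obtains M where "0 \<le> M" "\<And>t. t \<in> {0..T} \<Longrightarrow> AE x in lborel. \<bar>u t x\<bar> \<le> M"
proof -
  define good where "good t e \<longleftrightarrow> 0 < fst e \<and> 0 \<le> snd e \<and>
    (\<forall>s\<in>{0..T}. \<bar>s - t\<bar> < fst e \<longrightarrow> (AE x in lborel. \<bar>u s x\<bar> \<le> snd e))" for t and e :: "real \<times> real"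
  have "\<exists>e. good t e" if t: "t \<in> {0..T}" for t
  proof -
    have "Linf_norm lborel (u t) < \<infinity>"
      using u t by (auto simp: C_Linf_p_def Linf_p_def Linf_def)
    then obtain N0 where "Linf_norm lborel (u t) \<le> ereal N0"
      by (cases "Linf_norm lborel (u t)") auto
    then have N0: "AE x in lborel. \<bar>u t x\<bar> \<le> N0"
      using esssup_AE[of "\<lambda>x. ereal \<bar>u t x\<bar>" lborel] unfolding Linf_norm_def
      by (auto elim!: eventually_mono dest: order_trans)
    obtain d where d: "0 < d" "\<And>s. s \<in> {0..T} \<Longrightarrow> \<bar>s - t\<bar> < d \<Longrightarrow> AE x in lborel. \<bar>u s x - u t x\<bar> \<le> 1"
      using C_Linf_p_AE_close[OF u t zero_less_one] by metis
    have "AE x in lborel. \<bar>u s x\<bar> \<le> max 0 N0 + 1" if s: "s \<in> {0..T}" "\<bar>s - t\<bar> < d" for s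
      using d(2)[OF s] N0 by eventually_elim linarith
    then show ?thesis using d(1) by (intro exI[of _ "(d, max 0 N0 + 1)"]) (auto simp: good_def)
  qed
  then have "\<forall>t\<in>{0..T}. \<exists>e. good t e" by blast
  then obtain e where e: "\<forall>t\<in>{0..T}. good t (e t)" by (rule bchoice[elim_format]) blast
  define d N where "d t = fst (e t)" and "N t = snd (e t)" for t
  have dN: "0 < d t" "0 \<le> N t" "\<And>s. s \<in> {0..T} \<Longrightarrow> \<bar>s - t\<bar> < d t \<Longrightarrow> (AE x in lborel. \<bar>u s x\<bar> \<le> N t)"
    if "t \<in> {0..T}" for t
    using e that by (auto simp: good_def d_def N_def)
  have cover: "{0..T} \<subseteq> (\<Union>t\<in>{0..T}. ball t (d t))"
    using dN(1) by auto
  obtain S where S: "S \<subseteq> {0..T}" "finite S" "{0..T} \<subseteq> (\<Union>t\<in>S. ball t (d t))"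
    by (rule compactE_image[OF compact_Icc _ cover]) auto
  show thesis
  proof (rule that[of "sum N S"])
    show "0 \<le> sum N S" using S(1) dN(2) by (intro sum_nonneg) auto
    fix s assume s: "s \<in> {0..T}"
    obtain t where t: "t \<in> S" "s \<in> ball t (d t)" using S(3) s by blast
    have "N t \<le> sum N S"
      using S t(1) dN(2) by (intro member_le_sum) auto
    moreover have "AE x in lborel. \<bar>u s x\<bar> \<le> N t"
      using t S(1) s by (intro dN(3)) (auto simp: dist_real_def)
    ultimately show "AE x in lborel. \<bar>u s x\<bar> \<le> sum N S" by (auto elim!: eventually_mono)
  qed
qed

lemma C_Linf_p_jointly_measurable:
  fixes u :: "real \<Rightarrow> real ^ 'n \<Rightarrow> real"
  assumes u: "u \<in> C_Linf_p T"
  shows "(\<lambda>p. if fst p \<in> {0..T} then u (fst p) (snd p) else 0) \<in> borel_measurable borel"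
proof -
  have "(\<lambda>(t, x). u t x) \<in> borel_measurable (restrict_space borel ({0..T} \<times> UNIV))"
    using u by (simp add: C_Linf_p_def)
  moreover have "({0..T} \<times> UNIV) \<inter> space borel \<in> sets (borel :: 'n spacetime measure)"
    by (auto intro!: borel_closed closed_Times)
  ultimately have "(\<lambda>p. if p \<in> {0..T} \<times> UNIV then (case p of (t, x) \<Rightarrow> u t x) else 0) \<in> borel_measurable borel"
    by (subst (asm) measurable_restrict_space_iff[where c = 0]) auto
  also have "(\<lambda>p. if p \<in> {0..T} \<times> UNIV then (case p of (t, x) \<Rightarrow> u t x) else 0) =
      (\<lambda>p. if fst p \<in> {0..T} then u (fst p) (snd p) else 0)"
    by (auto simp: fun_eq_iff)
  finally show ?thesis .
qed

text \<open>
  Truncation and wrapping change \<open>u t\<close> only on null sets. The result is bounded, Borel and periodic at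
  every point, which removes all exceptional sets from the doubling argument.
\<close>

lemma C_Linf_p_periodic_representative:
  fixes u :: "real \<Rightarrow> real ^ 'n \<Rightarrow> real"
  assumes u: "u \<in> C_Linf_p T"
  obtains U M where "U \<in> borel_measurable borel" "\<And>p. \<bar>U p\<bar> \<le> M" "\<And>t. periodic (\<lambda>x. U (t, x))"
    "\<And>t. t \<in> {0..T} \<Longrightarrow> AE x in lborel. U (t, x) = u t x"
proof -
  obtain M where M: "0 \<le> M" "\<And>t. t \<in> {0..T} \<Longrightarrow> AE x in lborel. \<bar>u t x\<bar> \<le> M"
    using C_Linf_p_bounded[OF u] by blast
  define W where "W p = (if fst p \<in> {0..T} then u (fst p) (wrap (snd p)) else 0)" for p
  define U where "U p = max (- M) (min M (W p))" for p
  have "(\<lambda>p :: 'n spacetime. (fst p, wrap (snd p))) \<in> borel_measurable borel"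
    unfolding borel_prod[symmetric] by measurable
  from measurable_compose[OF this C_Linf_p_jointly_measurable[OF u]]
  have [measurable]: "W \<in> borel_measurable borel"
    unfolding W_def[abs_def] fst_conv snd_conv .
  show ?thesis
  proof (rule that[of U M])
    show "U \<in> borel_measurable borel"
      unfolding U_def by measurable
    show "\<bar>U p\<bar> \<le> M" for p using M(1) by (auto simp: U_def)
    show "periodic (\<lambda>x. U (t, x))" for t
      unfolding periodic_def U_def W_def fst_conv snd_conv wrap_shift by simp
    fix t assume t: "t \<in> {0..T}"
    then have "AE_periodic (u t)" using u by (auto simp: C_Linf_p_def Linf_p_def)
    from AE_periodic_wrap[OF this] M(2)[OF t] show "AE x in lborel. U (t, x) = u t x"
      by eventually_elim (use t in \<open>auto simp: U_def W_def\<close>)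
  qed
qed

section \<open>Levy measures\<close>

locale levy_measure =
  fixes \<mu> :: "(real ^ 'n) measure"
  assumes sets_eq: "sets \<mu> = sets (restrict_space borel (- {0}))"
    and levy: "(\<integral>\<^sup>+ z. ennreal (min ((norm z)\<^sup>2) 1) \<partial>\<mu>) < \<infinity>"
begin

lemma space_eq: "space \<mu> = - {0}"
  using sets_eq_imp_space_eq[OF sets_eq] by (simp add: space_restrict_space)

lemma measurable_id [measurable]: "(\<lambda>z. z) \<in> borel_measurable \<mu>"
  by (subst measurable_cong_sets[OF sets_eq refl]) (rule measurable_restrict_space1[OF measurable_ident_sets[OF refl]])

lemma measurable_of_borel:
  "g \<in> borel_measurable borel \<Longrightarrow> g \<in> borel_measurable \<mu>"
  by (rule measurable_compose[OF measurable_id])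

lemma norm_measurable [measurable]: "norm \<in> borel_measurable \<mu>"
  by (rule measurable_of_borel) (intro borel_measurable_continuous_onI continuous_intros)

lemma integrable_min: "integrable \<mu> (\<lambda>z. min ((norm z)\<^sup>2) 1)"
proof (rule integrableI_bounded)
  have "(\<integral>\<^sup>+ z. ennreal (norm (min ((norm z)\<^sup>2) 1)) \<partial>\<mu>) = (\<integral>\<^sup>+ z. ennreal (min ((norm z)\<^sup>2) 1) \<partial>\<mu>)"
    by (intro nn_integral_cong arg_cong[where f = ennreal]) simp
  with levy show "(\<integral>\<^sup>+ z. ennreal (norm (min ((norm z)\<^sup>2) 1)) \<partial>\<mu>) < \<infinity>" by simp
  show "(\<lambda>z. min ((norm z)\<^sup>2) 1) \<in> borel_measurable \<mu>"
    by (intro borel_measurable_min borel_measurable_power norm_measurable borel_measurable_const)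
qed

text \<open>
  Away from the origin \<open>min (\<bar>z\<bar>\<^sup>2) 1\<close> is bounded below, so the measure is finite there; hence it is
  \<open>\<sigma>\<close>-finite and Fubini's theorem applies to it.
\<close>

lemma emeasure_far_finite:
  assumes "0 < r" shows "emeasure \<mu> {z \<in> space \<mu>. r < norm z} < \<infinity>"
proof -
  define c where "c = min (r\<^sup>2) 1"
  have c: "0 < c" using assms by (simp add: c_def)
  have [measurable]: "{z \<in> space \<mu>. r < norm z} \<in> sets \<mu>" by measurable
  have "ennreal c * emeasure \<mu> {z \<in> space \<mu>. r < norm z} = (\<integral>\<^sup>+ z. ennreal c * indicator {z \<in> space \<mu>. r < norm z} z \<partial>\<mu>)"
    by (simp add: nn_integral_cmult_indicator)
  also have "\<dots> \<le> (\<integral>\<^sup>+ z. ennreal (min ((norm z)\<^sup>2) 1) \<partial>\<mu>)"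
  proof (rule nn_integral_mono)
    fix z :: "real ^ 'n"
    have "c \<le> min ((norm z)\<^sup>2) 1" if "r < norm z"
    proof -
      have "r\<^sup>2 \<le> (norm z)\<^sup>2" using that assms by (intro power_mono) auto
      then show ?thesis by (simp add: c_def min.coboundedI1 min.coboundedI2)
    qed
    then show "ennreal c * indicator {z \<in> space \<mu>. r < norm z} z \<le> ennreal (min ((norm z)\<^sup>2) 1)"
      by (auto simp: indicator_def intro!: ennreal_leI)
  qed
  also note levy
  finally have fin: "ennreal c * emeasure \<mu> {z \<in> space \<mu>. r < norm z} < \<infinity>" .
  show ?thesis
  proof (rule ccontr)
    assume "\<not> ?thesis"
    then have "emeasure \<mu> {z \<in> space \<mu>. r < norm z} = top" by (simp add: less_top[symmetric])
    with fin c show False by (simp add: ennreal_mult_top)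
  qed
qed

sublocale sigma_finite_measure \<mu>
proof
  let ?A = "\<lambda>k::nat. {z \<in> space \<mu>. 1 / (real k + 1) < norm z}"
  have "(\<Union>k. ?A k) = space \<mu>"
  proof
    show "space \<mu> \<subseteq> (\<Union>k. ?A k)"
    proof
      fix z assume z: "z \<in> space \<mu>"
      then have "0 < norm z" by (simp add: space_eq)
      then obtain k where "inverse (real (Suc k)) < norm z" using reals_Archimedean by blast
      with z show "z \<in> (\<Union>k. ?A k)" by (auto simp: field_simps intro!: exI[of _ k])
    qed
  qed auto
  moreover have "range ?A \<subseteq> sets \<mu>" by auto
  moreover have "emeasure \<mu> (?A k) \<noteq> \<infinity>" for k
    using emeasure_far_finite[of "1 / (real k + 1)"] by auto
  ultimately show "\<exists>A. countable A \<and> A \<subseteq> sets \<mu> \<and> \<Union> A = space \<mu> \<and> (\<forall>a\<in>A. emeasure \<mu> a \<noteq> \<infinity>)"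
    by (intro exI[of _ "range ?A"]) auto
qed

lemma measurable_shift_pair:
  fixes W :: "'n spacetime \<Rightarrow> real"
  assumes [measurable]: "W \<in> borel_measurable borel"
  shows "(\<lambda>q. W (fst (fst q), snd (fst q) + snd q)) \<in> borel_measurable (borel \<Otimes>\<^sub>M \<mu>)"
proof -
  have [measurable]: "(\<lambda>q. snd q) \<in> borel_measurable ((borel :: 'n spacetime measure) \<Otimes>\<^sub>M \<mu>)"
    using measurable_compose[OF measurable_snd measurable_id] by simp
  have [measurable]: "(\<lambda>q. fst (fst q)) \<in> borel_measurable ((borel :: 'n spacetime measure) \<Otimes>\<^sub>M \<mu>)"
    "(\<lambda>q. snd (fst q)) \<in> borel_measurable ((borel :: 'n spacetime measure) \<Otimes>\<^sub>M \<mu>)"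
    by (auto intro!: measurable_compose[OF measurable_fst] borel_measurable_continuous_onI continuous_intros)
  have "(\<lambda>q. (fst (fst q), snd (fst q) + snd q)) \<in> (borel :: 'n spacetime measure) \<Otimes>\<^sub>M \<mu> \<rightarrow>\<^sub>M borel \<Otimes>\<^sub>M borel"
    by measurable
  then show ?thesis
    unfolding borel_prod by (rule measurable_compose) fact
qed

lemma Lfar_measurable:
  fixes W :: "'n spacetime \<Rightarrow> real"
  assumes [measurable]: "W \<in> borel_measurable borel"
  shows "(\<lambda>p. Lfar \<mu> r (\<lambda>x. W (fst p, x)) (snd p)) \<in> borel_measurable borel"
proof -
  note [measurable] = measurable_shift_pair[OF assms]
  have [measurable]: "(\<lambda>q. indicator {z. r < norm z} (snd q)) \<in> borel_measurable ((borel :: 'n spacetime measure) \<Otimes>\<^sub>M \<mu>)"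
    by (rule measurable_compose[OF measurable_snd]) measurable
  have [measurable]: "(\<lambda>q. W (fst q)) \<in> borel_measurable ((borel :: 'n spacetime measure) \<Otimes>\<^sub>M \<mu>)"
    by (rule measurable_compose[OF measurable_fst assms])
  show ?thesis
    unfolding Lfar_def set_lebesgue_integral_def
    by (rule borel_measurable_lebesgue_integral) (simp add: case_prod_beta)
qed

text \<open>
  The measure \<open>\<mu>\<close> may charge Lebesgue null sets, so changing a function on a null set could affect the
  jump integral at some points \<open>x\<close>. By Fubini's theorem this happens for almost no \<open>x\<close>: each translate of a
  null set is null.
\<close>

lemma AE_Lfar_cong:
  fixes W U :: "'n spacetime \<Rightarrow> real"
  assumes W [measurable]: "W \<in> borel_measurable borel" and U [measurable]: "U \<in> borel_measurable borel"
    and eq: "\<And>t. t \<in> I \<Longrightarrow> AE x in lborel. W (t, x) = U (t, x)" and I: "I \<in> sets borel"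
  shows "AE p in lborel. fst p \<in> I \<longrightarrow> W p = U p \<and>
    Lfar \<mu> r (\<lambda>x. W (fst p, x)) (snd p) = Lfar \<mu> r (\<lambda>x. U (fst p, x)) (snd p)"
proof -
  interpret P: pair_sigma_finite \<mu> "lborel :: (real ^ 'n) measure" ..
  have Wt [measurable]: "(\<lambda>x. W (t, x)) \<in> borel_measurable borel" "(\<lambda>x. U (t, x)) \<in> borel_measurable borel" for t
    by (intro measurable_Pair_left W U)+
  have *: "AE x in lborel. W (t, x) = U (t, x) \<and> Lfar \<mu> r (\<lambda>x. W (t, x)) x = Lfar \<mu> r (\<lambda>x. U (t, x)) x" if t: "t \<in> I" for t
  proof -
    have [measurable]: "(\<lambda>q. fst q) \<in> borel_measurable (\<mu> \<Otimes>\<^sub>M (lborel :: (real ^ 'n) measure))"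
      using measurable_compose[OF measurable_fst measurable_id] by simp
    have [measurable]: "(\<lambda>q. W (t, snd q + fst q)) \<in> borel_measurable (\<mu> \<Otimes>\<^sub>M (lborel :: (real ^ 'n) measure))"
      "(\<lambda>q. U (t, snd q + fst q)) \<in> borel_measurable (\<mu> \<Otimes>\<^sub>M (lborel :: (real ^ 'n) measure))"
      by (auto intro!: measurable_compose[OF _ Wt(1)] measurable_compose[OF _ Wt(2)])
    have "AE z in \<mu>. AE x in lborel. W (t, x + z) = U (t, x + z)"
      using AE_lborel_translation[OF eq[OF t]] by simp
    moreover have "{q \<in> space (\<mu> \<Otimes>\<^sub>M (lborel :: (real ^ 'n) measure)). W (t, snd q + fst q) = U (t, snd q + fst q)}
        \<in> sets (\<mu> \<Otimes>\<^sub>M (lborel :: (real ^ 'n) measure))"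
      by measurable
    ultimately have "AE x in lborel. AE z in \<mu>. W (t, x + z) = U (t, x + z)"
      using P.AE_commute[of "\<lambda>z x. W (t, x + z) = U (t, x + z)"] by simp
    with eq[OF t] show ?thesis
    proof eventually_elim
      case (elim x)
      have [measurable]: "(\<lambda>z. W (t, x + z)) \<in> borel_measurable \<mu>" "(\<lambda>z. U (t, x + z)) \<in> borel_measurable \<mu>"
        by (auto intro!: measurable_compose[OF _ Wt(1)] measurable_compose[OF _ Wt(2)])
      have "Lfar \<mu> r (\<lambda>x. W (t, x)) x = Lfar \<mu> r (\<lambda>x. U (t, x)) x"
        unfolding Lfar_def set_lebesgue_integral_def
      proof (rule integral_cong_AE)
        show "AE z in \<mu>. indicat_real {z. r < norm z} z *\<^sub>R (W (t, x + z) - W (t, x)) =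
          indicat_real {z. r < norm z} z *\<^sub>R (U (t, x + z) - U (t, x))"
          using elim(2) by eventually_elim (simp add: elim(1))
      qed measurable
      with elim(1) show ?case by simp
    qed
  qed
  have "AE p in (lborel :: real measure) \<Otimes>\<^sub>M (lborel :: (real ^ 'n) measure). fst p \<in> I \<longrightarrow> W p = U p \<and>
    Lfar \<mu> r (\<lambda>x. W (fst p, x)) (snd p) = Lfar \<mu> r (\<lambda>x. U (fst p, x)) (snd p)"
  proof (rule lborel_pair.AE_pair_measure)
    note [measurable] = Lfar_measurable[OF W, of r] Lfar_measurable[OF U, of r] I
    have [measurable]: "fst \<in> borel_measurable (borel :: 'n spacetime measure)"
      by (intro borel_measurable_continuous_onI continuous_intros)
    have "{p. fst p \<in> I \<longrightarrow> W p = U p \<and>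
      Lfar \<mu> r (\<lambda>x. W (fst p, x)) (snd p) = Lfar \<mu> r (\<lambda>x. U (fst p, x)) (snd p)} \<in> sets borel"
      by measurable
    moreover have "sets ((lborel :: real measure) \<Otimes>\<^sub>M (lborel :: (real ^ 'n) measure)) = sets borel"
      by (subst lborel_prod) simp
    ultimately show "{p \<in> space (lborel \<Otimes>\<^sub>M lborel). fst p \<in> I \<longrightarrow> W p = U p \<and>
      Lfar \<mu> r (\<lambda>x. W (fst p, x)) (snd p) = Lfar \<mu> r (\<lambda>x. U (fst p, x)) (snd p)}
      \<in> sets ((lborel :: real measure) \<Otimes>\<^sub>M (lborel :: (real ^ 'n) measure))"
      by (simp add: space_pair_measure)
    show "AE t in lborel. AE x in lborel. fst (t, x) \<in> I \<longrightarrow> W (t, x) = U (t, x) \<and>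
      Lfar \<mu> r (\<lambda>x'. W (fst (t, x), x')) (snd (t, x)) = Lfar \<mu> r (\<lambda>x'. U (fst (t, x), x')) (snd (t, x))"
      using * by auto
  qed
  then show ?thesis unfolding lborel_prod .
qed

end

section \<open>Trigonometric kernels\<close>

lemma smooth_algebra_power: "f \<in> smooth_algebra \<Longrightarrow> (\<lambda>p. f p ^ n) \<in> smooth_algebra"
  by (induction n) (auto intro: smooth_algebra.const smooth_algebra.mult)

lemma smooth_algebra_prod:
  assumes "\<And>i. i \<in> S \<Longrightarrow> f i \<in> smooth_algebra" shows "(\<lambda>p. \<Prod>i\<in>S. f i p) \<in> smooth_algebra"
  using assms
  by (induction S rule: infinite_finite_induct) (auto intro: smooth_algebra.const smooth_algebra.mult)

lemma smooth_algebra_compose_affine: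
  assumes "f \<in> smooth_algebra" "bounded_linear L"
  shows "(\<lambda>p. f (L p + c)) \<in> smooth_algebra"
  using assms(1)
proof induction
  case (comp g l)
  interpret l: bounded_linear l by fact
  have "smooth_real (\<lambda>x. g (x + l c))"
    using smooth_real_affine[OF comp(1), of 1 1 "l c"] by simp
  moreover have "bounded_linear (\<lambda>p. l (L p))"
    using comp(2) assms(2) by (rule bounded_linear_compose)
  ultimately have "(\<lambda>p. g (l (L p) + l c)) \<in> smooth_algebra"
    by (rule smooth_algebra.comp)
  then show ?case by (simp add: l.add)
qed (auto intro: smooth_algebra.intros)

lemma smooth_algebra_continuous:
  assumes "f \<in> smooth_algebra" shows "continuous_on S f"
  using smooth_algebra_Ck_on[OF assms, of 0 S] by simp

text \<open>
  A bounded function with bounded gradient and a second-order Taylor estimate that is uniform in \<open>x\<close>.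
  This is what bounds the contribution of the small jumps; being stable under products, it follows for
  trigonometric products from the case of a single cosine.
\<close>

definition has_taylor2 :: "(real ^ 'n \<Rightarrow> real) \<Rightarrow> (real ^ 'n \<Rightarrow> real ^ 'n) \<Rightarrow> bool" where
  "has_taylor2 \<omega> G \<longleftrightarrow> (\<exists>C\<ge>0. \<forall>x. \<bar>\<omega> x\<bar> \<le> C \<and> norm (G x) \<le> C \<and>
     (\<forall>z. norm z \<le> 1 \<longrightarrow> \<bar>\<omega> (x - z) - \<omega> x + z \<bullet> G x\<bar> \<le> C * (norm z)\<^sup>2))"

lemma has_taylor2_const: "has_taylor2 (\<lambda>_. c) (\<lambda>_. 0)"
  unfolding has_taylor2_def by (intro exI[of _ "\<bar>c\<bar>"]) auto

lemma has_taylor2_cos: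
  fixes i :: "'n::finite"
  shows "has_taylor2 (\<lambda>x. (1 + cos (x $ i)) / 2) (\<lambda>x. axis i (- sin (x $ i) / 2))"
proof -
  have scalar: "\<bar>cos (a - h) - cos a - h * sin a\<bar> \<le> h\<^sup>2" for a h :: real
  proof -
    have sinh: "\<bar>sin h - h\<bar> \<le> h\<^sup>2 / 2"
      using Maclaurin_sin_bound[of h 2] by (simp add: numeral_2_eq_2 sin_coeff_def power2_eq_square)
    have cosh: "\<bar>cos h - 1\<bar> \<le> h\<^sup>2 / 2"
    proof -
      have "cos h - 1 = - 2 * (sin (h / 2))\<^sup>2"
        using cos_double_sin[of "h / 2"] by simp
      moreover have "(sin (h / 2))\<^sup>2 \<le> (h / 2)\<^sup>2"
        using abs_sin_x_le_abs_x[of "h / 2"] abs_le_square_iff by blast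
      ultimately show ?thesis by (simp add: power_divide)
    qed
    have "\<bar>cos (a - h) - cos a - h * sin a\<bar> = \<bar>cos a * (cos h - 1) + sin a * (sin h - h)\<bar>"
      by (simp add: cos_diff algebra_simps)
    also have "\<dots> \<le> \<bar>cos a\<bar> * \<bar>cos h - 1\<bar> + \<bar>sin a\<bar> * \<bar>sin h - h\<bar>"
      by (rule order_trans[OF abs_triangle_ineq]) (simp add: abs_mult)
    also have "\<dots> \<le> 1 * (h\<^sup>2 / 2) + 1 * (h\<^sup>2 / 2)"
      by (intro add_mono mult_mono sinh cosh abs_cos_le_one abs_sin_le_one) auto
    finally show ?thesis by simp
  qed
  show ?thesis
    unfolding has_taylor2_def
  proof (intro exI[of _ 1] conjI allI impI)
    fix x z :: "real ^ 'n"
    show "\<bar>(1 + cos (x $ i)) / 2\<bar> \<le> 1"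
      by (simp add: abs_le_iff) (use cos_ge_minus_one[of "x $ i"] in linarith)
    show "norm (axis i (- sin (x $ i) / 2)) \<le> 1"
    proof -
      have "axis i (- sin (x $ i) / 2) = (- sin (x $ i) / 2) *\<^sub>R axis i (1::real)"
        by (simp add: vec_eq_iff axis_def)
      then have "norm (axis i (- sin (x $ i) / 2)) = \<bar>sin (x $ i)\<bar> / 2"
        by (simp add: norm_axis_1)
      then show ?thesis using abs_sin_le_one[of "x $ i"] by linarith
    qed
    have "(1 + cos ((x - z) $ i)) / 2 - (1 + cos (x $ i)) / 2 + z \<bullet> axis i (- sin (x $ i) / 2) =
        (cos (x $ i - z $ i) - cos (x $ i) - z $ i * sin (x $ i)) / 2"
      by (simp add: inner_axis field_simps)
    then have "\<bar>(1 + cos ((x - z) $ i)) / 2 - (1 + cos (x $ i)) / 2 + z \<bullet> axis i (- sin (x $ i) / 2)\<bar> =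
        \<bar>cos (x $ i - z $ i) - cos (x $ i) - z $ i * sin (x $ i)\<bar> / 2"
      by (simp only: abs_divide abs_numeral)
    also have "\<dots> \<le> (z $ i)\<^sup>2" using scalar[of "x $ i" "z $ i"] by simp
    also have "\<dots> \<le> (norm z)\<^sup>2"
      using component_le_norm_cart[of z i] by (simp add: abs_le_square_iff[symmetric])
    finally show "\<bar>(1 + cos ((x - z) $ i)) / 2 - (1 + cos (x $ i)) / 2 + z \<bullet> axis i (- sin (x $ i) / 2)\<bar>
       \<le> 1 * (norm z)\<^sup>2" by simp
  qed simp
qed

lemma has_taylor2_mult:
  fixes f g :: "real ^ 'n \<Rightarrow> real"
  assumes "has_taylor2 f F" "has_taylor2 g G"
  shows "has_taylor2 (\<lambda>x. f x * g x) (\<lambda>x. g x *\<^sub>R F x + f x *\<^sub>R G x)"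
proof -
  obtain A where A: "0 \<le> A" "\<And>x. \<bar>f x\<bar> \<le> A" "\<And>x. norm (F x) \<le> A"
    "\<And>x z. norm z \<le> 1 \<Longrightarrow> \<bar>f (x - z) - f x + z \<bullet> F x\<bar> \<le> A * (norm z)\<^sup>2"
    using assms(1) by (auto simp: has_taylor2_def)
  obtain B where B: "0 \<le> B" "\<And>x. \<bar>g x\<bar> \<le> B" "\<And>x. norm (G x) \<le> B"
    "\<And>x z. norm z \<le> 1 \<Longrightarrow> \<bar>g (x - z) - g x + z \<bullet> G x\<bar> \<le> B * (norm z)\<^sup>2"
    using assms(2) by (auto simp: has_taylor2_def)
  show ?thesis
    unfolding has_taylor2_def
  proof (intro exI[of _ "4 * A * B"] conjI allI impI)
    show "0 \<le> 4 * A * B" using A(1) B(1) by simp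
    fix x z :: "real ^ 'n"
    have "\<bar>f x * g x\<bar> \<le> A * B"
      unfolding abs_mult by (intro mult_mono A B) auto
    moreover have AB: "0 \<le> A * B" using A(1) B(1) by simp
    ultimately show "\<bar>f x * g x\<bar> \<le> 4 * A * B" by linarith
    have "norm (g x *\<^sub>R F x + f x *\<^sub>R G x) \<le> \<bar>g x\<bar> * norm (F x) + \<bar>f x\<bar> * norm (G x)"
      by (rule order_trans[OF norm_triangle_ineq]) simp
    also have "\<dots> \<le> B * A + A * B"
      by (intro add_mono mult_mono A B) auto
    finally show "norm (g x *\<^sub>R F x + f x *\<^sub>R G x) \<le> 4 * A * B" using AB by (simp add: algebra_simps)
    assume z: "norm z \<le> 1"
    define n where "n = norm z"
    have n: "0 \<le> n" "n\<^sup>2 \<le> n"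
      using z by (auto simp: n_def power2_eq_square intro: mult_left_le)
    define a b where "a = f (x - z) - f x + z \<bullet> F x" and "b = g (x - z) - g x + z \<bullet> G x"
    have a: "\<bar>a\<bar> \<le> A * n\<^sup>2" and b: "\<bar>b\<bar> \<le> B * n\<^sup>2"
      unfolding a_def b_def n_def using A(4)[OF z] B(4)[OF z] by auto
    have zG: "\<bar>z \<bullet> G x\<bar> \<le> n * B"
      using Cauchy_Schwarz_ineq2[of z "G x"] mult_left_mono[OF B(3)[of x] n(1)] by (simp add: n_def)
    have zF: "\<bar>z \<bullet> F x\<bar> \<le> n * A"
      using Cauchy_Schwarz_ineq2[of z "F x"] mult_left_mono[OF A(3)[of x] n(1)] by (simp add: n_def)
    have df: "\<bar>f (x - z) - f x\<bar> \<le> 2 * A * n"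
    proof -
      have "\<bar>f (x - z) - f x\<bar> \<le> \<bar>a\<bar> + \<bar>z \<bullet> F x\<bar>" by (simp add: a_def)
      moreover have "A * n\<^sup>2 \<le> A * n" using A(1) n(2) by (rule mult_left_mono[rotated])
      ultimately show ?thesis using a zF by (simp add: algebra_simps)
    qed
    \<comment> \<open>Discrete product rule: both Taylor remainders and one product of first-order increments.\<close>
    have "f (x - z) * g (x - z) - f x * g x + z \<bullet> (g x *\<^sub>R F x + f x *\<^sub>R G x) =
        f (x - z) * b + g x * a - (z \<bullet> G x) * (f (x - z) - f x)"
      by (simp add: a_def b_def inner_add_right algebra_simps)
    moreover have "\<bar>f (x - z) * b\<bar> \<le> A * (B * n\<^sup>2)"
      unfolding abs_mult using a b by (intro mult_mono A) auto
    moreover have "\<bar>g x * a\<bar> \<le> B * (A * n\<^sup>2)"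
      unfolding abs_mult using a b by (intro mult_mono B) auto
    moreover have "\<bar>(z \<bullet> G x) * (f (x - z) - f x)\<bar> \<le> (n * B) * (2 * A * n)"
      unfolding abs_mult using zG df n B by (intro mult_mono) auto
    ultimately show "\<bar>f (x - z) * g (x - z) - f x * g x + z \<bullet> (g x *\<^sub>R F x + f x *\<^sub>R G x)\<bar> \<le> 4 * A * B * (norm z)\<^sup>2"
      unfolding n_def[symmetric] by (simp add: power2_eq_square algebra_simps)
  qed
qed

lemma has_taylor2_has_derivative:
  assumes "has_taylor2 \<omega> G" shows "(\<omega> has_derivative (\<lambda>h. h \<bullet> G x)) (at x)"
proof -
  obtain C where C: "0 \<le> C" "\<And>z. norm z \<le> 1 \<Longrightarrow> \<bar>\<omega> (x - z) - \<omega> x + z \<bullet> G x\<bar> \<le> C * (norm z)\<^sup>2"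
    using assms by (auto simp: has_taylor2_def)
  show ?thesis
    unfolding has_derivative_at_alt
  proof (intro conjI allI impI)
    show "bounded_linear (\<lambda>h. h \<bullet> G x)" by (rule bounded_linear_inner_left)
    fix e :: real assume e: "0 < e"
    show "\<exists>d>0. \<forall>y. norm (y - x) < d \<longrightarrow> norm (\<omega> y - \<omega> x - (y - x) \<bullet> G x) \<le> e * norm (y - x)"
    proof (intro exI[of _ "min 1 (e / (C + 1))"] conjI allI impI)
      show "0 < min 1 (e / (C + 1))" using e C(1) by simp
      fix y assume y: "norm (y - x) < min 1 (e / (C + 1))"
      have "\<bar>\<omega> (x - (x - y)) - \<omega> x + (x - y) \<bullet> G x\<bar> \<le> C * (norm (x - y))\<^sup>2"
        using y by (intro C(2)) (simp add: norm_minus_commute)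
      also have "\<dots> = (C * norm (y - x)) * norm (y - x)"
        by (simp add: power2_eq_square norm_minus_commute)
      also have "C * norm (y - x) \<le> C * (e / (C + 1))"
        using y C(1) by (intro mult_left_mono) auto
      also have "C * (e / (C + 1)) \<le> e" using C(1) e by (simp add: field_simps)
      finally show "norm (\<omega> y - \<omega> x - (y - x) \<bullet> G x) \<le> e * norm (y - x)"
        by (simp add: mult_right_mono inner_diff_left algebra_simps)
    qed
  qed
qed

lemma has_taylor2_grad:
  assumes "has_taylor2 \<omega> G" shows "grad \<omega> = G"
proof
  fix x
  have "frechet_derivative \<omega> (at x) = (\<lambda>h. h \<bullet> G x)"
    using frechet_derivative_at[OF has_taylor2_has_derivative[OF assms]] by simp
  then show "grad \<omega> x = G x" by (simp add: grad_def vec_eq_iff inner_axis')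
qed

text \<open>
  Up to normalisation this is de la Vallee Poussin's kernel in each coordinate: smooth, periodic, even,
  and concentrating at the lattice points as \<open>n\<close> grows.
\<close>

definition space_kernel :: "nat \<Rightarrow> real ^ 'n \<Rightarrow> real" where
  "space_kernel n w = (\<Prod>i\<in>UNIV. (1 + cos (w $ i)) / 2) ^ n"

lemma space_kernel_taylor2: "has_taylor2 (space_kernel n :: real ^ 'n \<Rightarrow> real) (grad (space_kernel n))"
proof -
  have prod: "\<exists>G. has_taylor2 (\<lambda>w :: real ^ 'n. \<Prod>i\<in>S. (1 + cos (w $ i)) / 2) G" if "finite S" for S
    using that
  proof induction
    case (insert i S)
    then show ?case using has_taylor2_mult[OF has_taylor2_cos[of i]] by auto
  qed (auto intro: has_taylor2_const)
  then obtain G where G: "has_taylor2 (\<lambda>w :: real ^ 'n. \<Prod>i\<in>UNIV. (1 + cos (w $ i)) / 2) G" by auto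
  have "\<exists>G. has_taylor2 (space_kernel n :: real ^ 'n \<Rightarrow> real) G"
    unfolding space_kernel_def
  proof (induction n)
    case (Suc n)
    then show ?case using has_taylor2_mult[OF G] by (auto simp: power_Suc)
  qed (auto intro: has_taylor2_const)
  then obtain G where "has_taylor2 (space_kernel n :: real ^ 'n \<Rightarrow> real) G" by blast
  with has_taylor2_grad[OF this] show ?thesis by simp
qed

lemma space_kernel_smooth: "(space_kernel n :: real ^ 'n \<Rightarrow> real) \<in> smooth_algebra"
proof -
  have "(\<lambda>w :: real ^ 'n. (1 / 2) * (1 + cos (w $ i))) \<in> smooth_algebra" for i
    by (intro smooth_algebra.mult smooth_algebra.add smooth_algebra.const
        smooth_algebra.comp[OF smooth_real_cos] bounded_linear_vec_nth)
  then show ?thesis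
    unfolding space_kernel_def[abs_def] by (intro smooth_algebra_power smooth_algebra_prod) simp
qed

lemma space_kernel_nonneg: "0 \<le> space_kernel n w"
proof -
  have "0 \<le> (1 + cos (w $ i)) / 2" for i
    by (intro divide_nonneg_pos) (use cos_ge_minus_one[of "w $ i"] in linarith)+
  then show ?thesis unfolding space_kernel_def by (intro zero_le_power prod_nonneg) auto
qed

lemma space_kernel_even: "space_kernel n (- w) = space_kernel n w"
  by (simp add: space_kernel_def)

lemma space_kernel_periodic: "periodic (space_kernel n :: real ^ 'n \<Rightarrow> real)"
proof -
  have "cos (x $ j + axis i (2 * pi) $ j) = cos (x $ j)" for x :: "real ^ 'n" and i j
    by (cases "i = j") (auto simp: axis_def)
  then show ?thesis by (simp add: periodic_def space_kernel_def)
qed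

text \<open>
  The period is \<open>2 * T\<close>, so that on \<open>[-T, T]\<close>, the range of time differences, \<open>0\<close> is the only maximum.
\<close>

definition time_kernel :: "real \<Rightarrow> nat \<Rightarrow> real \<Rightarrow> real" where
  "time_kernel T n \<tau> = ((1 + cos (pi / T * \<tau>)) / 2) ^ n"

lemma time_kernel_smooth_real: "smooth_real (time_kernel T n)"
proof -
  have "(\<lambda>x::real. (1 / 2) * (1 + cos (x * (pi / T)))) \<in> smooth_algebra"
    by (intro smooth_algebra.mult smooth_algebra.add smooth_algebra.const
        smooth_algebra.comp[OF smooth_real_cos] bounded_linear_mult_left)
  then have "(\<lambda>x::real. ((1 / 2) * (1 + cos (x * (pi / T)))) ^ n) \<in> smooth_algebra"
    by (rule smooth_algebra_power)
  then have "(\<lambda>x::real. time_kernel T n x) \<in> smooth_algebra"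
    by (simp add: time_kernel_def mult.commute)
  then show ?thesis by (intro smooth_algebra_smooth_real) simp
qed

lemma time_kernel_nonneg: "0 \<le> time_kernel T n \<tau>"
  unfolding time_kernel_def
  by (intro zero_le_power divide_nonneg_pos) (use cos_ge_minus_one[of "pi / T * \<tau>"] in linarith)+

lemma time_kernel_even: "time_kernel T n (- \<tau>) = time_kernel T n \<tau>"
  by (simp add: time_kernel_def)

section \<open>The entropy inequality for a product test function\<close>

text \<open>
  The data of one doubling step with fixed kernels: the time cut-off \<open>\<theta>\<close> with derivative \<open>\<theta>'\<close>, the even
  time kernel \<open>\<kappa>\<close> with derivative \<open>\<kappa>'\<close>, and the even periodic space kernel \<open>\<omega>\<close>.
\<close>

locale doubling = levy_measure \<mu> for \<mu> :: "(real ^ 'n) measure" +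
  fixes f :: "'n \<Rightarrow> real \<Rightarrow> real" and T :: real
    and \<theta> \<theta>' \<kappa> \<kappa>' :: "real \<Rightarrow> real" and \<omega> :: "real ^ 'n \<Rightarrow> real"
  assumes f_cont: "\<And>j. continuous_on UNIV (f j)"
    and T: "0 < T"
    and theta: "smooth_real \<theta>" "\<And>t. (\<theta> has_real_derivative \<theta>' t) (at t)" "\<And>t. 0 \<le> \<theta> t"
    and theta_support: "\<exists>a b. 0 < a \<and> b < T \<and> (\<forall>t. t \<notin> {a..b} \<longrightarrow> \<theta> t = 0 \<and> \<theta>' t = 0)"
    and kappa: "smooth_real \<kappa>" "\<And>t. (\<kappa> has_real_derivative \<kappa>' t) (at t)" "\<And>t. 0 \<le> \<kappa> t" "\<And>t. \<kappa> (- t) = \<kappa> t"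
    and omega: "\<omega> \<in> smooth_algebra" "\<And>x. 0 \<le> \<omega> x" "periodic \<omega>" "\<And>x. \<omega> (- x) = \<omega> x"
    and omega_taylor: "has_taylor2 \<omega> (grad \<omega>)"
begin

lemma continuous:
  "continuous_on UNIV \<theta>" "continuous_on UNIV \<theta>'" "continuous_on UNIV \<kappa>" "continuous_on UNIV \<kappa>'" "continuous_on UNIV \<omega>"
  using theta(2) kappa(2) smooth_real_continuous_deriv[OF theta(1,2)] smooth_real_continuous_deriv[OF kappa(1,2)] smooth_algebra_continuous[OF omega(1)]
  by (auto intro!: continuous_at_imp_continuous_on DERIV_isCont)

lemma omega_derivative: "(\<omega> has_derivative (\<lambda>h. h \<bullet> grad \<omega> x)) (at x)"
  by (rule has_taylor2_has_derivative[OF omega_taylor])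

lemma grad_continuous: "continuous_on UNIV (grad \<omega>)"
proof -
  obtain f' where f': "\<And>p. (\<omega> has_derivative f' p) (at p)" "\<And>v. (\<lambda>p. f' p v) \<in> smooth_algebra"
    using smooth_algebra_derivative[OF omega(1)] by blast
  have "grad \<omega> x = (\<chi> i. f' x (axis i 1))" for x
    using frechet_derivative_at[OF f'(1)[of x]] by (simp add: grad_def)
  then have "grad \<omega> = (\<lambda>x. \<chi> i. f' x (axis i 1))" by (rule ext)
  then show ?thesis
    using smooth_algebra_continuous[OF f'(2)] by (simp add: continuous_on_vec_lambda)
qed

lemma kappa'_odd: "\<kappa>' (- t) = - \<kappa>' t"
proof -
  have "((\<lambda>t. \<kappa> (- t)) has_real_derivative - \<kappa>' (- t)) (at t)"
  proof -
    have "(uminus has_real_derivative - 1) (at t)" by (auto intro!: derivative_eq_intros)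
    from DERIV_chain2[OF kappa(2) this] show ?thesis by simp
  qed
  with kappa(2)[of t] show ?thesis
    unfolding kappa(4) by (auto dest: DERIV_unique)
qed

lemma grad_odd: "grad \<omega> (- x) = - grad \<omega> x"
proof -
  have "((\<lambda>x. \<omega> (- x)) has_derivative (\<lambda>h. (- h) \<bullet> grad \<omega> (- x))) (at x)"
    by (rule has_derivative_compose[OF _ omega_derivative]) (auto intro!: derivative_eq_intros)
  then have "(\<omega> has_derivative (\<lambda>h. (- h) \<bullet> grad \<omega> (- x))) (at x)"
    unfolding omega(4) .
  then have "(\<lambda>h. (- h) \<bullet> grad \<omega> (- x)) = (\<lambda>h. h \<bullet> grad \<omega> x)"
    using omega_derivative by (rule has_derivative_unique)
  then have "h \<bullet> (grad \<omega> (- x) + grad \<omega> x) = 0" for h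
    by (drule_tac fun_cong[of _ _ h]) (simp add: inner_add_right)
  then show ?thesis
    by (metis add_eq_0_iff2 inner_eq_zero_iff)
qed

text \<open>
  The integrand of the entropy inequality at \<open>p\<close> for the test function \<open>doubled_test q\<close>, with the
  derivatives of the test function written out.
\<close>

definition doubled_integrand :: "real \<Rightarrow> ('n spacetime \<Rightarrow> real) \<Rightarrow> real \<Rightarrow> 'n spacetime \<Rightarrow> 'n spacetime \<Rightarrow> real" where
  "doubled_integrand r U k p q =
     \<bar>U p - k\<bar> * (\<theta> (fst q) * (\<theta>' (fst p) * \<kappa> (fst p - fst q) + \<theta> (fst p) * \<kappa>' (fst p - fst q)) * \<omega> (snd p - snd q))
     + \<theta> (fst p) * \<theta> (fst q) * \<kappa> (fst p - fst q) *
       (ent_flux f (U p) k \<bullet> grad \<omega> (snd p - snd q) + \<bar>U p - k\<bar> * Lstar \<mu> r \<omega> (snd p - snd q)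
        + sgn (U p - k) * Lfar \<mu> r (\<lambda>x. U (fst p, x)) (snd p) * \<omega> (snd p - snd q)
        + \<bar>U p - k\<bar> * (gam \<mu> r \<bullet> grad \<omega> (snd p - snd q)))"

definition doubled_test :: "'n spacetime \<Rightarrow> real \<Rightarrow> real ^ 'n \<Rightarrow> real" where
  "doubled_test q t x = (\<theta> (fst q) * (\<theta> t * \<kappa> (t - fst q))) * \<omega> (x - snd q)"

lemma doubled_test_test_function: "doubled_test q \<in> test_functions T"
proof -
  have "(\<lambda>p :: 'n spacetime. \<theta> (fst p)) \<in> smooth_algebra"
    by (rule smooth_algebra.comp[OF theta(1) bounded_linear_fst])
  moreover have "(\<lambda>p :: 'n spacetime. \<kappa> (fst p - fst q)) \<in> smooth_algebra"
    using smooth_algebra.comp[OF smooth_real_affine[OF kappa(1), of 1 1 "- fst q"] bounded_linear_fst] by simp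
  moreover have "(\<lambda>p :: 'n spacetime. \<omega> (snd p - snd q)) \<in> smooth_algebra"
    using smooth_algebra_compose_affine[OF omega(1) bounded_linear_snd, of "- snd q"] by simp
  ultimately have "(\<lambda>p. (\<theta> (fst q) * (\<theta> (fst p) * \<kappa> (fst p - fst q))) * \<omega> (snd p - snd q)) \<in> smooth_algebra"
    by (intro smooth_algebra.mult smooth_algebra.const)
  then have "Cinf_on (\<lambda>(t, x). doubled_test q t x) ({0<..<T} \<times> UNIV)"
    unfolding Cinf_on_def doubled_test_def case_prod_beta by (intro allI smooth_algebra_Ck_on)
  moreover have "periodic (doubled_test q t)" for t
  proof -
    have "\<omega> (x + axis i (2 * pi) - snd q) = \<omega> (x - snd q)" for x i
      using omega(3) by (metis add_diff_eq diff_add_eq periodic_def)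
    then show ?thesis by (simp add: periodic_def doubled_test_def)
  qed
  moreover obtain a b where "0 < a" "b < T" "\<And>t. t \<notin> {a..b} \<Longrightarrow> \<theta> t = 0"
    using theta_support by blast
  then have "\<exists>a b. 0 < a \<and> b < T \<and> (\<forall>t\<in>{0<..<T} - {a..b}. \<forall>x. doubled_test q t x = 0)"
    by (intro exI[of _ a] exI[of _ b]) (auto simp: doubled_test_def)
  ultimately show ?thesis by (simp add: test_functions_def)
qed

lemma doubled_test_nonneg: "0 \<le> doubled_test q t x"
  unfolding doubled_test_def by (intro mult_nonneg_nonneg theta kappa omega)

lemma Lstar_scaled_shift:
  "Lstar \<mu> r (\<lambda>x. c * \<omega> (x - y)) x = c * Lstar \<mu> r \<omega> (x - y)"
  and grad_scaled_shift: "grad (\<lambda>x. c * \<omega> (x - y)) x = c *\<^sub>R grad \<omega> (x - y)"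
proof -
  have "((\<lambda>x. \<omega> (x - y)) has_derivative (\<lambda>h. h \<bullet> grad \<omega> (x - y))) (at x)"
    by (rule has_derivative_compose[OF _ omega_derivative]) (auto intro!: derivative_eq_intros)
  then have "((\<lambda>x. c * \<omega> (x - y)) has_derivative (\<lambda>h. c * (h \<bullet> grad \<omega> (x - y)))) (at x)"
    by (rule has_derivative_mult_right)
  then have "frechet_derivative (\<lambda>x. c * \<omega> (x - y)) (at x) = (\<lambda>h. c * (h \<bullet> grad \<omega> (x - y)))"
    using frechet_derivative_at by metis
  then show grad: "grad (\<lambda>x. c * \<omega> (x - y)) x = c *\<^sub>R grad \<omega> (x - y)"
    by (simp add: grad_def vec_eq_iff inner_axis')
  have "Lstar \<mu> r (\<lambda>x. c * \<omega> (x - y)) x =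
    (LINT z:{z. norm z \<le> r}|\<mu>. c * (\<omega> (x - y - z) - \<omega> (x - y) + (z \<bullet> grad \<omega> (x - y)) * indicator {z. norm z < 1} z))"
    unfolding Lstar_def grad by (simp add: algebra_simps)
  then show "Lstar \<mu> r (\<lambda>x. c * \<omega> (x - y)) x = c * Lstar \<mu> r \<omega> (x - y)"
    by (simp add: Lstar_def)
qed

lemma entropy_integrand_doubled_test:
  "entropy_integrand f \<mu> k r (doubled_test q) w (fst p) (snd p) = doubled_integrand r (\<lambda>p. w (fst p) (snd p)) k p q"
proof -
  have "((\<lambda>\<tau>. doubled_test q \<tau> (snd p)) has_real_derivative
      \<theta> (fst q) * (\<theta>' (fst p) * \<kappa> (fst p - fst q) + \<theta> (fst p) * \<kappa>' (fst p - fst q)) * \<omega> (snd p - snd q)) (at (fst p))"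
    unfolding doubled_test_def
    by (auto intro!: derivative_eq_intros DERIV_chain2[OF theta(2)] DERIV_chain2[OF kappa(2)])
  then have "deriv (\<lambda>\<tau>. doubled_test q \<tau> (snd p)) (fst p) =
      \<theta> (fst q) * (\<theta>' (fst p) * \<kappa> (fst p - fst q) + \<theta> (fst p) * \<kappa>' (fst p - fst q)) * \<omega> (snd p - snd q)"
    by (rule DERIV_imp_deriv)
  moreover have "doubled_test q (fst p) = (\<lambda>x. (\<theta> (fst q) * (\<theta> (fst p) * \<kappa> (fst p - fst q))) * \<omega> (x - snd q))"
    by (rule ext) (simp add: doubled_test_def)
  ultimately show ?thesis
    unfolding entropy_integrand_def doubled_integrand_def ent_def ent'_def
    by (simp only: grad_scaled_shift Lstar_scaled_shift inner_scaleR_right fst_conv snd_conv eta_contract_eq) (simp add: algebra_simps)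
qed

lemma measurable_kernels [measurable]:
  "\<theta> \<in> borel_measurable borel" "\<theta>' \<in> borel_measurable borel" "\<kappa> \<in> borel_measurable borel"
  "\<kappa>' \<in> borel_measurable borel" "\<omega> \<in> borel_measurable borel" "grad \<omega> \<in> borel_measurable borel"
  "f j \<in> borel_measurable borel"
  by (intro borel_measurable_continuous_onI continuous grad_continuous f_cont)+

lemma Lstar_measurable [measurable]: "(\<lambda>x. Lstar \<mu> r \<omega> x) \<in> borel_measurable borel"
proof -
  let ?P = "(borel :: (real ^ 'n) measure) \<Otimes>\<^sub>M \<mu>"
  have z [measurable]: "(\<lambda>q. snd q) \<in> borel_measurable ?P"
    using measurable_compose[OF measurable_snd measurable_id] by simp
  have "(\<lambda>q. \<omega> (fst q - snd q)) \<in> borel_measurable ?P"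
    by measurable
  moreover have "(\<lambda>q. snd q \<bullet> grad \<omega> (fst q)) \<in> borel_measurable ?P"
    by measurable
  moreover have "(\<lambda>q. \<omega> (fst q)) \<in> borel_measurable ?P"
    by measurable
  moreover have "(\<lambda>q. indicator {z. norm z \<le> r} (snd q) :: real) \<in> borel_measurable ?P"
    "(\<lambda>q. indicator {z. norm z < 1} (snd q) :: real) \<in> borel_measurable ?P"
    by (auto intro!: measurable_compose[OF z])
  ultimately show ?thesis
    unfolding Lstar_def set_lebesgue_integral_def
    by (intro borel_measurable_lebesgue_integral) (simp add: case_prod_beta)
qed

lemma doubled_integrand_measurable:
  assumes [measurable]: "U \<in> borel_measurable borel" "V \<in> borel_measurable borel"
  shows "(\<lambda>z. doubled_integrand r U (V (snd z)) (fst z) (snd z)) \<in> borel_measurable borel"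
proof -
  note [measurable] = Lfar_measurable[OF assms(1), of r]
  have L [measurable]: "(\<lambda>z :: 'n spacetime \<times> 'n spacetime. Lfar \<mu> r (\<lambda>x. U (fst (fst z), x)) (snd (fst z))) \<in> borel_measurable borel"
    by (rule measurable_compose[OF fst_borel Lfar_measurable[OF assms(1), of r]])
  have [measurable]: "(\<lambda>z :: 'n spacetime \<times> 'n spacetime. Lstar \<mu> r \<omega> (snd (fst z) - snd (snd z))) \<in> borel_measurable borel"
    by (rule measurable_compose[OF _ Lstar_measurable]) measurable
  have [measurable]: "(\<lambda>x. grad \<omega> x $ i) \<in> borel_measurable borel" for i
    by (intro borel_measurable_continuous_onI continuous_intros grad_continuous)
  have [measurable]: "(\<lambda>z :: 'n spacetime \<times> 'n spacetime. grad \<omega> (snd (fst z) - snd (snd z)) $ i) \<in> borel_measurable borel" for i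
    by (rule measurable_compose[of "\<lambda>z. snd (fst z) - snd (snd z)" _ borel "\<lambda>x. grad \<omega> x $ i"]) measurable
  have [measurable]: "(\<lambda>z. ent_flux f (U (fst z)) (V (snd z)) \<bullet> grad \<omega> (snd (fst z) - snd (snd z))) \<in> borel_measurable borel"
    unfolding ent_flux_def inner_vec_def ent'_def vec_lambda_beta inner_real_def by measurable
  show ?thesis unfolding doubled_integrand_def by measurable
qed

text \<open>
  The inequality is transferred from \<open>u\<close> to its everywhere bounded and periodic representative \<open>U\<close>. The
  intermediate \<open>W\<close> equals \<open>u\<close> on the time interval and is Borel on all of space-time.
\<close>

lemma entropy_inequality:
  assumes sol: "periodic_entropy_solution T f \<mu> u0 u"
    and U [measurable]: "U \<in> borel_measurable borel"
    and eq: "\<And>t. t \<in> {0..T} \<Longrightarrow> AE x in lborel. U (t, x) = u t x"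
    and r: "0 < r"
  shows "0 \<le> (LINT p:{0<..<T} \<times> Lam|lborel. doubled_integrand r U k p q)"
proof -
  define W where "W p = (if fst p \<in> {0..T} then u (fst p) (snd p) else 0)" for p
  have W [measurable]: "W \<in> borel_measurable borel"
    using sol C_Linf_p_jointly_measurable[of u T] unfolding W_def by (simp add: periodic_entropy_solution_def)
  note [measurable] = cell_borel[of T]
  have sect [measurable]: "(\<lambda>p. doubled_integrand r X k p q) \<in> borel_measurable borel" if "X \<in> borel_measurable borel" for X
  proof -
    have "(\<lambda>p :: 'n spacetime. (p, q)) \<in> borel_measurable borel"
      by (intro borel_measurable_continuous_onI continuous_intros)
    from measurable_compose[OF this doubled_integrand_measurable[OF that, of "\<lambda>_. k" r]] show ?thesis by simp
  qed
  have "0 \<le> (LINT p:{0<..<T} \<times> Lam|lborel. entropy_integrand f \<mu> k r (doubled_test q) u (fst p) (snd p))"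
    using sol r doubled_test_test_function[of q] doubled_test_nonneg[of q] by (auto simp: periodic_entropy_solution_def)
  also have "\<dots> = (LINT p:{0<..<T} \<times> Lam|lborel. doubled_integrand r W k p q)"
    unfolding set_lebesgue_integral_def entropy_integrand_doubled_test
    by (rule Bochner_Integration.integral_cong) (auto simp: indicator_def doubled_integrand_def W_def)
  also have "\<dots> = (LINT p:{0<..<T} \<times> Lam|lborel. doubled_integrand r U k p q)"
    unfolding set_lebesgue_integral_def
  proof (rule integral_cong_AE)
    have "AE p in lborel. fst p \<in> {0<..<T} \<longrightarrow> W p = U p \<and>
       Lfar \<mu> r (\<lambda>x. W (fst p, x)) (snd p) = Lfar \<mu> r (\<lambda>x. U (fst p, x)) (snd p)"
    proof (rule AE_Lfar_cong[OF W U])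
      fix t assume "t \<in> {0<..<T}"
      then have t: "t \<in> {0..T}" by simp
      from eq[OF t] show "AE x in lborel. W (t, x) = U (t, x)"
        by eventually_elim (use t in \<open>simp add: W_def\<close>)
    qed simp
    then show "AE p in lborel. indicat_real ({0<..<T} \<times> Lam) p *\<^sub>R doubled_integrand r W k p q = indicat_real ({0<..<T} \<times> Lam) p *\<^sub>R doubled_integrand r U k p q"
      by eventually_elim (auto simp: indicator_def doubled_integrand_def)
  qed (use sect[OF W] sect[OF U] in measurable)
  finally show ?thesis .
qed

section \<open>Integration over pairs of space-time points\<close>

definition cell :: "'n spacetime measure" where
  "cell = restrict_space lborel ({0<..<T} \<times> Lam)"

lemma integral_cell: "(LINT p|cell. F p) = (LINT p:{0<..<T} \<times> Lam|lborel. F p)"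
  for F :: "_ \<Rightarrow> real"
  unfolding cell_def set_lebesgue_integral_def by (rule integral_restrict_space) (simp add: cell_borel)

lemma space_cell: "space cell = {0<..<T} \<times> Lam"
  by (simp add: cell_def space_restrict_space)

sublocale cell: finite_measure cell
proof
  have "emeasure cell (space cell) = emeasure lborel ({0<..<T} \<times> (Lam :: (real ^ 'n) set))"
    unfolding space_cell unfolding cell_def by (rule emeasure_restrict_space) (auto simp: cell_borel)
  also have "\<dots> < \<infinity>"
    by (intro emeasure_bounded_finite bounded_cell)
  finally show "emeasure cell (space cell) \<noteq> \<infinity>" by simp
qed

sublocale cell_pair: pair_sigma_finite cell cell ..

lemma measurable_cell: "F \<in> borel_measurable borel \<Longrightarrow> F \<in> borel_measurable cell"
  unfolding cell_def by (rule measurable_restrict_space1) simp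

lemma measurable_cell_pair_id: "(\<lambda>w. w) \<in> borel_measurable (cell \<Otimes>\<^sub>M cell)"
proof -
  have id: "(\<lambda>p. p) \<in> borel_measurable cell" by (rule measurable_cell) simp
  have "(\<lambda>z. (fst z, snd z)) \<in> cell \<Otimes>\<^sub>M cell \<rightarrow>\<^sub>M borel \<Otimes>\<^sub>M borel"
    by (intro measurable_Pair measurable_compose[OF measurable_fst id] measurable_compose[OF measurable_snd id])
  then show ?thesis by (simp add: borel_prod)
qed

lemma measurable_cell_pair: "F \<in> borel_measurable borel \<Longrightarrow> F \<in> borel_measurable (cell \<Otimes>\<^sub>M cell)"
  by (rule measurable_compose[OF measurable_cell_pair_id])

lemma finite_cell_pair: "emeasure (cell \<Otimes>\<^sub>M cell) (space (cell \<Otimes>\<^sub>M cell)) < \<infinity>"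
  unfolding space_pair_measure
  using cell.emeasure_finite[of "space cell"]
  by (subst cell.emeasure_pair_measure_Times) (auto simp: ennreal_mult_eq_top_iff less_top[symmetric])

sublocale cell_pair: finite_measure "cell \<Otimes>\<^sub>M cell"
  using finite_cell_pair by unfold_locales simp

text \<open>
  Boundedness over all times in \<open>(0, T)\<close> and all positions, also outside the cell, because arbitrary
  jumps carry the points there.
\<close>

definition strip_bounded :: "('n spacetime \<Rightarrow> 'n spacetime \<Rightarrow> real) \<Rightarrow> bool" where
  "strip_bounded F \<longleftrightarrow> (\<exists>C. \<forall>p q. fst p \<in> {0<..<T} \<longrightarrow> fst q \<in> {0<..<T} \<longrightarrow> \<bar>F p q\<bar> \<le> C)"

lemma strip_boundedI: "(\<And>p q. fst p \<in> {0<..<T} \<Longrightarrow> fst q \<in> {0<..<T} \<Longrightarrow> \<bar>F p q\<bar> \<le> C) \<Longrightarrow> strip_bounded F"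
  unfolding strip_bounded_def by blast

lemma strip_bounded_add: assumes "strip_bounded F" "strip_bounded G" shows "strip_bounded (\<lambda>p q. F p q + G p q)"
proof -
  obtain A B where "\<And>p q. fst p \<in> {0<..<T} \<Longrightarrow> fst q \<in> {0<..<T} \<Longrightarrow> \<bar>F p q\<bar> \<le> A"
    "\<And>p q. fst p \<in> {0<..<T} \<Longrightarrow> fst q \<in> {0<..<T} \<Longrightarrow> \<bar>G p q\<bar> \<le> B"
    using assms unfolding strip_bounded_def by metis
  then show ?thesis by (intro strip_boundedI[where C = "A + B"] order_trans[OF abs_triangle_ineq] add_mono)
qed

lemma strip_bounded_mult: assumes "strip_bounded F" "strip_bounded G" shows "strip_bounded (\<lambda>p q. F p q * G p q)"
proof -
  obtain A B where AB: "\<And>p q. fst p \<in> {0<..<T} \<Longrightarrow> fst q \<in> {0<..<T} \<Longrightarrow> \<bar>F p q\<bar> \<le> A"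
    "\<And>p q. fst p \<in> {0<..<T} \<Longrightarrow> fst q \<in> {0<..<T} \<Longrightarrow> \<bar>G p q\<bar> \<le> B"
    using assms unfolding strip_bounded_def by metis
  show ?thesis
  proof (rule strip_boundedI[where C = "A * B"])
    fix p q :: "'n spacetime" assume pq: "fst p \<in> {0<..<T}" "fst q \<in> {0<..<T}"
    have "0 \<le> A" using AB(1)[OF pq] by linarith
    then show "\<bar>F p q * G p q\<bar> \<le> A * B"
      unfolding abs_mult using AB[OF pq] by (intro mult_mono) auto
  qed
qed

lemma strip_bounded_abs: "strip_bounded F \<Longrightarrow> strip_bounded (\<lambda>p q. \<bar>F p q\<bar>)"
  by (simp add: strip_bounded_def)

lemma strip_bounded_diff: assumes "strip_bounded F" "strip_bounded G" shows "strip_bounded (\<lambda>p q. F p q - G p q)"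
proof -
  have "strip_bounded (\<lambda>p q. - G p q)" using assms(2) by (simp add: strip_bounded_def)
  from strip_bounded_add[OF assms(1) this] show ?thesis by simp
qed

lemma strip_bounded_sum: "(\<And>i. i \<in> S \<Longrightarrow> strip_bounded (F i)) \<Longrightarrow> strip_bounded (\<lambda>p q. \<Sum>i\<in>S. F i p q)"
proof (induction S rule: infinite_finite_induct)
  case (insert i S)
  then show ?case by (simp add: strip_bounded_add)
qed (auto intro: strip_boundedI[where C = 0])

lemma strip_bounded_integrable:
  assumes "strip_bounded (\<lambda>p q. F (p, q))" "F \<in> borel_measurable borel"
  shows "integrable (cell \<Otimes>\<^sub>M cell) F"
proof -
  obtain C where "\<And>p q. fst p \<in> {0<..<T} \<Longrightarrow> fst q \<in> {0<..<T} \<Longrightarrow> \<bar>F (p, q)\<bar> \<le> C"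
    using assms(1) unfolding strip_bounded_def by metis
  then show ?thesis
    by (intro cell_pair.integrable_const_bound[where B = C] AE_I2 measurable_cell_pair assms(2))
      (auto simp: space_pair_measure space_cell)
qed

lemma strip_bounded_continuous1:
  assumes "continuous_on UNIV g"
  shows "strip_bounded (\<lambda>p q. g (fst p))" "strip_bounded (\<lambda>p q. g (fst q))" "strip_bounded (\<lambda>p q. g (fst p - fst q))"
proof -
  obtain C where C: "\<And>t. t \<in> {-T..T} \<Longrightarrow> \<bar>g t\<bar> \<le> C"
    using continuous_bounded_Icc[OF assms] by blast
  show "strip_bounded (\<lambda>p q. g (fst p))" "strip_bounded (\<lambda>p q. g (fst q))" "strip_bounded (\<lambda>p q. g (fst p - fst q))"
    by (rule strip_boundedI[where C = C], rule C, use T in auto)+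
qed

lemma omega_bounds:
  obtains C where "0 \<le> C" "\<And>x. \<bar>\<omega> x\<bar> \<le> C" "\<And>x. norm (grad \<omega> x) \<le> C"
    "\<And>x z. norm z \<le> 1 \<Longrightarrow> \<bar>\<omega> (x - z) - \<omega> x + z \<bullet> grad \<omega> x\<bar> \<le> C * (norm z)\<^sup>2"
proof -
  obtain C where C: "0 \<le> C" "\<forall>x. \<bar>\<omega> x\<bar> \<le> C \<and> norm (grad \<omega> x) \<le> C \<and>
     (\<forall>z. norm z \<le> 1 \<longrightarrow> \<bar>\<omega> (x - z) - \<omega> x + z \<bullet> grad \<omega> x\<bar> \<le> C * (norm z)\<^sup>2)"
    using omega_taylor unfolding has_taylor2_def by (elim exE conjE)
  show thesis by (rule that[OF C(1)]) (simp_all add: C(2))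
qed

text \<open>
  For \<open>r < 1\<close> this is the integral of \<open>\<bar>z\<bar>\<^sup>2\<close> over \<open>\<bar>z\<bar> \<le> r\<close>; the minimum keeps it finite for every \<open>r\<close>.
\<close>

definition near_mass :: "real \<Rightarrow> real" where
  "near_mass r = (LINT z|\<mu>. indicator {z. norm z \<le> r} z * min ((norm z)\<^sup>2) 1)"

lemma near_mass_integrable: "integrable \<mu> (\<lambda>z. indicator {z. norm z \<le> r} z * min ((norm z)\<^sup>2) 1)"
proof -
  have "(\<lambda>z. indicator {z. norm z \<le> r} z * min ((norm z)\<^sup>2) 1) \<in> borel_measurable \<mu>"
    by (rule measurable_of_borel) measurable
  then show ?thesis
    by (rule Bochner_Integration.integrable_bound[OF integrable_min]) (auto simp: indicator_def)
qed

lemma near_mass_tendsto: "(\<lambda>k. near_mass (1 / (real k + 2))) \<longlonglongrightarrow> 0"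
proof -
  have "(\<lambda>k. LINT z|\<mu>. indicator {z. norm z \<le> 1 / (real k + 2)} z * min ((norm z)\<^sup>2) 1) \<longlonglongrightarrow> (LINT z|\<mu>. 0)"
  proof (rule integral_dominated_convergence[OF _ _ integrable_min])
    show "(\<lambda>z. indicator {z. norm z \<le> 1 / (real k + 2)} z * min ((norm z)\<^sup>2) 1) \<in> borel_measurable \<mu>" for k
      by (rule measurable_of_borel) measurable
    show "AE z in \<mu>. (\<lambda>k. indicator {z. norm z \<le> 1 / (real k + 2)} z * min ((norm z)\<^sup>2) 1) \<longlonglongrightarrow> 0"
    proof (rule AE_I2)
      fix z assume "z \<in> space \<mu>"
      then have "0 < norm z" by (simp add: space_eq)
      then obtain k0 where k0: "inverse (real (Suc k0)) < norm z" using reals_Archimedean by blast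
      have "\<not> norm z \<le> 1 / (real k + 2)" if "k0 \<le> k" for k
      proof -
        have "1 / (real k + 2) \<le> inverse (real (Suc k0))"
          using that by (simp add: field_simps)
        with k0 show ?thesis by linarith
      qed
      then have "\<forall>\<^sub>F k in sequentially. indicator {z. norm z \<le> 1 / (real k + 2)} z * min ((norm z)\<^sup>2) 1 = 0"
        by (intro eventually_sequentiallyI[of k0]) simp
      then show "(\<lambda>k. indicator {z. norm z \<le> 1 / (real k + 2)} z * min ((norm z)\<^sup>2) 1) \<longlonglongrightarrow> 0"
        by (rule tendsto_eventually)
    qed
  qed (auto simp: indicator_def)
  then show ?thesis by (simp add: near_mass_def)
qed

text \<open>
  For \<open>r < 1\<close> the indicator of \<open>\<bar>z\<bar> < 1\<close> in the integrand equals one, which leaves the second-order Taylor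
  remainder of \<open>\<omega>\<close>.
\<close>

lemma Lstar_bound:
  obtains C where "0 \<le> C" "\<And>r x. r < 1 \<Longrightarrow> \<bar>Lstar \<mu> r \<omega> x\<bar> \<le> C * near_mass r"
proof -
  obtain C where C: "0 \<le> C"
    "\<And>x z. norm z \<le> 1 \<Longrightarrow> \<bar>\<omega> (x - z) - \<omega> x + z \<bullet> grad \<omega> x\<bar> \<le> C * (norm z)\<^sup>2"
    using omega_bounds by metis
  have "\<bar>Lstar \<mu> r \<omega> x\<bar> \<le> C * near_mass r" if r: "r < 1" for r x
  proof -
    let ?g = "\<lambda>z. indicator {z. norm z \<le> r} z *\<^sub>R (\<omega> (x - z) - \<omega> x + (z \<bullet> grad \<omega> x) * indicator {z. norm z < 1} z)"
    let ?b = "\<lambda>z. C * (indicator {z. norm z \<le> r} z * min ((norm z)\<^sup>2) 1)"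
    have le: "norm (?g z) \<le> ?b z" for z
    proof (cases "norm z \<le> r")
      case True
      have "min ((norm z)\<^sup>2) 1 = (norm z)\<^sup>2"
        using True r by (intro min_absorb1) (simp add: power_le_one)
      then show ?thesis using True r C(2)[of z x] by simp
    qed simp
    have b: "integrable \<mu> ?b" using near_mass_integrable by (intro integrable_mult_right) auto
    have "?g \<in> borel_measurable \<mu>"
      by (rule measurable_of_borel) measurable
    then have g: "integrable \<mu> ?g"
      by (rule Bochner_Integration.integrable_bound[OF b]) (use le C(1) in \<open>auto intro!: AE_I2 order_trans[OF _ abs_ge_self]\<close>)
    have "norm (LINT z|\<mu>. ?g z) \<le> (LINT z|\<mu>. norm (?g z))" by (rule integral_norm_bound)
    also have "\<dots> \<le> (LINT z|\<mu>. ?b z)"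
      using g b le by (intro integral_mono) auto
    also have "\<dots> = C * near_mass r" by (simp add: near_mass_def)
    finally show ?thesis by (simp add: Lstar_def set_lebesgue_integral_def)
  qed
  with that C(1) show ?thesis by blast
qed

lemma far_sets: "0 < r \<Longrightarrow> {z. r < norm z} = {z \<in> space \<mu>. r < norm z}" "0 < r \<Longrightarrow> {z. r < norm z} \<in> sets \<mu>"
  "0 < r \<Longrightarrow> emeasure \<mu> {z. r < norm z} < \<infinity>"
proof -
  assume r: "0 < r"
  show e: "{z. r < norm z} = {z \<in> space \<mu>. r < norm z}" using r by (auto simp: space_eq)
  show "{z. r < norm z} \<in> sets \<mu>" unfolding e by measurable
  show "emeasure \<mu> {z. r < norm z} < \<infinity>" unfolding e using r by (rule emeasure_far_finite)
qed

lemma far_integrable: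
  fixes g :: "real ^ 'n \<Rightarrow> real"
  assumes "0 < r" "g \<in> borel_measurable borel" "\<And>z. \<bar>g z\<bar> \<le> C"
  shows "set_integrable \<mu> {z. r < norm z} g"
  unfolding set_integrable_def
  by (rule integrableI_bounded_set_indicator[where B = C])
    (use assms far_sets[OF assms(1)] in \<open>simp_all add: measurable_of_borel\<close>)

section \<open>The doubling inequality\<close>

lemma integral_cell_iterated:
  fixes F :: "'n spacetime \<Rightarrow> real"
  assumes F: "F \<in> borel_measurable borel" "\<And>p. fst p \<in> {0<..<T} \<Longrightarrow> \<bar>F p\<bar> \<le> C"
  shows "(LINT p|cell. F p) = (LINT t:{0<..<T}|lborel. LINT x:Lam|lborel. F (t, x))"
  unfolding integral_cell
  by (rule set_integral_Times_iterated(1)[where C = C]) (use F bounded_Lam in auto)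

lemma integral_cell_shift:
  fixes F :: "'n spacetime \<Rightarrow> real"
  assumes F: "F \<in> borel_measurable borel" "\<And>p. fst p \<in> {0<..<T} \<Longrightarrow> \<bar>F p\<bar> \<le> C"
    and per: "\<And>t. periodic (\<lambda>x. F (t, x))"
  shows "(LINT p|cell. F (fst p, snd p + z)) = (LINT p|cell. F p)"
proof -
  have "(\<lambda>p :: 'n spacetime. (fst p, snd p + z)) \<in> borel_measurable borel"
    by (intro borel_measurable_continuous_onI continuous_intros)
  from measurable_compose[OF this F(1)]
  have "(LINT p|cell. F (fst p, snd p + z)) = (LINT t:{0<..<T}|lborel. LINT x:Lam|lborel. F (t, x + z))"
    using F(2) by (subst integral_cell_iterated[where C = C]) auto
  also have "\<dots> = (LINT t:{0<..<T}|lborel. LINT x:Lam|lborel. F (t, x))"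
  proof (rule set_lebesgue_integral_cong)
    show "\<forall>t. t \<in> {0<..<T} \<longrightarrow> (LINT x:Lam|lborel. F (t, x + z)) = (LINT x:Lam|lborel. F (t, x))"
    proof (intro allI impI)
      fix t assume t: "t \<in> {0<..<T}"
      show "(LINT x:Lam|lborel. F (t, x + z)) = (LINT x:Lam|lborel. F (t, x))"
        using F(2) t by (intro integral_Lam_shift[OF per measurable_Pair_left[OF F(1)], where M = C]) auto
    qed
  qed simp
  also have "\<dots> = (LINT p|cell. F p)"
    by (rule integral_cell_iterated[OF F, symmetric])
  finally show ?thesis .
qed

lemma f_bounded: "\<exists>F. \<forall>j a. \<bar>a\<bar> \<le> m \<longrightarrow> \<bar>f j a\<bar> \<le> F"
proof -
  have "\<exists>F. \<forall>a. \<bar>a\<bar> \<le> m \<longrightarrow> \<bar>f j a\<bar> \<le> F" for j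
  proof -
    obtain F where "\<And>a. a \<in> {-m..m} \<Longrightarrow> \<bar>f j a\<bar> \<le> F"
      using continuous_bounded_Icc[OF f_cont[of j]] by blast
    then show ?thesis by (intro exI[of _ F] allI impI) (auto simp: abs_le_iff)
  qed
  then have "\<forall>j. \<exists>F. \<forall>a. \<bar>a\<bar> \<le> m \<longrightarrow> \<bar>f j a\<bar> \<le> F" by blast
  from choice[OF this] obtain F where F: "\<And>j a. \<bar>a\<bar> \<le> m \<Longrightarrow> \<bar>f j a\<bar> \<le> F j" by blast
  have "\<bar>f j a\<bar> \<le> (\<Sum>j\<in>UNIV. \<bar>F j\<bar>)" if "\<bar>a\<bar> \<le> m" for j a
  proof -
    have "\<bar>f j a\<bar> \<le> \<bar>F j\<bar>" using F[OF that, of j] by linarith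
    also have "\<dots> \<le> (\<Sum>j\<in>UNIV. \<bar>F j\<bar>)" by (rule member_le_sum) auto
    finally show ?thesis .
  qed
  then show ?thesis by blast
qed

lemma measurable_slice:
  fixes U :: "'n spacetime \<Rightarrow> real"
  assumes "U \<in> borel_measurable borel"
  shows "(\<lambda>z. U (t, x + z)) \<in> borel_measurable borel"
proof -
  have "(\<lambda>z :: real ^ 'n. (t, x + z)) \<in> borel_measurable borel"
    by (intro borel_measurable_continuous_onI continuous_intros)
  from measurable_compose[OF this assms] show ?thesis .
qed

lemma Lfar_bound:
  fixes U :: "'n spacetime \<Rightarrow> real"
  assumes "U \<in> borel_measurable borel" "\<And>p. \<bar>U p\<bar> \<le> m" "0 < r"
  shows "\<bar>Lfar \<mu> r (\<lambda>x. U (t, x)) x\<bar> \<le> (LINT z:{z. r < norm z}|\<mu>. 2 * m)"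
proof -
  have le: "\<bar>U (t, x + z) - U (t, x)\<bar> \<le> 2 * m" for z
    using assms(2)[of "(t, x + z)"] assms(2)[of "(t, x)"] by linarith
  have m: "0 \<le> m" using assms(2)[of undefined] by linarith
  have "set_integrable \<mu> {z. r < norm z} (\<lambda>z. U (t, x + z) - U (t, x))"
    using measurable_slice[OF assms(1)] le by (intro far_integrable[OF assms(3), where C = "2 * m"]) auto
  moreover have "set_integrable \<mu> {z. r < norm z} (\<lambda>z. 2 * m)"
    using m by (intro far_integrable[OF assms(3), where C = "2 * m"]) auto
  ultimately have "(LINT z|\<mu>. norm (indicat_real {z. r < norm z} z *\<^sub>R (U (t, x + z) - U (t, x))))
     \<le> (LINT z|\<mu>. indicat_real {z. r < norm z} z *\<^sub>R (2 * m))"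
    unfolding set_integrable_def using le by (intro integral_mono) (auto simp: indicator_def)
  from order_trans[OF integral_norm_bound this] show ?thesis
    unfolding Lfar_def set_lebesgue_integral_def real_norm_def .
qed

lemma strip_bounded_swap: "strip_bounded F \<Longrightarrow> strip_bounded (\<lambda>p q. F q p)"
  unfolding strip_bounded_def by metis

lemma strip_bounded_omega: "strip_bounded (\<lambda>p q. \<omega> (snd p - snd q))" "strip_bounded (\<lambda>p q. v \<bullet> grad \<omega> (snd p - snd q))"
  "strip_bounded (\<lambda>p q. grad \<omega> (snd p - snd q) $ j)"
proof -
  obtain C where C: "0 \<le> C" "\<And>x. \<bar>\<omega> x\<bar> \<le> C" "\<And>x. norm (grad \<omega> x) \<le> C"
    using omega_bounds by metis
  show "strip_bounded (\<lambda>p q. \<omega> (snd p - snd q))" by (rule strip_boundedI[where C = C]) (rule C)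
  show "strip_bounded (\<lambda>p q. grad \<omega> (snd p - snd q) $ j)"
    by (rule strip_boundedI[where C = C]) (rule order_trans[OF component_le_norm_cart C(3)])
  show "strip_bounded (\<lambda>p q. v \<bullet> grad \<omega> (snd p - snd q))"
    by (rule strip_boundedI[where C = "norm v * C"])
      (rule order_trans[OF Cauchy_Schwarz_ineq2 mult_left_mono[OF C(3)]], simp)
qed

lemma doubled_integrand_strip_bounded:
  assumes U: "U \<in> borel_measurable borel" "\<And>p. \<bar>U p\<bar> \<le> m" and V: "\<And>p. \<bar>V p\<bar> \<le> m" and r: "0 < r" "r < 1"
  shows "strip_bounded (\<lambda>p q. doubled_integrand r U (V q) p q)"
proof -
  obtain F where F: "\<And>j a. \<bar>a\<bar> \<le> m \<Longrightarrow> \<bar>f j a\<bar> \<le> F" using f_bounded by metis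
  obtain C where C: "\<And>x. \<bar>Lstar \<mu> r \<omega> x\<bar> \<le> C * near_mass r" using Lstar_bound r(2) by metis
  have UV: "strip_bounded (\<lambda>p q. \<bar>U p - V q\<bar>)"
    by (intro strip_bounded_abs strip_bounded_diff) (rule strip_boundedI[where C = m], use U(2) V in auto)+
  have sg: "strip_bounded (\<lambda>p q. sgn (U p - V q))"
    by (rule strip_boundedI[where C = 1]) (simp add: abs_sgn_eq)
  have "strip_bounded (\<lambda>p q. f j (U p))" "strip_bounded (\<lambda>p q. f j (V q))" for j
    by (rule strip_boundedI[where C = F], rule F, rule U V)+
  then have flux: "strip_bounded (\<lambda>p q. ent_flux f (U p) (V q) \<bullet> grad \<omega> (snd p - snd q))"
    unfolding ent_flux_def inner_vec_def ent'_def vec_lambda_beta inner_real_def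
    by (intro strip_bounded_sum strip_bounded_mult strip_bounded_diff sg strip_bounded_omega)
  have Ls: "strip_bounded (\<lambda>p q. Lstar \<mu> r \<omega> (snd p - snd q))"
    by (rule strip_boundedI) (rule C)
  have Lf: "strip_bounded (\<lambda>p q. Lfar \<mu> r (\<lambda>x. U (fst p, x)) (snd p))"
    by (rule strip_boundedI) (rule Lfar_bound[OF U r(1)])
  show ?thesis
    unfolding doubled_integrand_def
    by (intro strip_bounded_add strip_bounded_mult UV sg flux Ls Lf strip_bounded_omega strip_bounded_continuous1 continuous)
qed

text \<open>
  The common test function, seen as a function of both points.
\<close>

definition weight :: "'n spacetime \<Rightarrow> 'n spacetime \<Rightarrow> real" where
  "weight p q = \<theta> (fst p) * \<theta> (fst q) * \<kappa> (fst p - fst q) * \<omega> (snd p - snd q)"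

definition far_gain :: "real \<Rightarrow> ('n spacetime \<Rightarrow> real) \<Rightarrow> ('n spacetime \<Rightarrow> real) \<Rightarrow> 'n spacetime \<Rightarrow> 'n spacetime \<Rightarrow> real" where
  "far_gain r U V p q = (LINT z:{z. r < norm z}|\<mu>. \<bar>U (fst p, snd p + z) - V (fst q, snd q + z)\<bar> - \<bar>U p - V q\<bar>)"

definition kato_term :: "('n spacetime \<Rightarrow> real) \<Rightarrow> ('n spacetime \<Rightarrow> real) \<Rightarrow> 'n spacetime \<Rightarrow> 'n spacetime \<Rightarrow> real" where
  "kato_term U V p q = \<bar>U p - V q\<bar> * (\<theta>' (fst p) * \<theta> (fst q) + \<theta> (fst p) * \<theta>' (fst q)) * \<kappa> (fst p - fst q) * \<omega> (snd p - snd q)"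

lemma weight_nonneg: "0 \<le> weight p q"
  unfolding weight_def by (intro mult_nonneg_nonneg theta kappa omega)

text \<open>
  The subgradient inequality for the absolute value, \<open>sgn a * (b - a) \<le> \<bar>b\<bar> - \<bar>a\<bar>\<close>, under the integral. It
  needs the signs in the two entropy inequalities to be opposite for each pair of points; where
  \<open>U p = V q\<close> both are zero.
\<close>

lemma Lfar_difference_le:
  assumes U: "U \<in> borel_measurable borel" "\<And>p. \<bar>U p\<bar> \<le> m"
    and V: "V \<in> borel_measurable borel" "\<And>p. \<bar>V p\<bar> \<le> m" and r: "0 < r"
  shows "sgn (U p - V q) * (Lfar \<mu> r (\<lambda>x. U (fst p, x)) (snd p) - Lfar \<mu> r (\<lambda>x. V (fst q, x)) (snd q)) \<le> far_gain r U V p q"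
proof -
  have Um: "\<bar>U a - U b\<bar> \<le> 2 * m" and Vm: "\<bar>V a - V b\<bar> \<le> 2 * m" for a b
    using U(2)[of a] U(2)[of b] V(2)[of a] V(2)[of b] by linarith+
  have iU: "set_integrable \<mu> {z. r < norm z} (\<lambda>z. U (fst p, snd p + z) - U (fst p, snd p))"
    using measurable_slice[OF U(1)] Um by (intro far_integrable[OF r, where C = "2 * m"]) auto
  have iV: "set_integrable \<mu> {z. r < norm z} (\<lambda>z. V (fst q, snd q + z) - V (fst q, snd q))"
    using measurable_slice[OF V(1)] Vm by (intro far_integrable[OF r, where C = "2 * m"]) auto
  have iR: "set_integrable \<mu> {z. r < norm z} (\<lambda>z. \<bar>U (fst p, snd p + z) - V (fst q, snd q + z)\<bar> - \<bar>U p - V q\<bar>)"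
  proof (rule far_integrable[OF r, where C = "4 * m"])
    show "(\<lambda>z. \<bar>U (fst p, snd p + z) - V (fst q, snd q + z)\<bar> - \<bar>U p - V q\<bar>) \<in> borel_measurable borel"
      using measurable_slice[OF U(1), of "fst p" "snd p"] measurable_slice[OF V(1), of "fst q" "snd q"] by measurable
    show "\<bar>\<bar>U (fst p, snd p + z) - V (fst q, snd q + z)\<bar> - \<bar>U p - V q\<bar>\<bar> \<le> 4 * m" for z
      using U(2)[of "(fst p, snd p + z)"] V(2)[of "(fst q, snd q + z)"] U(2)[of p] V(2)[of q] by linarith
  qed
  have "sgn (U p - V q) * (Lfar \<mu> r (\<lambda>x. U (fst p, x)) (snd p) - Lfar \<mu> r (\<lambda>x. V (fst q, x)) (snd q)) =
      (LINT z:{z. r < norm z}|\<mu>. sgn (U p - V q) * ((U (fst p, snd p + z) - U (fst p, snd p)) - (V (fst q, snd q + z) - V (fst q, snd q))))"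
    unfolding Lfar_def set_integral_diff(2)[OF iU iV, symmetric] by (rule set_integral_mult_right[symmetric])
  also have "\<dots> \<le> far_gain r U V p q"
    unfolding far_gain_def
  proof (rule set_integral_mono[OF _ iR])
    show "set_integrable \<mu> {z. r < norm z} (\<lambda>z. sgn (U p - V q) * ((U (fst p, snd p + z) - U (fst p, snd p)) - (V (fst q, snd q + z) - V (fst q, snd q))))"
      by (intro set_integrable_mult_right set_integral_diff(1) iU iV)
    show "sgn (U p - V q) * ((U (fst p, snd p + z) - U (fst p, snd p)) - (V (fst q, snd q + z) - V (fst q, snd q)))
      \<le> \<bar>U (fst p, snd p + z) - V (fst q, snd q + z)\<bar> - \<bar>U p - V q\<bar>" for z
    proof -
      have "sgn a * ((a' - b') - a) \<le> \<bar>a' - b'\<bar> - \<bar>a\<bar>" for a a' b' :: real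
        by (cases "a > 0"; cases "a < 0") (auto simp: sgn_real_def)
      from this[of "U p - V q" "U (fst p, snd p + z)" "V (fst q, snd q + z)"] show ?thesis by (simp add: algebra_simps)
    qed
  qed
  finally show ?thesis .
qed

text \<open>
  Exchanging \<open>p\<close> and \<open>q\<close> reverses the arguments of the odd functions \<open>\<kappa>'\<close> and \<open>grad \<omega>\<close> but keeps the
  entropy flux. So the flux, drift and \<open>\<kappa>'\<close> terms cancel in the sum.
\<close>

lemma doubled_integrand_sum_le:
  assumes U: "U \<in> borel_measurable borel" "\<And>p. \<bar>U p\<bar> \<le> m"
    and V: "V \<in> borel_measurable borel" "\<And>p. \<bar>V p\<bar> \<le> m" and r: "0 < r"
  shows "doubled_integrand r U (V q) p q + doubled_integrand r V (U p) q p \<le> kato_term U V p q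
     + \<bar>U p - V q\<bar> * (\<theta> (fst p) * \<theta> (fst q) * \<kappa> (fst p - fst q)) * (Lstar \<mu> r \<omega> (snd p - snd q) + Lstar \<mu> r \<omega> (snd q - snd p))
     + weight p q * far_gain r U V p q"
proof -
  define a x where "a = fst p - fst q" and "x = snd p - snd q"
  have neg: "fst q - fst p = - a" "snd q - snd p = - x" by (simp_all add: a_def x_def)
  have flux: "ent_flux f (V q) (U p) = ent_flux f (U p) (V q)"
  proof -
    have "sgn (V q - U p) = - sgn (U p - V q)" by (simp add: sgn_real_def)
    then show ?thesis by (simp add: ent_flux_def ent'_def vec_eq_iff algebra_simps)
  qed
  have sgn: "sgn (V q - U p) = - sgn (U p - V q)" "\<bar>V q - U p\<bar> = \<bar>U p - V q\<bar>" by (auto simp: sgn_real_def)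
  have "doubled_integrand r U (V q) p q + doubled_integrand r V (U p) q p = kato_term U V p q
     + \<bar>U p - V q\<bar> * (\<theta> (fst p) * \<theta> (fst q) * \<kappa> (fst p - fst q)) * (Lstar \<mu> r \<omega> (snd p - snd q) + Lstar \<mu> r \<omega> (snd q - snd p))
     + weight p q * (sgn (U p - V q) * (Lfar \<mu> r (\<lambda>x. U (fst p, x)) (snd p) - Lfar \<mu> r (\<lambda>x. V (fst q, x)) (snd q)))"
    unfolding doubled_integrand_def kato_term_def weight_def neg a_def[symmetric] x_def[symmetric] flux sgn kappa kappa'_odd omega grad_odd inner_minus_right
    by (simp add: algebra_simps)
  also have "\<dots> \<le> kato_term U V p q
     + \<bar>U p - V q\<bar> * (\<theta> (fst p) * \<theta> (fst q) * \<kappa> (fst p - fst q)) * (Lstar \<mu> r \<omega> (snd p - snd q) + Lstar \<mu> r \<omega> (snd q - snd p))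
     + weight p q * far_gain r U V p q"
    by (intro add_left_mono mult_left_mono Lfar_difference_le[OF U V r] weight_nonneg)
  finally show ?thesis .
qed

lemma weight_shift: "weight (fst p, snd p + z) (fst q, snd q + z) = weight p q"
  by (simp add: weight_def)

lemma weight_strip_bounded: "strip_bounded weight"
  unfolding weight_def[abs_def] by (intro strip_bounded_mult strip_bounded_continuous1 continuous strip_bounded_omega)

lemma weight_measurable [measurable]: "(\<lambda>w. weight (fst w) (snd w)) \<in> borel_measurable borel"
  unfolding weight_def by measurable

lemma weight_periodic: "weight (t, x + axis i (2 * pi)) q = weight (t, x) q" "weight p (t, x + axis i (2 * pi)) = weight p (t, x)"
proof -
  have "\<omega> (x + axis i (2 * pi) - y) = \<omega> (x - y)" for x y :: "real ^ 'n"
    using omega(3) by (metis add_diff_eq diff_add_eq periodic_def)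
  moreover have "\<omega> (y - (x + axis i (2 * pi))) = \<omega> (y - x)" for x y :: "real ^ 'n"
    using omega(3) by (metis add_diff_eq diff_add_cancel diff_diff_eq periodic_def)
  ultimately show "weight (t, x + axis i (2 * pi)) q = weight (t, x) q" "weight p (t, x + axis i (2 * pi)) = weight p (t, x)"
    by (simp_all add: weight_def)
qed

context
  fixes U V :: "'n spacetime \<Rightarrow> real" and m :: real
  assumes U [measurable]: "U \<in> borel_measurable borel" and Ub: "\<And>p. \<bar>U p\<bar> \<le> m" and Up: "\<And>t. periodic (\<lambda>x. U (t, x))"
    and V [measurable]: "V \<in> borel_measurable borel" and Vb: "\<And>p. \<bar>V p\<bar> \<le> m" and Vp: "\<And>t. periodic (\<lambda>x. V (t, x))"
begin

lemma UV_strip_bounded: "strip_bounded (\<lambda>p q. \<bar>U (fst p, snd p + z) - V (fst q, snd q + z)\<bar>)"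
  by (intro strip_bounded_abs strip_bounded_diff) (rule strip_boundedI, rule Ub Vb)+

text \<open>
  Both integrals are taken one after the other, and each is invariant under translation by periodicity;
  the weight depends on the difference of the positions only.
\<close>

lemma simultaneous_shift:
  "(LINT w|(cell \<Otimes>\<^sub>M cell). weight (fst w) (snd w) * \<bar>U (fst (fst w), snd (fst w) + z) - V (fst (snd w), snd (snd w) + z)\<bar>)
   = (LINT w|(cell \<Otimes>\<^sub>M cell). weight (fst w) (snd w) * \<bar>U (fst w) - V (snd w)\<bar>)"
proof -
  define G where "G p q = weight p q * \<bar>U p - V q\<bar>" for p q
  define sh where "sh p = (fst p, snd p + z)" for p :: "'n spacetime"
  have [measurable]: "sh \<in> borel_measurable borel"
    unfolding sh_def by (intro borel_measurable_continuous_onI continuous_intros)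
  have G [measurable]: "(\<lambda>w. G (fst w) (snd w)) \<in> borel_measurable borel"
    unfolding G_def by measurable
  have Gsh: "(\<lambda>w. G (sh (fst w)) (sh (snd w))) \<in> borel_measurable borel"
  proof -
    have "(\<lambda>w :: 'n spacetime \<times> 'n spacetime. (sh (fst w), sh (snd w))) \<in> borel_measurable borel"
      unfolding sh_def by (intro borel_measurable_continuous_onI continuous_intros)
    from measurable_compose[OF this G] show ?thesis by simp
  qed
  have bG: "strip_bounded G"
    unfolding G_def[abs_def] using UV_strip_bounded[of 0] by (intro strip_bounded_mult weight_strip_bounded) simp
  then obtain C where C: "\<And>p q. fst p \<in> {0<..<T} \<Longrightarrow> fst q \<in> {0<..<T} \<Longrightarrow> \<bar>G p q\<bar> \<le> C"
    unfolding strip_bounded_def by metis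
  have Gper: "G (t, x + axis i (2 * pi)) q = G (t, x) q" "G p (t, x + axis i (2 * pi)) = G p (t, x)" for t x i p q
    using Up[of t] Vp[of t] by (simp_all add: G_def weight_periodic periodic_def)
  have int: "integrable (cell \<Otimes>\<^sub>M cell) (\<lambda>w. G (fst w) (snd w))"
    by (rule strip_bounded_integrable[OF _ G]) (use bG in simp)
  have intsh: "integrable (cell \<Otimes>\<^sub>M cell) (\<lambda>w. G (sh (fst w)) (sh (snd w)))"
    by (rule strip_bounded_integrable[OF _ Gsh]) (rule strip_boundedI, simp, rule C, simp_all add: sh_def)
  define J where "J q = (LINT p|cell. G p q)" for q
  have slice: "(\<lambda>p. G p q) \<in> borel_measurable borel" for q
  proof -
    have "(\<lambda>p :: 'n spacetime. (p, q)) \<in> borel_measurable borel"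
      by (intro borel_measurable_continuous_onI continuous_intros)
    from measurable_compose[OF this G] show ?thesis by simp
  qed
  have J: "J \<in> borel_measurable borel"
  proof -
    have id: "(\<lambda>p. p) \<in> borel_measurable cell" by (rule measurable_cell) simp
    have "(\<lambda>s. (snd s, fst s)) \<in> (borel :: 'n spacetime measure) \<Otimes>\<^sub>M cell \<rightarrow>\<^sub>M borel \<Otimes>\<^sub>M borel"
      by (intro measurable_Pair measurable_compose[OF measurable_snd id] measurable_fst)
    then have "(\<lambda>s. (snd s, fst s)) \<in> (borel :: 'n spacetime measure) \<Otimes>\<^sub>M cell \<rightarrow>\<^sub>M borel"
      by (simp add: borel_prod)
    from measurable_compose[OF this G]
    show ?thesis
      unfolding J_def by (intro cell.borel_measurable_lebesgue_integral) (simp add: case_prod_beta')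
  qed
  have Jb: "\<bar>J q\<bar> \<le> C * measure cell (space cell)" if q: "fst q \<in> {0<..<T}" for q
  proof -
    have bound: "\<bar>G p q\<bar> \<le> C" if "p \<in> space cell" for p
      using that q by (intro C) (auto simp: space_cell)
    have int: "integrable cell (\<lambda>p. G p q)"
      by (rule cell.integrable_const_bound[where B = C])
        (use bound measurable_cell[OF slice] in auto)
    have "\<bar>J q\<bar> \<le> (LINT p|cell. norm (G p q))"
      unfolding J_def using integral_norm_bound[of cell "\<lambda>p. G p q"] by simp
    also have "\<dots> \<le> (LINT p|cell. C)"
      using int bound by (intro integral_mono) auto
    finally show ?thesis by (simp add: mult.commute)
  qed
  have Jper: "periodic (\<lambda>y. J (t, y))" for t
    unfolding periodic_def J_def Gper by simp
  have "(LINT w|(cell \<Otimes>\<^sub>M cell). G (sh (fst w)) (sh (snd w))) = (LINT q|cell. LINT p|cell. G (sh p) (sh q))"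
    using cell_pair.integral_snd[of "\<lambda>p q. G (sh p) (sh q)"] intsh by (simp add: case_prod_beta')
  also have "\<dots> = (LINT q|cell. J (sh q))"
  proof (rule Bochner_Integration.integral_cong[OF refl])
    fix q assume "q \<in> space cell"
    then have q: "fst (sh q) \<in> {0<..<T}" by (auto simp: space_cell sh_def)
    have "(LINT p|cell. (\<lambda>p. G p (sh q)) (fst p, snd p + z)) = (LINT p|cell. (\<lambda>p. G p (sh q)) p)"
      by (rule integral_cell_shift[OF slice, where C = C]) (use C q Gper(1) in \<open>auto simp: periodic_def\<close>)
    then show "(LINT p|cell. G (sh p) (sh q)) = J (sh q)" by (simp add: J_def sh_def)
  qed
  also have "\<dots> = (LINT q|cell. J q)"
    unfolding sh_def by (rule integral_cell_shift[OF J Jb Jper])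
  also have "\<dots> = (LINT w|(cell \<Otimes>\<^sub>M cell). G (fst w) (snd w))"
    unfolding J_def using cell_pair.integral_snd[of G] int by (simp add: case_prod_beta')
  finally show ?thesis by (simp add: G_def sh_def weight_shift)
qed

text \<open>
  By Fubini's theorem the jump \<open>z\<close> is integrated last. For each fixed \<open>z\<close> the two terms of \<open>far_gain\<close> have
  the same integral.
\<close>

lemma integral_weight_far_gain:
  assumes r: "0 < r"
  shows "integrable (cell \<Otimes>\<^sub>M cell) (\<lambda>w. weight (fst w) (snd w) * far_gain r U V (fst w) (snd w))" (is ?int)
    and "(LINT w|(cell \<Otimes>\<^sub>M cell). weight (fst w) (snd w) * far_gain r U V (fst w) (snd w)) = 0" (is ?zero)
proof -
  interpret Q: pair_sigma_finite "cell \<Otimes>\<^sub>M cell" \<mu> ..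
  define H where "H w z = indicator {z. r < norm z} z * (weight (fst w) (snd w) *
     (\<bar>U (fst (fst w), snd (fst w) + z) - V (fst (snd w), snd (snd w) + z)\<bar> - \<bar>U (fst w) - V (snd w)\<bar>))" for w z
  have "(\<lambda>s. H (fst s) (snd s)) \<in> borel_measurable borel"
  proof -
    have "(\<lambda>s :: ('n spacetime \<times> 'n spacetime) \<times> (real ^ 'n). (fst (fst (fst s)), snd (fst (fst s)) + snd s)) \<in> borel_measurable borel"
      "(\<lambda>s :: ('n spacetime \<times> 'n spacetime) \<times> (real ^ 'n). (fst (snd (fst s)), snd (snd (fst s)) + snd s)) \<in> borel_measurable borel"
      by (intro borel_measurable_continuous_onI continuous_intros)+
    note [measurable] = measurable_compose[OF this(1) U] measurable_compose[OF this(2) V]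
      measurable_compose[OF fst_borel weight_measurable]
    show ?thesis unfolding H_def by measurable
  qed
  moreover have "(\<lambda>s. (fst s, snd s)) \<in> (cell \<Otimes>\<^sub>M cell) \<Otimes>\<^sub>M \<mu> \<rightarrow>\<^sub>M borel \<Otimes>\<^sub>M borel"
    by (intro measurable_Pair measurable_compose[OF measurable_fst measurable_cell_pair_id] measurable_compose[OF measurable_snd measurable_id])
  then have "(\<lambda>s. s) \<in> (cell \<Otimes>\<^sub>M cell) \<Otimes>\<^sub>M \<mu> \<rightarrow>\<^sub>M borel" by (simp add: borel_prod)
  ultimately have Hm: "(\<lambda>s. H (fst s) (snd s)) \<in> borel_measurable ((cell \<Otimes>\<^sub>M cell) \<Otimes>\<^sub>M \<mu>)"
    using measurable_compose by blast
  have sh_bd: "strip_bounded (\<lambda>p q. weight p q * (\<bar>U (fst p, snd p + z) - V (fst q, snd q + z)\<bar> - \<bar>U p - V q\<bar>))" for z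
    using UV_strip_bounded[of 0] by (intro strip_bounded_mult strip_bounded_diff weight_strip_bounded UV_strip_bounded) simp
  obtain CK where CK: "\<And>p q. fst p \<in> {0<..<T} \<Longrightarrow> fst q \<in> {0<..<T} \<Longrightarrow> \<bar>weight p q\<bar> \<le> CK"
    using weight_strip_bounded unfolding strip_bounded_def by metis
  have Hb: "\<bar>H w z\<bar> \<le> CK * (4 * m)" if w: "w \<in> space (cell \<Otimes>\<^sub>M cell)" for w z
  proof -
    have k: "\<bar>weight (fst w) (snd w)\<bar> \<le> CK" using w by (intro CK) (auto simp: space_pair_measure space_cell)
    have d: "\<bar>\<bar>U (fst (fst w), snd (fst w) + z) - V (fst (snd w), snd (snd w) + z)\<bar> - \<bar>U (fst w) - V (snd w)\<bar>\<bar> \<le> 4 * m"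
      using Ub[of "(fst (fst w), snd (fst w) + z)"] Vb[of "(fst (snd w), snd (snd w) + z)"] Ub[of "fst w"] Vb[of "snd w"]
      by linarith
    have "\<bar>weight (fst w) (snd w) * (\<bar>U (fst (fst w), snd (fst w) + z) - V (fst (snd w), snd (snd w) + z)\<bar> - \<bar>U (fst w) - V (snd w)\<bar>)\<bar> \<le> CK * (4 * m)"
      unfolding abs_mult[of "weight (fst w) (snd w)"] using k d by (intro mult_mono) auto
    moreover from this have "0 \<le> CK * (4 * m)" by linarith
    ultimately show ?thesis by (simp add: H_def indicator_def)
  qed
  have Hint: "integrable ((cell \<Otimes>\<^sub>M cell) \<Otimes>\<^sub>M \<mu>) (\<lambda>s. H (fst s) (snd s))"
  proof -
    let ?A = "space (cell \<Otimes>\<^sub>M cell) \<times> {z. r < norm z}"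
    have "integrable ((cell \<Otimes>\<^sub>M cell) \<Otimes>\<^sub>M \<mu>) (\<lambda>s. indicator ?A s *\<^sub>R H (fst s) (snd s))"
    proof (rule integrableI_bounded_set_indicator[where B = "CK * (4 * m)"])
      show "?A \<in> sets ((cell \<Otimes>\<^sub>M cell) \<Otimes>\<^sub>M \<mu>)"
        using far_sets(2)[OF r] by (intro pair_measureI) auto
      have "emeasure ((cell \<Otimes>\<^sub>M cell) \<Otimes>\<^sub>M \<mu>) ?A = emeasure (cell \<Otimes>\<^sub>M cell) (space (cell \<Otimes>\<^sub>M cell)) * emeasure \<mu> {z. r < norm z}"
        using far_sets(2)[OF r] by (intro emeasure_pair_measure_Times) auto
      then show "emeasure ((cell \<Otimes>\<^sub>M cell) \<Otimes>\<^sub>M \<mu>) ?A < \<infinity>"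
        using far_sets(3)[OF r] finite_cell_pair by (simp add: ennreal_mult_less_top)
      show "AE s in (cell \<Otimes>\<^sub>M cell) \<Otimes>\<^sub>M \<mu>. s \<in> ?A \<longrightarrow> norm (H (fst s) (snd s)) \<le> CK * (4 * m)"
        using Hb by (intro AE_I2) (auto simp: space_pair_measure[of "cell \<Otimes>\<^sub>M cell"])
    qed (rule Hm)
    then show ?thesis
      by (subst (asm) Bochner_Integration.integrable_cong[OF refl, where g = "\<lambda>s. H (fst s) (snd s)"])
        (auto simp: space_pair_measure[of "cell \<Otimes>\<^sub>M cell"] H_def indicator_def)
  qed
  have KR: "(LINT z|\<mu>. H w z) = weight (fst w) (snd w) * far_gain r U V (fst w) (snd w)" for w
    unfolding H_def far_gain_def set_lebesgue_integral_def by (subst integral_mult_right_zero[symmetric]) (simp add: ac_simps)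
  show ?int
    using Q.integrable_fst'[OF Hint] by (simp add: KR)
  have inner: "(LINT w|(cell \<Otimes>\<^sub>M cell). H w z) = 0" for z
  proof -
    have shm: "(\<lambda>w :: 'n spacetime \<times> 'n spacetime. (fst (fst w), snd (fst w) + z)) \<in> borel_measurable borel"
      "(\<lambda>w :: 'n spacetime \<times> 'n spacetime. (fst (snd w), snd (snd w) + z)) \<in> borel_measurable borel"
      by (intro borel_measurable_continuous_onI continuous_intros)+
    note [measurable] = measurable_compose[OF shm(1) U] measurable_compose[OF shm(2) V]
    have i1: "integrable (cell \<Otimes>\<^sub>M cell) (\<lambda>w. weight (fst w) (snd w) * \<bar>U (fst (fst w), snd (fst w) + z) - V (fst (snd w), snd (snd w) + z)\<bar>)"
    proof (rule strip_bounded_integrable)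
      show "(\<lambda>w. weight (fst w) (snd w) * \<bar>U (fst (fst w), snd (fst w) + z) - V (fst (snd w), snd (snd w) + z)\<bar>) \<in> borel_measurable borel"
        by measurable
    qed (simp add: strip_bounded_mult weight_strip_bounded UV_strip_bounded)
    have i2: "integrable (cell \<Otimes>\<^sub>M cell) (\<lambda>w. weight (fst w) (snd w) * \<bar>U (fst w) - V (snd w)\<bar>)"
    proof (rule strip_bounded_integrable)
      show "(\<lambda>w. weight (fst w) (snd w) * \<bar>U (fst w) - V (snd w)\<bar>) \<in> borel_measurable borel"
        by measurable
    qed (use UV_strip_bounded[of 0] in \<open>simp add: strip_bounded_mult weight_strip_bounded\<close>)
    have "(LINT w|(cell \<Otimes>\<^sub>M cell). weight (fst w) (snd w) *
        (\<bar>U (fst (fst w), snd (fst w) + z) - V (fst (snd w), snd (snd w) + z)\<bar> - \<bar>U (fst w) - V (snd w)\<bar>)) = 0"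
      unfolding right_diff_distrib Bochner_Integration.integral_diff[OF i1 i2] simultaneous_shift by simp
    then show ?thesis unfolding H_def by simp
  qed
  have "(LINT w|(cell \<Otimes>\<^sub>M cell). weight (fst w) (snd w) * far_gain r U V (fst w) (snd w)) = (LINT w|(cell \<Otimes>\<^sub>M cell). LINT z|\<mu>. H w z)"
    by (simp add: KR)
  also have "\<dots> = (LINT z|\<mu>. LINT w|(cell \<Otimes>\<^sub>M cell). H w z)"
    using Q.Fubini_integral[of H] Hint unfolding case_prod_beta' by simp
  also have "\<dots> = 0" by (simp add: inner)
  finally show ?zero .
qed

text \<open>
  The kernels stay fixed while \<open>r\<close> tends to \<open>0\<close>: the large jumps contribute nothing for any \<open>r\<close>, and the
  small jumps at most a multiple of \<open>near_mass r\<close>.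
\<close>

lemma doubling_inequality:
  assumes entU: "\<And>r k q. 0 < r \<Longrightarrow> 0 \<le> (LINT p:{0<..<T} \<times> Lam|lborel. doubled_integrand r U k p q)"
    and entV: "\<And>r k q. 0 < r \<Longrightarrow> 0 \<le> (LINT p:{0<..<T} \<times> Lam|lborel. doubled_integrand r V k p q)"
  shows "integrable (cell \<Otimes>\<^sub>M cell) (\<lambda>w. kato_term U V (fst w) (snd w))" (is ?int)
    and "0 \<le> (LINT w|(cell \<Otimes>\<^sub>M cell). kato_term U V (fst w) (snd w))" (is ?nonneg)
proof -
  have UV: "strip_bounded (\<lambda>p q. \<bar>U p - V q\<bar>)" using UV_strip_bounded[of 0] by simp
  show kato_int: ?int
  proof (rule strip_bounded_integrable)
    show "(\<lambda>w. kato_term U V (fst w) (snd w)) \<in> borel_measurable borel"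
      unfolding kato_term_def by measurable
    show "strip_bounded (\<lambda>p q. kato_term U V (fst (p, q)) (snd (p, q)))"
      unfolding kato_term_def fst_conv snd_conv by (intro strip_bounded_mult strip_bounded_add UV strip_bounded_continuous1 continuous strip_bounded_omega)
  qed
  obtain C where C: "0 \<le> C" "\<And>r x. r < 1 \<Longrightarrow> \<bar>Lstar \<mu> r \<omega> x\<bar> \<le> C * near_mass r" using Lstar_bound by metis
  define S where "S p q = \<bar>U p - V q\<bar> * (\<theta> (fst p) * \<theta> (fst q) * \<kappa> (fst p - fst q))" for p q
  have "strip_bounded S" unfolding S_def[abs_def] by (intro strip_bounded_mult UV strip_bounded_continuous1 continuous)
  then obtain CS where CS: "\<And>p q. fst p \<in> {0<..<T} \<Longrightarrow> fst q \<in> {0<..<T} \<Longrightarrow> \<bar>S p q\<bar> \<le> CS"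
    unfolding strip_bounded_def by metis
  let ?v = "measure (cell \<Otimes>\<^sub>M cell) (space (cell \<Otimes>\<^sub>M cell))"
  have step: "0 \<le> (LINT w|(cell \<Otimes>\<^sub>M cell). kato_term U V (fst w) (snd w)) + CS * (2 * C * near_mass r) * ?v"
    if r: "0 < r" "r < 1" for r
  proof -
    define L where "L p q = S p q * (Lstar \<mu> r \<omega> (snd p - snd q) + Lstar \<mu> r \<omega> (snd q - snd p))" for p q
    have Lb: "\<bar>L p q\<bar> \<le> CS * (2 * C * near_mass r)" if "fst p \<in> {0<..<T}" "fst q \<in> {0<..<T}" for p q
    proof -
      have "\<bar>Lstar \<mu> r \<omega> (snd p - snd q) + Lstar \<mu> r \<omega> (snd q - snd p)\<bar> \<le> 2 * C * near_mass r"
        using C(2)[OF r(2), of "snd p - snd q"] C(2)[OF r(2), of "snd q - snd p"] by linarith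
      then show ?thesis
        unfolding L_def abs_mult using CS[OF that] by (intro mult_mono) auto
    qed
    have Lint: "integrable (cell \<Otimes>\<^sub>M cell) (\<lambda>w. L (fst w) (snd w))"
    proof (rule strip_bounded_integrable)
      have [measurable]: "(\<lambda>w :: 'n spacetime \<times> 'n spacetime. Lstar \<mu> r \<omega> (snd (fst w) - snd (snd w))) \<in> borel_measurable borel"
        "(\<lambda>w :: 'n spacetime \<times> 'n spacetime. Lstar \<mu> r \<omega> (snd (snd w) - snd (fst w))) \<in> borel_measurable borel"
        by (rule measurable_compose[OF _ Lstar_measurable], measurable)+
      show "(\<lambda>w. L (fst w) (snd w)) \<in> borel_measurable borel"
        unfolding L_def S_def by measurable
      show "strip_bounded (\<lambda>p q. L (fst (p, q)) (snd (p, q)))"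
        unfolding fst_conv snd_conv by (rule strip_boundedI) (rule Lb)
    qed
    have dU: "integrable (cell \<Otimes>\<^sub>M cell) (\<lambda>w. doubled_integrand r U (V (snd w)) (fst w) (snd w))"
      by (rule strip_bounded_integrable) (use doubled_integrand_strip_bounded[OF U Ub Vb r] doubled_integrand_measurable[OF U V] in auto)
    have dV: "integrable (cell \<Otimes>\<^sub>M cell) (\<lambda>w. doubled_integrand r V (U (fst w)) (snd w) (fst w))"
    proof (rule strip_bounded_integrable)
      have "(\<lambda>w :: 'n spacetime \<times> 'n spacetime. (snd w, fst w)) \<in> borel_measurable borel"
        by (intro borel_measurable_continuous_onI continuous_intros)
      from measurable_compose[OF this doubled_integrand_measurable[OF V U, of r]]
      show "(\<lambda>w. doubled_integrand r V (U (fst w)) (snd w) (fst w)) \<in> borel_measurable borel" by simp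
      show "strip_bounded (\<lambda>p q. doubled_integrand r V (U (fst (p, q))) (snd (p, q)) (fst (p, q)))"
        using strip_bounded_swap[OF doubled_integrand_strip_bounded[OF V Vb Ub r]] by simp
    qed
    have "0 \<le> (LINT q|cell. LINT p|cell. doubled_integrand r U (V q) p q)"
      by (rule integral_nonneg_AE, rule AE_I2) (simp add: integral_cell entU[OF r(1)])
    also have "\<dots> = (LINT w|(cell \<Otimes>\<^sub>M cell). doubled_integrand r U (V (snd w)) (fst w) (snd w))"
      using cell_pair.integral_snd[of "\<lambda>p q. doubled_integrand r U (V q) p q"] dU by (simp add: case_prod_beta')
    finally have 1: "0 \<le> (LINT w|(cell \<Otimes>\<^sub>M cell). doubled_integrand r U (V (snd w)) (fst w) (snd w))" .
    have "0 \<le> (LINT p|cell. LINT q|cell. doubled_integrand r V (U p) q p)"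
      by (rule integral_nonneg_AE, rule AE_I2) (simp add: integral_cell entV[OF r(1)])
    also have "\<dots> = (LINT w|(cell \<Otimes>\<^sub>M cell). doubled_integrand r V (U (fst w)) (snd w) (fst w))"
      using cell_pair.integral_fst[of "\<lambda>p q. doubled_integrand r V (U p) q p"] dV by (simp add: case_prod_beta')
    finally have 2: "0 \<le> (LINT w|(cell \<Otimes>\<^sub>M cell). doubled_integrand r V (U (fst w)) (snd w) (fst w))" .
    have "0 \<le> (LINT w|(cell \<Otimes>\<^sub>M cell). doubled_integrand r U (V (snd w)) (fst w) (snd w) + doubled_integrand r V (U (fst w)) (snd w) (fst w))"
      using 1 2 by (simp add: Bochner_Integration.integral_add[OF dU dV])
    also have "\<dots> \<le> (LINT w|(cell \<Otimes>\<^sub>M cell). (kato_term U V (fst w) (snd w) + L (fst w) (snd w)) + weight (fst w) (snd w) * far_gain r U V (fst w) (snd w))"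
      using doubled_integrand_sum_le[OF U Ub V Vb r(1)] unfolding L_def S_def
      by (intro integral_mono Bochner_Integration.integrable_add dU dV kato_int integral_weight_far_gain(1)[OF r(1)] Lint[unfolded L_def S_def]) auto
    also have "\<dots> = (LINT w|(cell \<Otimes>\<^sub>M cell). kato_term U V (fst w) (snd w)) + (LINT w|(cell \<Otimes>\<^sub>M cell). L (fst w) (snd w))"
      using integral_weight_far_gain[OF r(1)] kato_int Lint by simp
    also have "(LINT w|(cell \<Otimes>\<^sub>M cell). L (fst w) (snd w)) \<le> (LINT w|(cell \<Otimes>\<^sub>M cell). CS * (2 * C * near_mass r))"
    proof (rule integral_mono[OF Lint])
      fix w assume "w \<in> space (cell \<Otimes>\<^sub>M cell)"
      then have "\<bar>L (fst w) (snd w)\<bar> \<le> CS * (2 * C * near_mass r)"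
        by (intro Lb) (auto simp: space_pair_measure space_cell)
      then show "L (fst w) (snd w) \<le> CS * (2 * C * near_mass r)" by linarith
    qed simp
    finally show ?thesis by (simp add: ac_simps)
  qed
  have "(\<lambda>k. (LINT w|(cell \<Otimes>\<^sub>M cell). kato_term U V (fst w) (snd w)) + CS * (2 * C * near_mass (1 / (real k + 2))) * ?v)
      \<longlonglongrightarrow> (LINT w|(cell \<Otimes>\<^sub>M cell). kato_term U V (fst w) (snd w)) + CS * (2 * C * 0) * ?v"
    by (intro tendsto_intros near_mass_tendsto)
  then have "0 \<le> (LINT w|(cell \<Otimes>\<^sub>M cell). kato_term U V (fst w) (snd w)) + CS * (2 * C * 0) * ?v"
    by (rule LIMSEQ_le_const) (intro exI[of _ 0] allI impI step, auto)
  then show ?nonneg by simp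
qed

end

end

section \<open>Collapsing the doubled variables\<close>

text \<open>
  The differences \<open>q - p\<close> of two points of the cell, with the spatial part reduced modulo the periods.
\<close>

definition shift_box :: "real \<Rightarrow> ('n::finite) spacetime set" where
  "shift_box T = {-T<..<T} \<times> centered_cube"

lemma bounded_centered_cube: "bounded centered_cube"
  by (simp add: centered_cube_def bounded_box)

lemma shift_box_borel: "shift_box T \<in> sets borel"
  unfolding shift_box_def borel_prod[symmetric] by (intro pair_measureI) auto

lemma bounded_shift_box: "bounded (shift_box T)"
  unfolding shift_box_def by (intro bounded_Times bounded_centered_cube) simp

text \<open>
  In space the cell may be moved around \<open>x\<close> by periodicity. In time, \<open>Q\<close> vanishes outside \<open>(0, T)\<close>, so
  that enlarging the range of times to \<open>(t - T, t + T)\<close> changes nothing.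
\<close>

lemma integral_recentre:
  fixes Q :: "('n::finite) spacetime \<Rightarrow> real"
  assumes Q: "Q \<in> borel_measurable borel" "\<And>q. \<bar>Q q\<bar> \<le> C"
    and per: "\<And>s. periodic (\<lambda>y. Q (s, y))" and zero: "\<And>s y. s \<notin> {0<..<T} \<Longrightarrow> Q (s, y) = 0"
    and t: "t \<in> {0<..<T}"
  shows "(LINT q:{0<..<T} \<times> Lam|lborel. Q q) = (LINT w:shift_box T|lborel. Q (t + fst w, x + snd w))"
proof -
  define h where "h s = (LINT w:centered_cube|lborel. Q (s, x + w))" for s
  have Qs: "(\<lambda>w :: 'n spacetime. Q (fst w, x + snd w)) \<in> borel_measurable borel"
    "(\<lambda>w :: 'n spacetime. Q (t + fst w, x + snd w)) \<in> borel_measurable borel"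
    by (intro measurable_compose[OF _ Q(1)] borel_measurable_continuous_onI continuous_intros)+
  have h: "h \<in> borel_measurable borel"
  proof -
    have "(\<lambda>w :: 'n spacetime. indicator centered_cube (snd w) *\<^sub>R Q (fst w, x + snd w)) \<in> borel_measurable borel"
      by (intro borel_measurable_scaleR Qs measurable_compose[OF snd_borel]) measurable
    moreover have s: "sets ((borel :: real measure) \<Otimes>\<^sub>M (lborel :: (real ^ 'n) measure)) = sets borel"
      by (rule sets_borel_pair_lborel)
    ultimately have "(\<lambda>w :: 'n spacetime. indicator centered_cube (snd w) *\<^sub>R Q (fst w, x + snd w)) \<in> borel_measurable (borel \<Otimes>\<^sub>M lborel)"
      unfolding measurable_cong_sets[OF s refl] by blast
    then show ?thesis
      unfolding h_def set_lebesgue_integral_def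
      by (intro lborel.borel_measurable_lebesgue_integral) (simp add: case_prod_beta')
  qed
  have h0: "h s = 0" if "s \<notin> {0<..<T}" for s
    using zero[OF that] by (simp add: h_def)
  have "(LINT q:{0<..<T} \<times> Lam|lborel. Q q) = (LINT s:{0<..<T}|lborel. LINT y:Lam|lborel. Q (s, y))"
    using Q bounded_Lam by (intro set_integral_Times_iterated(1)[where C = C]) auto
  also have "\<dots> = (LINT s:{0<..<T}|lborel. h s)"
    unfolding h_def using integral_Lam_eq_centered_cube[OF per measurable_Pair_left[OF Q(1)] Q(2)] by simp
  also have "\<dots> = (LINT s|lborel. h s)"
    unfolding set_lebesgue_integral_def
    by (rule Bochner_Integration.integral_cong) (use h0 in \<open>auto simp: indicator_def\<close>)
  also have "\<dots> = (LINT \<tau>|lborel. h (\<tau> + t))"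
    by (rule lborel_integral_translation[OF h, symmetric])
  also have "\<dots> = (LINT \<tau>:{-T<..<T}|lborel. h (t + \<tau>))"
    unfolding set_lebesgue_integral_def
  proof (rule Bochner_Integration.integral_cong[OF refl])
    fix \<tau> show "h (\<tau> + t) = indicat_real {- T<..<T} \<tau> *\<^sub>R h (t + \<tau>)"
    proof (cases "\<tau> \<in> {-T<..<T}")
      case False
      then have "\<tau> + t \<notin> {0<..<T}" using t by auto
      from h0[OF this] False show ?thesis by simp
    qed (simp add: add.commute)
  qed
  also have "\<dots> = (LINT w:shift_box T|lborel. Q (t + fst w, x + snd w))"
    unfolding h_def shift_box_def
    using set_integral_Times_iterated(1)[OF _ _ centered_cube_borel bounded_centered_cube Qs(2), of "{-T<..<T}" C] Q(2) by simp
  finally show ?thesis .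
qed

definition kernel_base :: "real \<Rightarrow> ('n::finite) spacetime \<Rightarrow> real" where
  "kernel_base T w = (1 + cos (pi / T * fst w)) / 2 * (\<Prod>i\<in>UNIV. (1 + cos (snd w $ i)) / 2)"

lemma kernel_base_power: "kernel_base T w ^ n = time_kernel T n (fst w) * space_kernel n (snd w)"
  unfolding kernel_base_def time_kernel_def space_kernel_def by (rule power_mult_distrib)

lemma kernel_base_continuous: "continuous_on UNIV (kernel_base T)"
  unfolding kernel_base_def by (intro continuous_intros) auto

lemma half_cos: "0 \<le> (1 + cos a) / 2" "(1 + cos a) / 2 \<le> (1 :: real)"
proof -
  have "0 \<le> 1 + cos a" using cos_ge_minus_one[of a] by linarith
  then show "0 \<le> (1 + cos a) / 2" by (rule divide_nonneg_pos) simp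
qed (simp add: divide_le_eq)

lemma half_cos_less:
  assumes "\<bar>a\<bar> \<le> pi" "a \<noteq> 0" shows "(1 + cos a) / 2 < (1 :: real)"
proof -
  have "cos \<bar>a\<bar> < cos 0" using assms by (intro cos_monotone_0_pi) auto
  then show ?thesis by simp
qed

lemma kernel_base_nonneg: "0 \<le> kernel_base T w"
  unfolding kernel_base_def by (intro mult_nonneg_nonneg prod_nonneg ballI half_cos)

lemma kernel_base_less_1:
  assumes T: "0 < T" and w: "w \<in> closure (shift_box T)" "w \<noteq> 0"
  shows "kernel_base T w < 1"
proof -
  have "closure (shift_box T) \<subseteq> {-T..T} \<times> cbox (\<chi> i. - pi) (\<chi> i. pi)"
    by (intro closure_minimal closed_Times closed_cbox closed_atLeastAtMost)
      (auto simp: shift_box_def centered_cube_iff mem_box_cart less_imp_le)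
  with w have "w \<in> {-T..T} \<times> cbox (\<chi> i. - pi) (\<chi> i. pi)" by blast
  then have t: "\<bar>fst w\<bar> \<le> T" and x: "\<bar>snd w $ i\<bar> \<le> pi" for i
    by (auto simp: mem_box_cart abs_le_iff mem_Times_iff minus_le_iff)
  let ?P = "\<Prod>i\<in>UNIV. (1 + cos (snd w $ i)) / 2"
  have P: "0 \<le> ?P" "?P \<le> 1" by (intro prod_nonneg prod_le_1 ballI conjI half_cos)+
  show ?thesis
  proof (cases "fst w = 0")
    case False
    have "\<bar>pi / T * fst w\<bar> \<le> pi" using t T by (simp add: abs_mult field_simps)
    moreover have "pi / T * fst w \<noteq> 0" using False T by simp
    ultimately have "(1 + cos (pi / T * fst w)) / 2 < 1" by (rule half_cos_less)
    moreover have "(1 + cos (pi / T * fst w)) / 2 * ?P \<le> (1 + cos (pi / T * fst w)) / 2 * 1"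
      using P(2) half_cos by (intro mult_left_mono)
    ultimately show ?thesis by (simp add: kernel_base_def)
  next
    case True
    then have "snd w \<noteq> 0" using w(2) by (metis prod.collapse zero_prod_def)
    then obtain j where j: "snd w $ j \<noteq> 0" by (auto simp: vec_eq_iff)
    have "?P = (1 + cos (snd w $ j)) / 2 * (\<Prod>i\<in>UNIV - {j}. (1 + cos (snd w $ i)) / 2)"
      by (rule prod.remove) auto
    also have "\<dots> \<le> (1 + cos (snd w $ j)) / 2 * 1"
      by (intro mult_left_mono prod_le_1 conjI half_cos)
    also have "\<dots> < 1" using half_cos_less[OF x j] by simp
    finally show ?thesis by (simp add: kernel_base_def True)
  qed
qed

lemma zero_in_interior_shift_box: "0 < T \<Longrightarrow> (0 :: ('n::finite) spacetime) \<in> interior (shift_box T)"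
  unfolding shift_box_def
  by (intro interiorI[of "{-T<..<T} \<times> centered_cube"]) (auto simp: zero_prod_def centered_cube_def mem_box_cart intro: open_Times)

lemma translation_tendsto:
  fixes g :: "('n::finite) spacetime \<Rightarrow> real"
  assumes g: "g \<in> borel_measurable borel" "\<And>x. \<bar>g x\<bar> \<le> M"
  shows "((\<lambda>w. LINT p:{0<..<T} \<times> Lam|lborel. \<bar>g (p + w) - g p\<bar>) \<longlongrightarrow> 0) (at 0)"
  by (rule L1_translation_continuous[OF g cell_borel bounded_cell])

text \<open>
  Substituting \<open>q = p + w\<close> and integrating over \<open>p\<close> first, the double integral becomes the integral of
  \<open>kernel_base T w ^ n * N w\<close> over the differences \<open>w\<close>, where \<open>N w\<close> pairs \<open>U\<close> with the translate of \<open>V\<close> by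
  \<open>w\<close>. Translations being continuous in \<open>L\<^sup>1\<close>, \<open>N\<close> is continuous at \<open>0\<close>, and \<open>N 0\<close> is the diagonal integral
  of the conclusion.
\<close>

lemma kato_localization:
  fixes U V :: "('n::finite) spacetime \<Rightarrow> real" and \<theta> \<theta>' :: "real \<Rightarrow> real"
  assumes T: "0 < T"
    and U: "U \<in> borel_measurable borel" "\<And>p. \<bar>U p\<bar> \<le> m" "\<And>t. periodic (\<lambda>x. U (t, x))"
    and V: "V \<in> borel_measurable borel" "\<And>p. \<bar>V p\<bar> \<le> m" "\<And>t. periodic (\<lambda>x. V (t, x))"
    and \<theta>: "continuous_on UNIV \<theta>" "continuous_on UNIV \<theta>'"
    and zero: "\<And>t. t \<notin> {0<..<T} \<Longrightarrow> \<theta> t = 0 \<and> \<theta>' t = 0"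
    and ineq: "\<And>n. 0 \<le> (LINT p:{0<..<T} \<times> Lam|lborel. LINT q:{0<..<T} \<times> Lam|lborel.
       \<bar>U p - V q\<bar> * (\<theta>' (fst p) * \<theta> (fst q) + \<theta> (fst p) * \<theta>' (fst q)) * time_kernel T n (fst p - fst q) * space_kernel n (snd p - snd q))"
  shows "0 \<le> (LINT p:{0<..<T} \<times> Lam|lborel. \<bar>U p - V p\<bar> * (2 * \<theta> (fst p) * \<theta>' (fst p)))"
proof -
  let ?D = "{0<..<T} \<times> (Lam :: (real ^ 'n) set)"
  note D = cell_borel[of T] bounded_cell[of T]
  define \<psi> where "\<psi> a b = \<theta>' a * \<theta> b + \<theta> a * \<theta>' b" for a b
  define F where "F p w = \<bar>U p - V (p + w)\<bar> * \<psi> (fst p) (fst p + fst w)" for p w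
  define N where "N w = (LINT p:?D|lborel. F p w)" for w
  have "\<exists>c. \<forall>t. \<bar>g t\<bar> \<le> c" if g: "continuous_on UNIV g" "\<And>t. t \<notin> {0<..<T} \<Longrightarrow> g t = 0" for g :: "real \<Rightarrow> real"
  proof -
    obtain c where c: "\<And>t. t \<in> {0..T} \<Longrightarrow> \<bar>g t\<bar> \<le> c"
      using continuous_bounded_Icc[OF g(1)] by blast
    have "\<bar>g t\<bar> \<le> \<bar>c\<bar>" for t
    proof (cases "t \<in> {0<..<T}")
      case True
      with c[of t] show ?thesis by simp
    qed (simp add: g(2))
    then show ?thesis by blast
  qed
  then obtain c0 c1 where c0: "\<And>t. \<bar>\<theta> t\<bar> \<le> c0" and c1: "\<And>t. \<bar>\<theta>' t\<bar> \<le> c1"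
    using \<theta> zero by metis
  define c where "c = max c0 c1"
  have c: "\<bar>\<theta> t\<bar> \<le> c" "\<bar>\<theta>' t\<bar> \<le> c" for t
    using c0[of t] c1[of t] by (auto simp: c_def)
  have cpos: "0 \<le> c" using c(1)[of 0] by linarith
  have mpos: "0 \<le> m" using U(2)[of 0] by linarith
  have \<psi>b: "\<bar>\<psi> a b\<bar> \<le> 2 * c * c" for a b
  proof -
    have "\<bar>\<psi> a b\<bar> \<le> \<bar>\<theta>' a\<bar> * \<bar>\<theta> b\<bar> + \<bar>\<theta> a\<bar> * \<bar>\<theta>' b\<bar>"
      unfolding \<psi>_def by (rule order_trans[OF abs_triangle_ineq]) (simp add: abs_mult)
    also have "\<dots> \<le> c * c + c * c"
      by (intro add_mono mult_mono c cpos) auto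
    finally show ?thesis by simp
  qed
  have UVb: "\<bar>U p - V q\<bar> \<le> 2 * m" for p q
    using U(2)[of p] V(2)[of q] by linarith
  have Fb: "\<bar>F p w\<bar> \<le> (2 * m) * (2 * c * c)" for p w
    unfolding F_def abs_mult using UVb \<psi>b mpos by (intro mult_mono) auto
  note [measurable] = U(1) V(1) borel_measurable_continuous_onI[OF \<theta>(1)] borel_measurable_continuous_onI[OF \<theta>(2)]
  have add_meas [measurable]: "(\<lambda>z :: 'n spacetime \<times> 'n spacetime. fst z + snd z) \<in> borel_measurable borel"
    by (intro borel_measurable_continuous_onI continuous_intros)
  have F [measurable]: "(\<lambda>z. F (fst z) (snd z)) \<in> borel_measurable borel"
    unfolding F_def \<psi>_def by measurable
  have kernel_base [measurable]: "kernel_base T \<in> borel_measurable borel"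
    using kernel_base_continuous by (rule borel_measurable_continuous_onI)
  have kxt1: "\<bar>kernel_base T w\<bar> \<le> 1" for w :: "'n spacetime"
  proof -
    have "(1 + cos (pi / T * fst w)) / 2 * (\<Prod>i\<in>UNIV. (1 + cos (snd w $ i)) / 2) \<le> 1 * 1"
      by (intro mult_mono prod_le_1 prod_nonneg conjI ballI half_cos) simp
    then show ?thesis using kernel_base_nonneg[of T w] by (simp add: kernel_base_def)
  qed
  have main: "0 \<le> (LINT w:shift_box T|lborel. kernel_base T w ^ n * N w)" for n
  proof -
    let ?G = "\<lambda>z. kernel_base T (snd z) ^ n * F (fst z) (snd z)"
    have Gm: "?G \<in> borel_measurable borel" by measurable
    have Gb: "\<bar>?G (p, w)\<bar> \<le> (2 * m) * (2 * c * c)" for p w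
    proof -
      have "\<bar>kernel_base T w ^ n\<bar> \<le> 1" using kxt1[of w] by (simp add: power_abs power_le_one)
      then have "\<bar>kernel_base T w ^ n\<bar> * \<bar>F p w\<bar> \<le> 1 * ((2 * m) * (2 * c * c))"
        using Fb[of p w] by (intro mult_mono) auto
      then show ?thesis by (simp add: abs_mult)
    qed
    have "(LINT w:shift_box T|lborel. kernel_base T w ^ n * N w) = (LINT w:shift_box T|lborel. LINT p:?D|lborel. ?G (p, w))"
      by (simp add: N_def)
    also have "\<dots> = (LINT p:?D|lborel. LINT w:shift_box T|lborel. ?G (p, w))"
      using set_integral_Times_iterated[OF D shift_box_borel bounded_shift_box Gm, of T "(2 * m) * (2 * c * c)"] Gb by simp
    also have "\<dots> = (LINT p:?D|lborel. LINT q:?D|lborel. \<bar>U p - V q\<bar> * (\<theta>' (fst p) * \<theta> (fst q) + \<theta> (fst p) * \<theta>' (fst q)) * time_kernel T n (fst p - fst q) * space_kernel n (snd p - snd q))"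
    proof (rule set_lebesgue_integral_cong[OF cell_borel[folded sets_lborel]], intro allI impI)
      fix p assume p: "p \<in> ?D"
      define Q where "Q q = \<bar>U p - V q\<bar> * \<psi> (fst p) (fst q) * kernel_base T (q - p) ^ n" for q
      have "(LINT q:?D|lborel. Q q) = (LINT w:shift_box T|lborel. Q (fst p + fst w, snd p + snd w))"
      proof (rule integral_recentre[where C = "(2 * m) * (2 * c * c)"])
        have "(\<lambda>q. kernel_base T (q - p)) \<in> borel_measurable borel"
          by (rule measurable_compose[OF _ kernel_base]) (intro borel_measurable_continuous_onI continuous_intros)
        then show "Q \<in> borel_measurable borel"
          unfolding Q_def \<psi>_def by measurable
        show "\<bar>Q q\<bar> \<le> (2 * m) * (2 * c * c)" for q
        proof -
          have "\<bar>U p - V q\<bar> * \<bar>\<psi> (fst p) (fst q)\<bar> * \<bar>kernel_base T (q - p)\<bar> ^ n \<le> (2 * m) * (2 * c * c) * 1"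
            using UVb \<psi>b mpos cpos kxt1 by (intro mult_mono power_le_one) auto
          then show ?thesis by (simp add: Q_def abs_mult power_abs)
        qed
        show "periodic (\<lambda>y. Q (s, y))" for s
        proof -
          have "kernel_base T ((s, y + axis i (2 * pi)) - p) = kernel_base T ((s, y) - p)" for y i
          proof -
            have "cos ((y + axis i (2 * pi) - snd p) $ j) = cos ((y - snd p) $ j)" for j
            proof (cases "i = j")
              case True
              then have "(y + axis i (2 * pi) - snd p) $ j = (y - snd p) $ j + 2 * pi" by simp
              then show ?thesis by (simp only: cos_periodic)
            qed (simp add: axis_def)
            then show ?thesis by (simp only: kernel_base_def fst_diff snd_diff fst_conv snd_conv)
          qed
          then show ?thesis using V(3)[of s] by (simp add: periodic_def Q_def)
        qed
        show "Q (s, y) = 0" if "s \<notin> {0<..<T}" for s y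
          using zero[OF that] by (simp add: Q_def \<psi>_def)
      qed (use p in auto)
      moreover have "Q (fst p + fst w, snd p + snd w) = ?G (p, w)" for w
      proof -
        have "(fst p + fst w, snd p + snd w) = p + w" by (simp add: prod_eq_iff)
        then show ?thesis by (simp add: Q_def F_def)
      qed
      moreover have "Q q = \<bar>U p - V q\<bar> * (\<theta>' (fst p) * \<theta> (fst q) + \<theta> (fst p) * \<theta>' (fst q)) * time_kernel T n (fst p - fst q) * space_kernel n (snd p - snd q)" for q
      proof -
        have "time_kernel T n (fst q - fst p) = time_kernel T n (fst p - fst q)" "space_kernel n (snd q - snd p) = space_kernel n (snd p - snd q)"
          using time_kernel_even[of T n "fst p - fst q"] space_kernel_even[of n "snd p - snd q"] by simp_all
        then show ?thesis by (simp add: Q_def \<psi>_def kernel_base_power)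
      qed
      ultimately show "(LINT w:shift_box T|lborel. ?G (p, w)) = (LINT q:?D|lborel. \<bar>U p - V q\<bar> * (\<theta>' (fst p) * \<theta> (fst q) + \<theta> (fst p) * \<theta>' (fst q)) * time_kernel T n (fst p - fst q) * space_kernel n (snd p - snd q))"
        by simp
    qed
    finally show ?thesis using ineq[of n] by simp
  qed
  have int: "set_integrable lborel ?D g" if "g \<in> borel_measurable borel" "\<And>p. \<bar>g p\<bar> \<le> B" for g :: "'n spacetime \<Rightarrow> real" and B
    using that by (intro set_integrable_lborel_bounded[OF D]) auto
  have Fw: "(\<lambda>p. F p w) \<in> borel_measurable borel" for w
  proof -
    have "(\<lambda>p :: 'n spacetime. (p, w)) \<in> borel_measurable borel"
      by (intro borel_measurable_continuous_onI continuous_intros)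
    from measurable_compose[OF this F] show ?thesis by simp
  qed
  have N_meas: "N \<in> borel_measurable borel"
  proof -
    have "(\<lambda>z. indicator ?D (snd z) *\<^sub>R F (snd z) (fst z)) \<in> borel_measurable borel"
    proof (intro borel_measurable_scaleR)
      have "(\<lambda>z :: 'n spacetime \<times> 'n spacetime. (snd z, fst z)) \<in> borel_measurable borel"
        by (intro borel_measurable_continuous_onI continuous_intros)
      from measurable_compose[OF this F] show "(\<lambda>z. F (snd z) (fst z)) \<in> borel_measurable borel" by simp
      show "(\<lambda>z :: 'n spacetime \<times> 'n spacetime. indicat_real ?D (snd z)) \<in> borel_measurable borel"
        by (rule measurable_compose[OF snd_borel]) (use cell_borel in measurable)
    qed
    moreover have s: "sets ((borel :: 'n spacetime measure) \<Otimes>\<^sub>M (lborel :: 'n spacetime measure)) = sets borel"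
      by (rule sets_borel_pair_lborel)
    ultimately have "(\<lambda>z. indicator ?D (snd z) *\<^sub>R F (snd z) (fst z)) \<in> borel_measurable (borel \<Otimes>\<^sub>M lborel)"
      unfolding measurable_cong_sets[OF s refl] by blast
    then show ?thesis
      unfolding N_def set_lebesgue_integral_def
      by (intro lborel.borel_measurable_lebesgue_integral) (simp add: case_prod_beta')
  qed
  have N_bound: "\<bar>N w\<bar> \<le> (LINT p:?D|lborel. (2 * m) * (2 * c * c))" for w
  proof -
    have "(LINT p|lborel. norm (indicat_real ?D p *\<^sub>R F p w)) \<le> (LINT p|lborel. indicat_real ?D p *\<^sub>R ((2 * m) * (2 * c * c)))"
      using int[OF Fw Fb] int[of "\<lambda>_. (2 * m) * (2 * c * c)" "(2 * m) * (2 * c * c)"] Fb mpos cpos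
      unfolding set_integrable_def by (intro integral_mono) (auto simp: indicator_def)
    from order_trans[OF integral_norm_bound this] show ?thesis
      unfolding N_def set_lebesgue_integral_def real_norm_def .
  qed
  have N_cont: "isCont N 0"
  proof -
    define E where "E w = 2 * c * c * (LINT p:?D|lborel. \<bar>V (p + w) - V p\<bar>)
        + 2 * m * c * ((LINT p:?D|lborel. \<bar>\<theta> (fst (p + w)) - \<theta> (fst p)\<bar>) + (LINT p:?D|lborel. \<bar>\<theta>' (fst (p + w)) - \<theta>' (fst p)\<bar>))" for w
    have th: "(\<lambda>p :: 'n spacetime. \<theta> (fst p)) \<in> borel_measurable borel" "(\<lambda>p :: 'n spacetime. \<theta>' (fst p)) \<in> borel_measurable borel"
      by measurable
    have "(E \<longlongrightarrow> 2 * c * c * 0 + 2 * m * c * (0 + 0)) (at 0)"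
      unfolding E_def
      by (intro tendsto_intros translation_tendsto[OF V(1,2)] translation_tendsto[OF th(1) c(1)] translation_tendsto[OF th(2) c(2)])
    then have E0: "(E \<longlongrightarrow> 0) (at 0)" by simp
    have NE: "\<bar>N w - N 0\<bar> \<le> E w" for w
    proof -
      have shift: "(\<lambda>p. g (p + w)) \<in> borel_measurable borel" if "g \<in> borel_measurable borel" for g :: "'n spacetime \<Rightarrow> real"
        by (rule measurable_compose[OF _ that]) (intro borel_measurable_continuous_onI continuous_intros)
      have i: "set_integrable lborel ?D (\<lambda>p. \<bar>g (p + w) - g p\<bar>)" if g: "g \<in> borel_measurable borel" "\<And>p. \<bar>g p\<bar> \<le> B" for g :: "'n spacetime \<Rightarrow> real" and B
      proof (rule int)
        show "(\<lambda>p. \<bar>g (p + w) - g p\<bar>) \<in> borel_measurable borel"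
          using shift[OF g(1)] g(1) by measurable
        show "\<bar>\<bar>g (p + w) - g p\<bar>\<bar> \<le> 2 * B" for p using g(2)[of p] g(2)[of "p + w"] by linarith
      qed
      note iV = i[OF V(1,2)] and i0 = i[OF th(1) c(1)] and i1 = i[OF th(2) c(2)]
      have bnd: "set_integrable lborel ?D (\<lambda>p. 2 * c * c * \<bar>V (p + w) - V p\<bar> + 2 * m * c * (\<bar>\<theta> (fst (p + w)) - \<theta> (fst p)\<bar> + \<bar>\<theta>' (fst (p + w)) - \<theta>' (fst p)\<bar>))"
        by (intro set_integral_add(1) set_integrable_mult_right iV i0 i1)
      have pw: "\<bar>F p w - F p 0\<bar> \<le> 2 * c * c * \<bar>V (p + w) - V p\<bar> + 2 * m * c * (\<bar>\<theta> (fst (p + w)) - \<theta> (fst p)\<bar> + \<bar>\<theta>' (fst (p + w)) - \<theta>' (fst p)\<bar>)" for p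
      proof -
        let ?a = "\<bar>U p - V p\<bar>" and ?a' = "\<bar>U p - V (p + w)\<bar>"
        let ?b = "\<psi> (fst p) (fst p)" and ?b' = "\<psi> (fst p) (fst p + fst w)"
        have "F p w - F p 0 = (?a' - ?a) * ?b' + ?a * (?b' - ?b)"
          by (simp add: F_def algebra_simps)
        then have "\<bar>F p w - F p 0\<bar> \<le> \<bar>?a' - ?a\<bar> * \<bar>?b'\<bar> + \<bar>?a\<bar> * \<bar>?b' - ?b\<bar>"
          by (metis abs_mult abs_triangle_ineq)
        also have "\<bar>?a' - ?a\<bar> * \<bar>?b'\<bar> \<le> \<bar>V (p + w) - V p\<bar> * (2 * c * c)"
          using \<psi>b by (intro mult_mono) auto
        also have "\<bar>?a\<bar> * \<bar>?b' - ?b\<bar> \<le> (2 * m) * (c * \<bar>\<theta> (fst (p + w)) - \<theta> (fst p)\<bar> + c * \<bar>\<theta>' (fst (p + w)) - \<theta>' (fst p)\<bar>)"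
        proof (intro mult_mono)
          have "?b' - ?b = \<theta>' (fst p) * (\<theta> (fst (p + w)) - \<theta> (fst p)) + \<theta> (fst p) * (\<theta>' (fst (p + w)) - \<theta>' (fst p))"
            by (simp add: \<psi>_def algebra_simps)
          then have "\<bar>?b' - ?b\<bar> \<le> \<bar>\<theta>' (fst p)\<bar> * \<bar>\<theta> (fst (p + w)) - \<theta> (fst p)\<bar> + \<bar>\<theta> (fst p)\<bar> * \<bar>\<theta>' (fst (p + w)) - \<theta>' (fst p)\<bar>"
            by (metis abs_mult abs_triangle_ineq)
          also have "\<dots> \<le> c * \<bar>\<theta> (fst (p + w)) - \<theta> (fst p)\<bar> + c * \<bar>\<theta>' (fst (p + w)) - \<theta>' (fst p)\<bar>"
            by (intro add_mono mult_right_mono c) auto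
          finally show "\<bar>?b' - ?b\<bar> \<le> c * \<bar>\<theta> (fst (p + w)) - \<theta> (fst p)\<bar> + c * \<bar>\<theta>' (fst (p + w)) - \<theta>' (fst p)\<bar>" .
        qed (use UVb mpos in auto)
        finally show ?thesis by (simp add: algebra_simps)
      qed
      have iF: "set_integrable lborel ?D (\<lambda>p. F p w)" for w by (rule int[OF Fw Fb])
      have "\<bar>N w - N 0\<bar> = \<bar>LINT p:?D|lborel. F p w - F p 0\<bar>"
        unfolding N_def set_integral_diff(2)[OF iF iF] ..
      also have "\<dots> \<le> (LINT p:?D|lborel. 2 * c * c * \<bar>V (p + w) - V p\<bar> + 2 * m * c * (\<bar>\<theta> (fst (p + w)) - \<theta> (fst p)\<bar> + \<bar>\<theta>' (fst (p + w)) - \<theta>' (fst p)\<bar>))"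
      proof -
        have "(LINT p|lborel. norm (indicat_real ?D p *\<^sub>R (F p w - F p 0))) \<le>
          (LINT p|lborel. indicat_real ?D p *\<^sub>R (2 * c * c * \<bar>V (p + w) - V p\<bar> + 2 * m * c * (\<bar>\<theta> (fst (p + w)) - \<theta> (fst p)\<bar> + \<bar>\<theta>' (fst (p + w)) - \<theta>' (fst p)\<bar>)))"
          using set_integral_diff(1)[OF iF iF, of w 0] bnd pw unfolding set_integrable_def
          by (intro integral_mono) (auto simp: indicator_def)
        from order_trans[OF integral_norm_bound this] show ?thesis
          unfolding set_lebesgue_integral_def real_norm_def .
      qed
      also have "\<dots> = E w"
        unfolding E_def
        by (subst set_integral_add(2), (intro set_integral_add(1) set_integrable_mult_right iV i0 i1)+)
          (simp only: set_integral_add(2)[OF i0 i1] set_integral_mult_right)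
      finally show ?thesis .
    qed
    have "((\<lambda>w. N w - N 0) \<longlongrightarrow> 0) (at 0)"
      by (rule Lim_null_comparison[OF _ E0]) (use NE in auto)
    then show ?thesis unfolding isCont_def by (simp add: LIM_zero_iff)
  qed
  have "0 \<le> N 0"
    by (rule kernel_concentration[where K = "shift_box T" and \<kappa> = "kernel_base T" and N = N, OF bounded_shift_box shift_box_borel
          zero_in_interior_shift_box[OF T] kernel_base_continuous kernel_base_nonneg _ kernel_base_less_1[OF T] N_meas N_bound N_cont main])
      (auto simp: kernel_base_def)
  also have "N 0 = (LINT p:?D|lborel. \<bar>U p - V p\<bar> * (2 * \<theta> (fst p) * \<theta>' (fst p)))"
    by (simp add: N_def F_def \<psi>_def algebra_simps)
  finally show ?thesis .
qed

text \<open>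
  The kernels of every order \<open>n\<close> are admissible in the doubling step, so that the diagonal limit applies.
\<close>

lemma (in levy_measure) kato_inequality:
  fixes f :: "'n \<Rightarrow> real \<Rightarrow> real" and U V :: "'n spacetime \<Rightarrow> real"
  assumes f: "\<And>j. continuous_on UNIV (f j)" and T: "0 < T"
    and u: "periodic_entropy_solution T f \<mu> u0 u" and v: "periodic_entropy_solution T f \<mu> v0 v"
    and U: "U \<in> borel_measurable borel" "\<And>p. \<bar>U p\<bar> \<le> m" "\<And>t. periodic (\<lambda>x. U (t, x))"
      "\<And>t. t \<in> {0..T} \<Longrightarrow> AE x in lborel. U (t, x) = u t x"
    and V: "V \<in> borel_measurable borel" "\<And>p. \<bar>V p\<bar> \<le> m" "\<And>t. periodic (\<lambda>x. V (t, x))"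
      "\<And>t. t \<in> {0..T} \<Longrightarrow> AE x in lborel. V (t, x) = v t x"
    and theta: "smooth_real \<theta>" "\<And>t. (\<theta> has_real_derivative \<theta>' t) (at t)" "\<And>t. 0 \<le> \<theta> t"
    and support: "\<exists>a b. 0 < a \<and> b < T \<and> (\<forall>t. t \<notin> {a..b} \<longrightarrow> \<theta> t = 0 \<and> \<theta>' t = 0)"
  shows "0 \<le> (LINT p:{0<..<T} \<times> Lam|lborel. \<bar>U p - V p\<bar> * (2 * \<theta> (fst p) * \<theta>' (fst p)))"
proof -
  have dbl: "\<exists>\<kappa>'. doubling \<mu> f T \<theta> \<theta>' (time_kernel T n) \<kappa>' (space_kernel n)" for n
  proof -
    obtain \<kappa>' where \<kappa>': "\<And>t. (time_kernel T n has_real_derivative \<kappa>' t) (at t)"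
      by (rule smooth_real_deriv[OF time_kernel_smooth_real]) blast
    have "doubling \<mu> f T \<theta> \<theta>' (time_kernel T n) \<kappa>' (space_kernel n)"
      by unfold_locales
        (use f T theta support in \<open>simp_all add: \<kappa>' time_kernel_smooth_real time_kernel_nonneg time_kernel_even space_kernel_smooth space_kernel_nonneg space_kernel_even space_kernel_periodic space_kernel_taylor2\<close>)
    then show ?thesis by blast
  qed
  obtain \<kappa>0 where "doubling \<mu> f T \<theta> \<theta>' (time_kernel T 0) \<kappa>0 (space_kernel 0)" using dbl[of 0] by blast
  then interpret D0: doubling \<mu> f T \<theta> \<theta>' "time_kernel T 0" \<kappa>0 "space_kernel 0" .
  show ?thesis
  proof (rule kato_localization[OF T U(1-3) V(1-3) D0.continuous(1,2)])
    obtain a b where ab: "0 < a" "b < T" "\<And>t. t \<notin> {a..b} \<Longrightarrow> \<theta> t = 0 \<and> \<theta>' t = 0"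
      using support by blast
    show "\<theta> t = 0 \<and> \<theta>' t = 0" if "t \<notin> {0<..<T}" for t
      using that ab(1,2) by (intro ab(3)) auto
    fix n
    obtain \<kappa>' where "doubling \<mu> f T \<theta> \<theta>' (time_kernel T n) \<kappa>' (space_kernel n)" using dbl[of n] by blast
    then interpret D: doubling \<mu> f T \<theta> \<theta>' "time_kernel T n" \<kappa>' "space_kernel n" .
    note dbl_ineq = D.doubling_inequality[OF U(1-3) V(1-3) D.entropy_inequality[OF u U(1,4)] D.entropy_inequality[OF v V(1,4)]]
    have "(LINT w|(D.cell \<Otimes>\<^sub>M D.cell). D.kato_term U V (fst w) (snd w)) = (LINT p|D.cell. LINT q|D.cell. D.kato_term U V p q)"
      using D0.cell_pair.integral_fst'[OF dbl_ineq(1)] by simp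
    also have "\<dots> = (LINT p:{0<..<T} \<times> Lam|lborel. LINT q:{0<..<T} \<times> Lam|lborel. D.kato_term U V p q)"
      by (simp add: D.integral_cell)
    finally show "0 \<le> (LINT p:{0<..<T} \<times> Lam|lborel. LINT q:{0<..<T} \<times> Lam|lborel.
       \<bar>U p - V q\<bar> * (\<theta>' (fst p) * \<theta> (fst q) + \<theta> (fst p) * \<theta>' (fst q)) * time_kernel T n (fst p - fst q) * space_kernel n (snd p - snd q))"
      using dbl_ineq(2) by (simp add: D.kato_term_def)
  qed
qed

text \<open>
  By periodicity the integral of \<open>g\<close> is zero over every translate of the cell, so that \<open>g\<close> vanishes
  almost everywhere in each. Countably many translates, by integer multiples of \<open>pi\<close>, cover the whole
  space; multiples of \<open>2 * pi\<close> would miss the hyperplanes between the open cells.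
\<close>

lemma AE_periodic_extension:
  fixes g :: "real ^ 'n \<Rightarrow> real"
  assumes g: "periodic g" "g \<in> borel_measurable borel" "\<And>x. 0 \<le> g x" "\<And>x. g x \<le> M"
    and zero: "(LINT x:Lam|lborel. g x) = 0"
  shows "AE x in lborel. g x = 0"
proof -
  have b: "\<bar>g x\<bar> \<le> M" for x using g(3,4)[of x] by simp
  have cell: "AE y in lborel. y - z \<in> Lam \<longrightarrow> g y = 0" for z
  proof -
    have m: "(\<lambda>x. g (x + z)) \<in> borel_measurable borel"
      by (rule measurable_compose[OF _ g(2)]) (intro borel_measurable_continuous_onI continuous_intros)
    have "set_integrable lborel Lam (\<lambda>x. g (x + z))"
      by (rule set_integrable_lborel_bounded[OF Lam_borel bounded_Lam m b])
    moreover have "(LINT x:Lam|lborel. g (x + z)) = 0"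
      using integral_Lam_shift[OF g(1,2) b] zero by simp
    ultimately have "AE x in lborel. indicat_real Lam x *\<^sub>R g (x + z) = 0"
      unfolding set_integrable_def set_lebesgue_integral_def
      by (subst (asm) integral_nonneg_eq_0_iff_AE) (use g(3) in auto)
    then have "AE x in lborel. indicat_real Lam (x - z) *\<^sub>R g (x - z + z) = 0"
      using AE_lborel_translation[of "\<lambda>x. indicat_real Lam x *\<^sub>R g (x + z) = 0" "- z"] by simp
    then show ?thesis by eventually_elim (auto simp: indicator_def)
  qed
  have "AE y in lborel. \<forall>k :: 'n \<Rightarrow> int. y - (\<chi> i. pi * of_int (k i)) \<in> Lam \<longrightarrow> g y = 0"
    unfolding AE_all_countable using cell by blast
  then show ?thesis
  proof eventually_elim
    case (elim y)
    have "y - (\<chi> i. pi * of_int (\<lceil>y $ i / pi\<rceil> - 1)) \<in> Lam"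
    proof -
      have "0 < y $ i - pi * (of_int \<lceil>y $ i / pi\<rceil> - 1) \<and> y $ i - pi * (of_int \<lceil>y $ i / pi\<rceil> - 1) < 2 * pi" for i
      proof -
        have "of_int \<lceil>y $ i / pi\<rceil> - 1 < y $ i / pi" "y $ i / pi \<le> of_int \<lceil>y $ i / pi\<rceil>"
          using ceiling_correct[of "y $ i / pi"] by auto
        then have "(of_int \<lceil>y $ i / pi\<rceil> - 1) * pi < y $ i" "y $ i \<le> of_int \<lceil>y $ i / pi\<rceil> * pi"
          unfolding pos_less_divide_eq[OF pi_gt_zero] pos_divide_le_eq[OF pi_gt_zero] by blast+
        then show ?thesis using pi_gt_zero by (simp add: algebra_simps)
      qed
      then show ?thesis by (simp add: Lam_def)
    qed
    then show ?case using elim[rule_format, of "\<lambda>i. \<lceil>y $ i / pi\<rceil> - 1"] by simp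
  qed
qed

lemma integral_lebesgue_on_Lam:
  fixes g :: "real ^ 'n \<Rightarrow> real"
  assumes "g \<in> borel_measurable borel"
  shows "(LINT x|lebesgue_on Lam. g x) = (LINT x:Lam|lborel. g x)"
proof -
  have "(LINT x|lebesgue_on Lam. g x) = (LINT x|lebesgue. indicator Lam x *\<^sub>R g x)"
    by (rule integral_restrict_space) (simp add: Lam_eq_box)
  also have "\<dots> = (LINT x|lborel. indicator Lam x *\<^sub>R g x)"
    by (rule integral_completion) (use assms in measurable)
  finally show ?thesis by (simp add: set_lebesgue_integral_def)
qed

lemma lebesgue_on_Lam:
  "finite_measure (lebesgue_on (Lam :: (real ^ 'n) set))"
  "(AE x in lborel. P x) \<Longrightarrow> AE x in lebesgue_on (Lam :: (real ^ 'n) set). P x"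
  "g \<in> borel_measurable borel \<Longrightarrow> (g :: real ^ 'n \<Rightarrow> real) \<in> borel_measurable (lebesgue_on Lam)"
proof -
  show "finite_measure (lebesgue_on (Lam :: (real ^ 'n) set))"
    by (intro finite_measure_lebesgue_on) (simp add: Lam_eq_box)
  show "AE x in lebesgue_on (Lam :: (real ^ 'n) set). P x" if "AE x in lborel. P x"
    using AE_completion[OF that] by (subst AE_restrict_space_iff) (auto simp: Lam_eq_box)
  show "g \<in> borel_measurable (lebesgue_on Lam)" if "g \<in> borel_measurable borel"
    using that by (intro measurable_restrict_space1 measurable_completion) simp
qed

lemma integrable_difference_Linf:
  fixes w u0 :: "real ^ 'n \<Rightarrow> real"
  assumes w: "w \<in> borel_measurable lborel" "AE x in lborel. \<bar>w x\<bar> \<le> M" and u0: "u0 \<in> Linf (lebesgue_on Lam)"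
  shows "integrable (lebesgue_on Lam) (\<lambda>x. \<bar>w x - u0 x\<bar>)"
proof -
  have "Linf_norm (lebesgue_on Lam) u0 < \<infinity>" and u0m: "u0 \<in> borel_measurable (lebesgue_on Lam)"
    using u0 by (auto simp: Linf_def)
  then obtain N where "Linf_norm (lebesgue_on Lam) u0 \<le> ereal N"
    by (cases "Linf_norm (lebesgue_on Lam) u0") auto
  then have N: "AE x in lebesgue_on Lam. \<bar>u0 x\<bar> \<le> N"
    using esssup_AE[of "\<lambda>x. ereal \<bar>u0 x\<bar>" "lebesgue_on Lam"] unfolding Linf_norm_def
    by (auto elim!: eventually_mono dest: order_trans)
  have "AE x in lebesgue_on Lam. norm \<bar>w x - u0 x\<bar> \<le> M + N"
    using N lebesgue_on_Lam(2)[OF w(2)] by eventually_elim auto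
  moreover have "(\<lambda>x. \<bar>w x - u0 x\<bar>) \<in> borel_measurable (lebesgue_on Lam)"
    by (intro borel_measurable_abs borel_measurable_diff lebesgue_on_Lam(3) u0m) (use w(1) in simp)
  ultimately show ?thesis
    by (rule finite_measure.integrable_const_bound[OF lebesgue_on_Lam(1)])
qed

section \<open>Uniqueness\<close>

text \<open>
  The inequality \<open>\<integral> 2 \<theta> \<theta>' \<Psi> dt \<ge> 0\<close> says weakly that \<open>\<Psi>\<close> decreases. Let \<open>3 * c = \<Psi> b > 0\<close>. The cut-off \<open>\<theta>\<close>
  climbs to \<open>j\<close> on \<open>[a, a + h]\<close>, where \<open>\<Psi> < c\<close> almost everywhere, and falls back to \<open>0\<close> on \<open>[b, b + h]\<close>,
  where \<open>\<Psi> \<ge> 2 * c\<close>. Since \<open>2 \<theta> \<theta>'\<close> is the derivative of \<open>\<theta>\<^sup>2\<close>, the integral is at most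
  \<open>c * j\<^sup>2 - 2 * c * j\<^sup>2 < 0\<close>.
\<close>

lemma kato_vanishing:
  fixes \<Psi> :: "real \<Rightarrow> real"
  assumes T: "0 < T" and b: "b \<in> {0<..<T}"
    and \<Psi>: "\<Psi> \<in> borel_measurable borel" "\<And>t. 0 \<le> \<Psi> t" "\<And>t. \<Psi> t \<le> C"
    and initial: "\<And>\<epsilon>. 0 < \<epsilon> \<Longrightarrow> \<exists>\<delta>>0. AE t in lborel. 0 < t \<and> t < \<delta> \<longrightarrow> \<Psi> t < \<epsilon>"
    and lower: "\<And>\<epsilon>. 0 < \<epsilon> \<Longrightarrow> \<exists>\<delta>>0. \<forall>s\<in>{0..T}. \<bar>s - b\<bar> < \<delta> \<longrightarrow> \<Psi> b - \<epsilon> \<le> \<Psi> s"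
    and kato: "\<And>\<theta> \<theta>'. smooth_real \<theta> \<Longrightarrow> (\<And>t. (\<theta> has_real_derivative \<theta>' t) (at t)) \<Longrightarrow> (\<And>t. 0 \<le> \<theta> t) \<Longrightarrow>
       continuous_on UNIV \<theta>' \<Longrightarrow> \<exists>a b. 0 < a \<and> b < T \<and> (\<forall>t. t \<notin> {a..b} \<longrightarrow> \<theta> t = 0 \<and> \<theta>' t = 0) \<Longrightarrow>
       0 \<le> (LINT t:{0<..<T}|lborel. (2 * \<theta> t * \<theta>' t) * \<Psi> t)"
  shows "\<Psi> b = 0"
proof (rule ccontr)
  assume "\<Psi> b \<noteq> 0"
  define c where "c = \<Psi> b / 3"
  have c: "0 < c" using \<open>\<Psi> b \<noteq> 0\<close> \<Psi>(2)[of b] by (simp add: c_def)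
  obtain \<delta>1 where \<delta>1: "0 < \<delta>1" "\<And>s. s \<in> {0..T} \<Longrightarrow> \<bar>s - b\<bar> < \<delta>1 \<Longrightarrow> 2 * c \<le> \<Psi> s"
  proof -
    obtain \<delta>1 where "0 < \<delta>1" and *: "\<forall>s\<in>{0..T}. \<bar>s - b\<bar> < \<delta>1 \<longrightarrow> \<Psi> b - c \<le> \<Psi> s"
      using lower[OF c] by blast
    moreover have "\<Psi> b - c = 2 * c" by (simp add: c_def)
    ultimately show thesis using that by auto
  qed
  obtain \<delta>0 where \<delta>0: "0 < \<delta>0" "AE t in lborel. 0 < t \<and> t < \<delta>0 \<longrightarrow> \<Psi> t < c"
    using initial[OF c] by blast
  define a where "a = min \<delta>0 b / 3"
  define h where "h = min a (min (\<delta>1 / 2) ((T - b) / 2))"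
  have b': "0 < b" "b < T" using b by auto
  have a: "0 < a" "2 * a < \<delta>0" "2 * a < b" using \<delta>0(1) b' by (auto simp: a_def)
  have "0 < h" using a(1) \<delta>1(1) b' by (simp add: h_def)
  moreover have "h \<le> a" "h \<le> \<delta>1 / 2" "h \<le> (T - b) / 2" unfolding h_def by linarith+
  then have "h \<le> a" "h * 2 \<le> \<delta>1" "h * 2 \<le> T - b" by simp_all
  ultimately have h: "0 < h" "h \<le> a" "h < \<delta>1" "b + h < T" by linarith+
  obtain J J' j where J: "smooth_real J" "smooth_real J'" "\<And>x. (J has_real_derivative J' x) (at x)" "\<And>x. 0 \<le> J' x"
    "\<And>x. x \<le> 0 \<Longrightarrow> J x = 0" "\<And>x. 1 \<le> x \<Longrightarrow> J x = j" "0 < j" "\<And>x. x \<le> 0 \<or> 1 \<le> x \<Longrightarrow> J' x = 0"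
    using smooth_step_exists by metis
  define \<theta> where "\<theta> t = J ((t - a) / h) - J ((t - b) / h)" for t
  define \<theta>' where "\<theta>' t = (J' ((t - a) / h) - J' ((t - b) / h)) / h" for t
  have smooth: "smooth_real \<theta>"
  proof -
    have sm: "(\<lambda>t. J ((t - x) / h)) \<in> smooth_algebra" for x
      using smooth_algebra.comp[OF smooth_real_affine[OF J(1), of 1 "1 / h" "- x / h"] bounded_linear_ident]
      by (simp add: diff_divide_distrib)
    have "(\<lambda>t. J ((t - a) / h) + (- 1) * J ((t - b) / h)) \<in> smooth_algebra"
      by (intro smooth_algebra.add smooth_algebra.mult smooth_algebra.const sm)
    moreover have "(\<lambda>t. J ((t - a) / h) + (- 1) * J ((t - b) / h)) = \<theta>"
      by (simp add: \<theta>_def fun_eq_iff)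
    ultimately show ?thesis using smooth_algebra_smooth_real by simp
  qed
  have deriv: "(\<theta> has_real_derivative \<theta>' t) (at t)" for t
  proof -
    have "((\<lambda>t. J ((t - x) / h)) has_real_derivative J' ((t - x) / h) * (1 / h)) (at t)" for x
      by (rule DERIV_chain2[OF J(3)]) (use h(1) in \<open>auto intro!: derivative_eq_intros\<close>)
    from DERIV_diff[OF this[of a] this[of b]] show ?thesis
      by (simp add: \<theta>_def[abs_def] \<theta>'_def diff_divide_distrib)
  qed
  have J'_cont: "continuous_on UNIV J'" by (rule smooth_real_continuous[OF J(2)])
  have cont': "continuous_on UNIV \<theta>'"
    unfolding \<theta>'_def by (intro continuous_intros continuous_on_compose2[OF J'_cont]) (use h(1) in auto)
  have cont: "continuous_on UNIV \<theta>"
    using deriv by (auto intro!: continuous_at_imp_continuous_on DERIV_isCont)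
  have J_mono: "x \<le> y \<Longrightarrow> J x \<le> J y" for x y
    by (rule DERIV_nonneg_imp_nondecreasing) (blast intro: J(3,4))+
  have nonneg: "0 \<le> \<theta> t" for t
    unfolding \<theta>_def using a b' h(1) by (auto intro!: J_mono divide_right_mono)
  have outside: "\<theta> t = 0 \<and> \<theta>' t = 0" if t: "t \<notin> {a..b + h}" for t
  proof -
    consider "t < a" | "b + h < t" using t unfolding atLeastAtMost_iff by argo
    then show ?thesis
    proof cases
      case 1
      then have "(t - a) / h \<le> 0" "(t - b) / h \<le> 0" using a(1,3) h(1) by (auto simp: divide_le_0_iff)
      then show ?thesis by (simp add: \<theta>_def \<theta>'_def J)
    next
      case 2
      then have "1 \<le> (t - a) / h" "1 \<le> (t - b) / h" using a(1,3) h(1) by (auto simp: le_divide_eq)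
      then show ?thesis by (simp add: \<theta>_def \<theta>'_def J)
    qed
  qed
  define g where "g t = 2 * \<theta> t * \<theta>' t" for t
  have g_cont: "continuous_on UNIV g"
    unfolding g_def by (intro continuous_intros cont cont')
  have [measurable]: "g \<in> borel_measurable borel" using g_cont by (rule borel_measurable_continuous_onI)
  note [measurable] = \<Psi>(1)
  have pos: "0 \<le> (LINT t:{0<..<T}|lborel. g t * \<Psi> t)"
    unfolding g_def
  proof (rule kato[OF smooth deriv nonneg cont'])
    show "\<exists>a b. 0 < a \<and> b < T \<and> (\<forall>t. t \<notin> {a..b} \<longrightarrow> \<theta> t = 0 \<and> \<theta>' t = 0)"
      using a(1) h(4) outside by (intro exI[of _ a] exI[of _ "b + h"]) auto
  qed
  have FTC: "(LINT t|lborel. indicator {x..y} t *\<^sub>R g t) = (\<theta> y)\<^sup>2 - (\<theta> x)\<^sup>2" if "x \<le> y" for x y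
  proof (rule integral_FTC_Icc[OF that])
    fix t
    have "((\<lambda>t. (\<theta> t)\<^sup>2) has_real_derivative g t) (at t)"
      unfolding g_def by (auto intro!: derivative_eq_intros deriv)
    then show "((\<lambda>t. (\<theta> t)\<^sup>2) has_vector_derivative g t) (at t within {x..y})"
      by (auto simp: has_real_derivative_iff_has_vector_derivative intro: has_vector_derivative_at_within)
  qed (rule continuous_on_subset[OF g_cont], simp)
  have ends: "\<theta> 0 = 0" "\<theta> T = 0" using outside[of 0] outside[of T] a(1) h(4) by auto
  have \<theta>_b: "\<theta> b = j"
  proof -
    have "1 \<le> (b - a) / h" using a(3) h(1,2) by (simp add: le_divide_eq)
    then show ?thesis by (simp add: \<theta>_def J)
  qed
  have \<theta>_bh: "\<theta> (b + h) = 0"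
  proof -
    have "1 \<le> (b + h - a) / h" using a(3) h(1,2) by (simp add: le_divide_eq)
    then show ?thesis using h(1) by (simp add: \<theta>_def J)
  qed
  \<comment> \<open>The part of the derivative of the square on the falling edge; its integral is minus the squared height.\<close>
  let ?\<chi> = "\<lambda>t. indicator {b..b + h} t * g t"
  have int1: "(LINT t:{0<..<T}|lborel. g t) = 0"
  proof -
    have "(LINT t:{0<..<T}|lborel. g t) = (LINT t|lborel. indicator {0..T} t *\<^sub>R g t)"
      unfolding set_lebesgue_integral_def
    proof (rule Bochner_Integration.integral_cong[OF refl])
      fix t show "indicat_real {0<..<T} t *\<^sub>R g t = indicat_real {0..T} t *\<^sub>R g t"
        using ends by (cases "t = 0 \<or> t = T") (auto simp: indicator_def g_def)
    qed
    then show ?thesis using FTC[of 0 T] T ends by simp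
  qed
  have int2: "(LINT t:{0<..<T}|lborel. ?\<chi> t) = - j\<^sup>2"
  proof -
    have "(LINT t:{0<..<T}|lborel. ?\<chi> t) = (LINT t|lborel. indicator {b..b + h} t *\<^sub>R g t)"
      unfolding set_lebesgue_integral_def
      by (rule Bochner_Integration.integral_cong) (use b' h(4) in \<open>auto simp: indicator_def\<close>)
    then show ?thesis using FTC[of b "b + h"] h(1) \<theta>_b \<theta>_bh by simp
  qed
  obtain B where "\<And>t. t \<in> {0..T} \<Longrightarrow> \<bar>g t\<bar> \<le> B"
    using continuous_bounded_Icc[OF g_cont] by blast
  then have B: "\<bar>g t\<bar> \<le> B" if "t \<in> {0<..<T}" for t using that by simp
  have i0: "set_integrable lborel {0<..<T} g"
    by (rule set_integrable_lborel_bounded[where C = B]) (use B in auto)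
  have i1: "set_integrable lborel {0<..<T} ?\<chi>"
  proof (rule set_integrable_lborel_bounded[where C = B])
    show "\<bar>?\<chi> t\<bar> \<le> B" if "t \<in> {0<..<T}" for t
      using B[OF that] by (cases "t \<in> {b..b + h}") auto
  qed auto
  have i2: "set_integrable lborel {0<..<T} (\<lambda>t. g t * \<Psi> t)"
  proof (rule set_integrable_lborel_bounded[where C = "B * C"])
    show "\<bar>g t * \<Psi> t\<bar> \<le> B * C" if "t \<in> {0<..<T}" for t
      unfolding abs_mult using B[OF that] \<Psi>(2,3)[of t] by (intro mult_mono) auto
  qed auto
  have "(LINT t:{0<..<T}|lborel. g t * \<Psi> t) \<le> (LINT t:{0<..<T}|lborel. c * g t + c * ?\<chi> t)"
  proof (rule set_integral_mono_AE[OF i2])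
    show "set_integrable lborel {0<..<T} (\<lambda>t. c * g t + c * ?\<chi> t)"
      by (intro set_integral_add(1) set_integrable_mult_right i0 i1)
    from \<delta>0(2) show "AE t\<in>{0<..<T} in lborel. g t * \<Psi> t \<le> c * g t + c * ?\<chi> t"
    proof eventually_elim
      case (elim t)
      show ?case
      proof
        consider "t < a \<or> b + h < t" | "t \<in> {a..a + h}" | "a + h < t" "t < b" | "t \<in> {b..b + h}"
          unfolding atLeastAtMost_iff by argo
        then show "g t * \<Psi> t \<le> c * g t + c * ?\<chi> t"
        proof cases
          case 1
          then have "g t = 0" using outside[of t] by (auto simp: g_def)
          then show ?thesis by simp
        next
          case 2
          then have t: "t < \<delta>0" "0 < t" "t < b" using a h(2) by auto
          then have "(t - b) / h \<le> 0" using h(1) by (auto simp: divide_le_0_iff)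
          then have "0 \<le> \<theta>' t" using J(4) h(1) by (simp add: \<theta>'_def J(8))
          then have "0 \<le> g t" using nonneg by (simp add: g_def)
          moreover have "\<Psi> t \<le> c" using elim t by simp
          ultimately have "g t * \<Psi> t \<le> g t * c" by (intro mult_left_mono)
          then show ?thesis using t by (simp add: mult.commute)
        next
          case 3
          then have "1 \<le> (t - a) / h" "(t - b) / h \<le> 0" using h(1) by (auto simp: le_divide_eq divide_le_0_iff)
          then have "g t = 0" by (simp add: g_def \<theta>'_def J(8))
          then show ?thesis by simp
        next
          case 4
          then have "1 \<le> (t - a) / h" using h(1,2) a by (simp add: le_divide_eq)
          then have "\<theta>' t \<le> 0" using J(4) h(1) by (simp add: \<theta>'_def J(8) divide_le_0_iff)
          then have "g t \<le> 0" using nonneg by (simp add: g_def mult_nonneg_nonpos)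
          moreover have "2 * c \<le> \<Psi> t" using 4 b' h by (intro \<delta>1(2)) auto
          ultimately have "g t * \<Psi> t \<le> g t * (2 * c)" by (intro mult_left_mono_neg)
          then show ?thesis using 4 by (simp add: algebra_simps)
        qed
      qed
    qed
  qed
  also have "\<dots> = c * (LINT t:{0<..<T}|lborel. g t) + c * (LINT t:{0<..<T}|lborel. ?\<chi> t)"
    by (subst set_integral_add(2)) (intro set_integrable_mult_right i0 i1, intro set_integrable_mult_right i0 i1,
      simp only: set_integral_mult_right)
  also have "\<dots> = - (c * j\<^sup>2)" unfolding int1 int2 by simp
  also have "\<dots> < 0" using c J(7) by simp
  finally show False using pos by simp
qed

theorem corollary2p3:
  fixes T :: real
    and s :: nat
    and f :: "'n::finite \<Rightarrow> real \<Rightarrow> real"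
    and \<mu> :: "(real ^ 'n) measure"
    and u0 :: "real ^ 'n \<Rightarrow> real"
    and u v :: "real \<Rightarrow> real ^ 'n \<Rightarrow> real"
  assumes "0 < T"
    and "4 + CARD('n) div 2 < s"
    and "\<And>j. Ck_on s (f j) UNIV"
    and "radon_measure_on (- {0}) \<mu>"
    and "(\<integral>\<^sup>+ z. ennreal (min ((norm z)\<^sup>2) 1) \<partial>\<mu>) < \<infinity>"
    and "AE_periodic u0"
    and "u0 \<in> Linf (lebesgue_on Lam) \<inter> BV Lam"
    and "periodic_entropy_solution T f \<mu> u0 u"
    and "periodic_entropy_solution T f \<mu> u0 v"
  shows "\<forall>t\<in>{0..T}. AE x in lborel. u t x = v t x"
proof -
  note T = \<open>0 < T\<close>
  interpret levy_measure \<mu>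
    by standard (use assms(4,5) in \<open>auto simp: radon_measure_on_def\<close>)
  have f: "continuous_on UNIV (f j)" for j
  proof -
    obtain k where "s = Suc k" using assms(2) by (cases s) auto
    then show ?thesis
      using assms(3)[of j] by (auto intro!: continuous_at_imp_continuous_on differentiable_imp_continuous_within)
  qed
  have uC: "u \<in> C_Linf_p T" and vC: "v \<in> C_Linf_p T"
    using assms(8,9) by (auto simp: periodic_entropy_solution_def)
  obtain U Mu where U: "U \<in> borel_measurable borel" "\<And>p. \<bar>U p\<bar> \<le> Mu" "\<And>t. periodic (\<lambda>x. U (t, x))"
    "\<And>t. t \<in> {0..T} \<Longrightarrow> AE x in lborel. U (t, x) = u t x"
    by (rule C_Linf_p_periodic_representative[OF uC]) blast
  obtain V Mv where V: "V \<in> borel_measurable borel" "\<And>p. \<bar>V p\<bar> \<le> Mv" "\<And>t. periodic (\<lambda>x. V (t, x))"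
    "\<And>t. t \<in> {0..T} \<Longrightarrow> AE x in lborel. V (t, x) = v t x"
    by (rule C_Linf_p_periodic_representative[OF vC]) blast
  define m where "m = max Mu Mv"
  have Um: "\<bar>U p\<bar> \<le> m" and Vm: "\<bar>V p\<bar> \<le> m" for p
    using U(2)[of p] V(2)[of p] by (auto simp: m_def)
  have diff_b: "\<bar>U p - V q\<bar> \<le> 2 * m" for p q
    using Um[of p] Vm[of q] by linarith
  have m: "0 \<le> m" using Um[of 0] by linarith
  define \<Psi> where "\<Psi> t = (LINT x:Lam|lborel. \<bar>U (t, x) - V (t, x)\<bar>)" for t
  define L where "L = measure lborel (Lam :: (real ^ 'n) set)"
  have L: "0 \<le> L" by (simp add: L_def)
  have Lam_const: "(LINT x:(Lam :: (real ^ 'n) set)|lborel. c) = c * L" for c :: real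
    by (simp add: set_lebesgue_integral_def L_def)
  have slice: "(\<lambda>x. \<bar>U (t, x) - V (t, x)\<bar>) \<in> borel_measurable borel" for t
    by (intro borel_measurable_abs borel_measurable_diff measurable_Pair_left U(1) V(1))
  have slice_int: "set_integrable lborel Lam (\<lambda>x. \<bar>U (t, x) - V (t, x)\<bar>)" for t
    by (rule set_integrable_lborel_bounded[OF Lam_borel bounded_Lam slice, where C = "2 * m"]) (simp add: diff_b)
  have const_int: "set_integrable lborel (Lam :: (real ^ 'n) set) (\<lambda>_. c)" for c :: real
    by (rule set_integrable_lborel_bounded[OF Lam_borel bounded_Lam]) auto
  have \<Psi>_nonneg: "0 \<le> \<Psi> t" for t
    unfolding \<Psi>_def set_lebesgue_integral_def by (intro integral_nonneg_AE AE_I2) simp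
  have \<Psi>_le: "\<Psi> t \<le> 2 * m * L" for t
    using set_integral_mono[OF slice_int[of t] const_int[of "2 * m"] diff_b] by (simp add: \<Psi>_def Lam_const ac_simps)
  have \<Psi>_meas: "\<Psi> \<in> borel_measurable borel"
  proof -
    have "(\<lambda>p. indicat_real Lam (snd p) *\<^sub>R \<bar>U p - V p\<bar>) \<in> borel_measurable borel"
      using U(1) V(1) by (intro borel_measurable_scaleR measurable_compose[OF snd_borel]) measurable
    then have "(\<lambda>p. indicat_real Lam (snd p) *\<^sub>R \<bar>U p - V p\<bar>) \<in> borel_measurable (borel \<Otimes>\<^sub>M lborel)"
      unfolding measurable_cong_sets[OF sets_borel_pair_lborel refl] .
    then show ?thesis
      unfolding \<Psi>_def set_lebesgue_integral_def
      by (intro lborel.borel_measurable_lebesgue_integral) (simp add: case_prod_beta')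
  qed
  have initial: "\<exists>\<delta>>0. AE t in lborel. 0 < t \<and> t < \<delta> \<longrightarrow> \<Psi> t < \<epsilon>" if e: "0 < \<epsilon>" for \<epsilon>
  proof -
    define A where "A w = (\<lambda>t. LINT x|lebesgue_on Lam. \<bar>w t x - u0 x\<bar>)" for w :: "real \<Rightarrow> real ^ 'n \<Rightarrow> real"
    have "esslim_0 (A u) 0" "esslim_0 (A v) 0"
      using assms(8,9) by (simp_all add: periodic_entropy_solution_def A_def)
    then obtain d1 d2 where d: "0 < d1" "0 < d2" "AE t in lborel. 0 < t \<and> t < d1 \<longrightarrow> \<bar>A u t - 0\<bar> < \<epsilon> / 2"
      "AE t in lborel. 0 < t \<and> t < d2 \<longrightarrow> \<bar>A v t - 0\<bar> < \<epsilon> / 2"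
      unfolding esslim_0_def using half_gt_zero[OF e] by blast
    have tri: "\<Psi> t \<le> A u t + A v t" if t: "t \<in> {0..T}" for t
    proof -
      have um: "u t \<in> borel_measurable lborel" and vm: "v t \<in> borel_measurable lborel"
        using uC vC t by (auto simp: C_Linf_p_def Linf_p_def Linf_def)
      have "AE x in lborel. \<bar>u t x\<bar> \<le> m"
        using U(4)[OF t] by eventually_elim (metis Um)
      then have iu: "integrable (lebesgue_on Lam) (\<lambda>x. \<bar>u t x - u0 x\<bar>)"
        using assms(7) by (intro integrable_difference_Linf[OF um]) auto
      have "AE x in lborel. \<bar>v t x\<bar> \<le> m"
        using V(4)[OF t] by eventually_elim (metis Vm)
      then have iv: "integrable (lebesgue_on Lam) (\<lambda>x. \<bar>v t x - u0 x\<bar>)"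
        using assms(7) by (intro integrable_difference_Linf[OF vm]) auto
      have "\<Psi> t = (LINT x|lebesgue_on Lam. \<bar>U (t, x) - V (t, x)\<bar>)"
        unfolding \<Psi>_def by (rule integral_lebesgue_on_Lam[OF slice, symmetric])
      also have "\<dots> \<le> (LINT x|lebesgue_on Lam. \<bar>u t x - u0 x\<bar> + \<bar>v t x - u0 x\<bar>)"
      proof (rule integral_mono_AE)
        show "integrable (lebesgue_on Lam) (\<lambda>x. \<bar>U (t, x) - V (t, x)\<bar>)"
          by (rule finite_measure.integrable_const_bound[OF lebesgue_on_Lam(1) _ lebesgue_on_Lam(3)[OF slice], where B = "2 * m"])
            (simp add: diff_b)
        show "AE x in lebesgue_on Lam. \<bar>U (t, x) - V (t, x)\<bar> \<le> \<bar>u t x - u0 x\<bar> + \<bar>v t x - u0 x\<bar>"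
          using lebesgue_on_Lam(2)[OF U(4)[OF t]] lebesgue_on_Lam(2)[OF V(4)[OF t]]
          by eventually_elim auto
      qed (use iu iv in auto)
      also have "\<dots> = A u t + A v t" using iu iv by (simp add: A_def)
      finally show ?thesis .
    qed
    have "AE t in lborel. 0 < t \<and> t < min (min d1 d2) T \<longrightarrow> \<Psi> t < \<epsilon>"
      using d(3,4)
    proof eventually_elim
      case (elim t)
      show ?case
      proof
        assume t: "0 < t \<and> t < min (min d1 d2) T"
        with elim have "\<bar>A u t\<bar> < \<epsilon> / 2" "\<bar>A v t\<bar> < \<epsilon> / 2" by auto
        moreover have "\<Psi> t \<le> A u t + A v t" using t by (intro tri) auto
        ultimately show "\<Psi> t < \<epsilon>" by (auto simp: abs_if split: if_splits)
      qed
    qed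
    then show ?thesis using d(1,2) T by (intro exI[of _ "min (min d1 d2) T"]) auto
  qed
  have lower: "\<exists>\<delta>>0. \<forall>s\<in>{0..T}. \<bar>s - b\<bar> < \<delta> \<longrightarrow> \<Psi> b - \<epsilon> \<le> \<Psi> s" if b: "b \<in> {0..T}" and e: "0 < \<epsilon>" for b \<epsilon>
  proof -
    \<comment> \<open>Closeness of both solutions in the supremum norm, tuned to the volume of the cell.\<close>
    define \<eta> where "\<eta> = \<epsilon> / (2 * (L + 1))"
    have \<eta>: "0 < \<eta>" "2 * \<eta> * L \<le> \<epsilon>" using e L by (auto simp: \<eta>_def field_simps)
    obtain d1 where d1: "0 < d1" "\<And>s. s \<in> {0..T} \<Longrightarrow> \<bar>s - b\<bar> < d1 \<Longrightarrow> AE x in lborel. \<bar>u s x - u b x\<bar> \<le> \<eta>"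
      using C_Linf_p_AE_close[OF uC b \<eta>(1)] by metis
    obtain d2 where d2: "0 < d2" "\<And>s. s \<in> {0..T} \<Longrightarrow> \<bar>s - b\<bar> < d2 \<Longrightarrow> AE x in lborel. \<bar>v s x - v b x\<bar> \<le> \<eta>"
      using C_Linf_p_AE_close[OF vC b \<eta>(1)] by metis
    have "\<Psi> b - \<epsilon> \<le> \<Psi> s" if s: "s \<in> {0..T}" "\<bar>s - b\<bar> < min d1 d2" for s
    proof -
      have "\<Psi> b \<le> (LINT x:Lam|lborel. \<bar>U (s, x) - V (s, x)\<bar> + 2 * \<eta>)"
        unfolding \<Psi>_def
      proof (rule set_integral_mono_AE[OF slice_int])
        show "set_integrable lborel Lam (\<lambda>x. \<bar>U (s, x) - V (s, x)\<bar> + 2 * \<eta>)"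
          by (intro set_integral_add(1) slice_int const_int)
        have "AE x in lborel. \<bar>u s x - u b x\<bar> \<le> \<eta>" "AE x in lborel. \<bar>v s x - v b x\<bar> \<le> \<eta>"
          using d1(2) d2(2) s by auto
        with U(4)[OF s(1)] U(4)[OF b] V(4)[OF s(1)] V(4)[OF b]
        show "AE x\<in>Lam in lborel. \<bar>U (b, x) - V (b, x)\<bar> \<le> \<bar>U (s, x) - V (s, x)\<bar> + 2 * \<eta>"
          by eventually_elim auto
      qed
      also have "\<dots> = \<Psi> s + 2 * \<eta> * L"
        unfolding \<Psi>_def set_integral_add(2)[OF slice_int const_int] Lam_const ..
      finally show ?thesis using \<eta>(2) by linarith
    qed
    then show ?thesis using d1(1) d2(1) by (intro exI[of _ "min d1 d2"]) auto
  qed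
  have kato: "0 \<le> (LINT t:{0<..<T}|lborel. (2 * \<theta> t * \<theta>' t) * \<Psi> t)"
    if \<theta>: "smooth_real \<theta>" "\<And>t. (\<theta> has_real_derivative \<theta>' t) (at t)" "\<And>t. 0 \<le> \<theta> t" "continuous_on UNIV \<theta>'"
      and supp: "\<exists>a b. 0 < a \<and> b < T \<and> (\<forall>t. t \<notin> {a..b} \<longrightarrow> \<theta> t = 0 \<and> \<theta>' t = 0)" for \<theta> \<theta>'
  proof -
    have cont: "continuous_on UNIV (\<lambda>t. 2 * \<theta> t * \<theta>' t)"
      using \<theta>(2) by (intro continuous_intros \<theta>(4)) (auto intro!: continuous_at_imp_continuous_on DERIV_isCont)
    obtain B where "\<And>t. t \<in> {0..T} \<Longrightarrow> \<bar>2 * \<theta> t * \<theta>' t\<bar> \<le> B"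
      using continuous_bounded_Icc[OF cont] by blast
    then have B: "\<bar>2 * \<theta> t * \<theta>' t\<bar> \<le> B" if "t \<in> {0<..<T}" for t using that by simp
    let ?F = "\<lambda>p. \<bar>U p - V p\<bar> * (2 * \<theta> (fst p) * \<theta>' (fst p))"
    have F: "?F \<in> borel_measurable borel"
      by (intro borel_measurable_times borel_measurable_abs borel_measurable_diff U(1) V(1)
          measurable_compose[OF fst_borel borel_measurable_continuous_onI[OF cont]])
    have Fb: "\<bar>?F (t, x)\<bar> \<le> 2 * m * B" if "t \<in> {0<..<T}" for t x
      unfolding abs_mult[of "\<bar>U (t, x) - V (t, x)\<bar>"] using diff_b[of "(t, x)" "(t, x)"] B[OF that] m
      by (intro mult_mono) auto
    have "0 \<le> (LINT p:{0<..<T} \<times> Lam|lborel. ?F p)"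
      by (rule kato_inequality[OF f T assms(8,9) U(1) Um U(3,4) V(1) Vm V(3,4) \<theta>(1-3) supp])
    also have "\<dots> = (LINT t:{0<..<T}|lborel. LINT x:Lam|lborel. ?F (t, x))"
      by (rule set_integral_Times_iterated(1)[OF _ _ Lam_borel bounded_Lam F Fb]) auto
    also have "\<dots> = (LINT t:{0<..<T}|lborel. (2 * \<theta> t * \<theta>' t) * \<Psi> t)"
      by (simp add: \<Psi>_def mult.commute)
    finally show ?thesis .
  qed
  have interior: "AE x in lborel. u b x = v b x" if b: "b \<in> {0<..<T}" for b
  proof -
    have b': "b \<in> {0..T}" using b by simp
    have "\<Psi> b = 0"
      by (rule kato_vanishing[OF T b \<Psi>_meas \<Psi>_nonneg \<Psi>_le initial lower[OF b'] kato])
    then have "AE x in lborel. \<bar>U (b, x) - V (b, x)\<bar> = 0"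
      using U(3)[of b] V(3)[of b] diff_b
      by (intro AE_periodic_extension[OF _ slice, where M = "2 * m"]) (auto simp: periodic_def \<Psi>_def)
    with U(4)[OF b'] V(4)[OF b'] show ?thesis by eventually_elim simp
  qed
  show ?thesis
  proof
    fix t assume t: "t \<in> {0..T}"
    have close: "AE x in lborel. \<bar>u t x - v t x\<bar> \<le> 2 * e" if e: "0 < e" for e
    proof -
      obtain d1 where d1: "0 < d1" "\<And>s. s \<in> {0..T} \<Longrightarrow> \<bar>s - t\<bar> < d1 \<Longrightarrow> AE x in lborel. \<bar>u s x - u t x\<bar> \<le> e"
        using C_Linf_p_AE_close[OF uC t e] by metis
      obtain d2 where d2: "0 < d2" "\<And>s. s \<in> {0..T} \<Longrightarrow> \<bar>s - t\<bar> < d2 \<Longrightarrow> AE x in lborel. \<bar>v s x - v t x\<bar> \<le> e"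
        using C_Linf_p_AE_close[OF vC t e] by metis
      define d where "d = min (min d1 d2) T / 2"
      have d: "0 < d" "d < d1" "d < d2" "d < T" using d1(1) d2(1) T by (auto simp: d_def)
      \<comment> \<open>An interior time close to t, needed when t is one of the two end points.\<close>
      obtain s where s: "s \<in> {0<..<T}" "\<bar>s - t\<bar> \<le> d"
      proof (cases "t < d")
        case True
        then show thesis using that[of d] t d by auto
      next
        case False
        then show thesis using that[of "t - d / 2"] t d by auto
      qed
      have "AE x in lborel. \<bar>u s x - u t x\<bar> \<le> e" "AE x in lborel. \<bar>v s x - v t x\<bar> \<le> e"
        using s d by (auto intro!: d1(2) d2(2))
      with interior[OF s(1)] show ?thesis by eventually_elim auto
    qed
    have "AE x in lborel. \<forall>k::nat. \<bar>u t x - v t x\<bar> \<le> 2 * (1 / real (Suc k))"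
      unfolding AE_all_countable by (intro allI close) simp
    then show "AE x in lborel. u t x = v t x"
    proof eventually_elim
      case (elim x)
      show ?case
      proof (rule ccontr)
        assume "u t x \<noteq> v t x"
        then have "0 < \<bar>u t x - v t x\<bar> / 2" by simp
        then obtain k where "inverse (real (Suc k)) < \<bar>u t x - v t x\<bar> / 2" using reals_Archimedean by blast
        with elim[rule_format, of k] show False by (simp add: field_simps)
      qed
    qed
  qed
qed

end
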